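(* Fix $A>0$. Let $k=k(X)$ be an integer-valued function of the real variable $X$ such that $k\to\infty$ as $X\to\infty$ and $k\le A\log X$. Then, as $X\to\infty$, $$V(k)=(2-\log(2\pi)+o(1))\,k\log k$$ and $$\frac{U_k(n)-m(k)}{\sqrt{V(k)}}\Rightarrow \mathcal N(0,1)\qquad (n\text{ uniform in }\mathcal I_X),$$ where $\Rightarrow$ denotes convergence in distribution. In addition, $$\mathbb E_X U_k(n)=m(k)+o(\sqrt{V(k)}),\qquad \operatorname{Var}_X(U_k(n))\sim V(k),$$ and consequently $$\frac{U_k(n)-\mathbb E_XU_k(n)}{\sqrt{\operatorname{Var}_X(U_k(n))}}\Rightarrow\mathcal N(0,1).$$
   Context: All logarithms are natural; $p$ always denotes a prime. For integers $0\le k\le n$ let $u(n,k):=\prod_{p\le k}p^{\nu_p\binom nk}$, where $\nu_p$ is the $p$-adic valuation, and $U_k(n):=\log u(n,k)$. For real $X\ge 3$ let $\mathcal I_X:=\{n\in\mathbb Z: X\le n<2X\}$; $\mathbb P_X$, $\mathbb E_X$, $\operatorname{Var}_X$ denote probability, expectation and variance when $n$ is chosen uniformly from $\mathcal I_X$. For an integer $q\ge1$, $[x]_q$ is the least non-negative residue of the integer $x$ modulo $q$. For $k\ge1$ define $$m(k):=\sum_{p\le k}\log p\sum_{a\ge1}\frac{[k]_{p^a}}{p^a}$$ (a convergent series). For $k\ge2$ define $\alpha_p(k):=\frac{[k]_p}{p}=\{k/p\}$ (fractional part) and $$V(k):=\sum_{p\le k}(\log p)^2\alpha_p(k)(1-\alpha_p(k)).$$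 ($U_k(n)$ is defined for all $n\in\mathcal I_X$ once $X$ is large, since then $k\le A\log X<X\le n$.) *)

theory Defs
  imports "HOL-Probability.Probability" "HOL-Library.Landau_Symbols"
    "HOL-Computational_Algebra.Primes"
begin

text \<open>
  The variables \<open>n\<close>, \<open>k\<close>, \<open>p\<close> range over the integers throughout. The notions below are meant for
  \<open>0 \<le> k \<le> n\<close>; the values outside that range are irrelevant for the asymptotic statements.
  Recall that \<^term>\<open>prime (p :: int)\<close> entails \<open>p > 0\<close>.
\<close>

definition primes_upto :: "int \<Rightarrow> int set" where
  "primes_upto k = {p. prime p \<and> p \<le> k}"

definition smooth_part_binom :: "int \<Rightarrow> int \<Rightarrow> int" where
  "smooth_part_binom n k =
     (\<Prod>p\<in>primes_upto k. p ^ multiplicity p (int (nat n choose nat k)))"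

definition U :: "int \<Rightarrow> int \<Rightarrow> real" where
  "U k n = ln (real_of_int (smooth_part_binom n k))"

text \<open>
  The least non-negative residue of \<open>k\<close> modulo \<open>q \<ge> 1\<close> is \<^term>\<open>k mod q\<close>. The inner sum over all
  exponents \<open>a \<ge> 1\<close> is indexed by \<open>a = Suc j\<close>.
\<close>

definition mean_const :: "int \<Rightarrow> real" where
  "mean_const k =
     (\<Sum>p\<in>primes_upto k. ln (real_of_int p) *
        (\<Sum>j. real_of_int (k mod p ^ Suc j) / real_of_int (p ^ Suc j)))"

definition alpha :: "int \<Rightarrow> int \<Rightarrow> real" where
  "alpha p k = real_of_int (k mod p) / real_of_int p"

definition V :: "int \<Rightarrow> real" where
  "V k = (\<Sum>p\<in>primes_upto k. (ln (real_of_int p))\<^sup>2 * alpha p k * (1 - alpha p k))"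

definition dyadic_ints :: "real \<Rightarrow> int set" where
  "dyadic_ints X = {n. X \<le> real_of_int n \<and> real_of_int n < 2 * X}"

text \<open>Meaningful for \<open>X \<ge> 3\<close>, where the interval is finite and nonempty (see below).\<close>

definition unif :: "real \<Rightarrow> int pmf" where
  "unif X = pmf_of_set (dyadic_ints X)"

text \<open>
  Weak convergence along an arbitrary filter; the library's \<^const>\<open>weak_conv_m\<close> is the
  case of sequences.
\<close>

definition weak_conv_along :: "('i \<Rightarrow> real measure) \<Rightarrow> real measure \<Rightarrow> 'i filter \<Rightarrow> bool" where
  "weak_conv_along M N F \<longleftrightarrow>
     (\<forall>x. isCont (cdf N) x \<longrightarrow> ((\<lambda>i. cdf (M i) x) \<longlongrightarrow> cdf N x) F)"

lemma weak_conv_along_sequentially: "weak_conv_along M N sequentially \<longleftrightarrow> weak_conv_m M N"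
  by (simp add: weak_conv_along_def weak_conv_m_def weak_conv_def)

lemma finite_primes_upto: "finite (primes_upto k)"
proof (rule finite_subset)
  show "primes_upto k \<subseteq> {0..k}"
    by (auto simp: primes_upto_def dest: prime_gt_0_int)
qed simp

lemma alpha_eq_frac: "alpha p k = frac (real_of_int k / real_of_int p)"
proof (cases "p = 0")
  case False
  have "real_of_int k = real_of_int (p * (k div p) + k mod p)"
    by simp
  then have "real_of_int k = real_of_int p * real_of_int (k div p) + real_of_int (k mod p)"
    by (simp only: of_int_add of_int_mult)
  with False have "real_of_int (k mod p) / real_of_int p
      = real_of_int k / real_of_int p - real_of_int (k div p)"
    by (simp add: field_simps)
  then show ?thesis
    by (simp only: alpha_def frac_def floor_divide_of_int_eq)
qed (simp add: alpha_def)

lemma summable_mean_const: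
  assumes "prime p" and "0 \<le> k"
  shows "summable (\<lambda>j. real_of_int (k mod p ^ Suc j) / real_of_int (p ^ Suc j))"
proof (rule summable_comparison_test)
  have p: "p > 1" using assms(1) by (rule prime_gt_1_int)
  show "summable (\<lambda>j. real_of_int k * (1 / real_of_int p) ^ Suc j)"
    using p by (intro summable_mult summable_ignore_initial_segment[where k = 1, simplified]
        summable_geometric) auto
  have "k mod p ^ Suc j \<le> k" "0 \<le> k mod p ^ Suc j" for j
    using p assms(2) by (auto simp: zmod_le_nonneg_dividend)
  then have "norm (real_of_int (k mod p ^ Suc j) / real_of_int (p ^ Suc j))
      \<le> real_of_int k * (1 / real_of_int p) ^ Suc j" for j
    using p by (simp add: power_one_over divide_right_mono del: power_Suc)
  then show "\<exists>N. \<forall>j\<ge>N. norm (real_of_int (k mod p ^ Suc j) / real_of_int (p ^ Suc j))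
      \<le> real_of_int k * (1 / real_of_int p) ^ Suc j"
    by blast
qed

lemma finite_dyadic_ints: "finite (dyadic_ints X)"
proof (rule finite_subset)
  show "dyadic_ints X \<subseteq> {\<lceil>X\<rceil>..\<lceil>2 * X\<rceil>}"
    by (auto simp: dyadic_ints_def) linarith+
qed simp

lemma dyadic_ints_nonempty: "X \<ge> 3 \<Longrightarrow> dyadic_ints X \<noteq> {}"
proof -
  assume "X \<ge> 3"
  then have "\<lceil>X\<rceil> \<in> dyadic_ints X"
    unfolding dyadic_ints_def by simp linarith
  then show ?thesis by blast
qed

end

theory Submission
  imports Defs "HOL-Complex_Analysis.Complex_Analysis" "HOL-Number_Theory.Cong" "HOL-Number_Theory.Prime_Powers" "HOL-Real_Asymp.Real_Asymp"
begin

text \<open>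
  By Kummer's theorem the exponent of \<open>p\<close> in \<open>n choose k\<close> counts the \<open>a\<close> with \<open>n mod p^a < k mod p^a\<close>.
  The terms with \<open>a \<ge> 2\<close>, centred, have second moment \<open>O(k) = o(V k)\<close>. The terms with \<open>a = 1\<close> form a sum of
  functions of period \<open>p \<le> k\<close>. A product of \<open>j\<close> of them has period at most \<open>k^j = X^o(1)\<close>, so every fixed
  moment agrees up to \<open>o(1)\<close> with the moment taken over \<open>n\<close> uniform modulo the product of all primes
  \<open>p \<le> k\<close>, although this product may exceed \<open>X\<close>. In that model the terms are independent by the Chinese
  remainder theorem. A sub-Gaussian bound on even moments controls the Taylor remainder of the
  characteristic function, so the moment comparison gives the central limit theorem.

  The asymptotics of \<open>V\<close> are equivalent in depth to the prime number theorem. The measures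
  \<open>\<Sum> \<Lambda>(n) n^(-1-\<epsilon>)\<close> at the points \<open>ln n - T\<close>, weighted by a positive function whose Fourier transform has compact
  support, have characteristic functions that are integrals of \<open>- \<zeta>'/\<zeta>\<close> near the line \<open>Re s = 1\<close>. Since
  \<open>\<zeta>\<close> has no zero there, the Riemann-Lebesgue lemma and Levy's continuity theorem show that
  they converge weakly to the weighted Lebesgue measure. Testing against \<open>{t} (1 - {t}) / t\<close> with \<open>t = k/n\<close>
  gives \<open>V\<close>, and Wallis' product evaluates the limit integral.
\<close>

section \<open>The zeta function and the von Mangoldt series\<close>

text \<open>The characteristic function of the prime part has the product of all primes up to
  \<open>k\<close> as its period. This product is about \<open>exp k\<close>, possibly a large power
  of \<open>X\<close>, so a direct comparison with the independent model fails. A polynomial of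
  fixed degree in the prime part only involves short periods; hence the detour through a Taylor
  polynomial whose degree depends on the required accuracy and not on \<open>X\<close>. The
  reduction to \<open>a = 1\<close> rests on a difference of scale: the primes themselves contribute
  order \<open>k ln k\<close> to the variance, the higher powers only \<open>k\<close> times a
  convergent sum of \<open>(ln p / p)^2\<close>. On the analytic side no growth bound for
  \<open>\<zeta>'/\<zeta>\<close> along the line \<open>Re s = 1\<close> enters. Compact support of
  the Fourier transform confines everything to a bounded segment, where continuity is enough. The
  weight must be positive, since it is divided out again to reach the test function of
  interest.\<close>

definition nat_pow :: "nat \<Rightarrow> complex \<Rightarrow> complex" where
  "nat_pow n s = (if n = 0 then 0 else exp (- s * of_real (ln (real n))))"

lemma nat_pow_0 [simp]: "nat_pow 0 s = 0"
  by (simp add: nat_pow_def)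

text \<open>The value \<open>0\<close> at \<open>n = 0\<close> makes complete multiplicativity
  unconditional and lets every series run over all of \<open>nat\<close>.\<close>

lemma nat_pow_mult: "nat_pow (m * n) s = nat_pow m s * nat_pow n s"
  by (auto simp: nat_pow_def ln_mult exp_add [symmetric] algebra_simps)

lemma norm_nat_pow: "norm (nat_pow n s) = (if n = 0 then 0 else real n powr (- Re s))"
  by (auto simp: nat_pow_def powr_def)

lemma nat_pow_deriv: "(nat_pow n has_field_derivative (- of_real (ln (real n)) * nat_pow n s)) (at s within A)"
  unfolding nat_pow_def [abs_def] by (auto intro!: derivative_eq_intros)

lemma summable_norm_nat_pow: "Re s > 1 \<Longrightarrow> summable (\<lambda>n. norm (nat_pow n s))"
  by (rule summable_comparison_test' [of "\<lambda>n. real n powr (- Re s)" 0])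
     (auto simp: norm_nat_pow summable_real_powr_iff)

lemma summable_ln_powr:
  assumes "\<sigma> > (1::real)"
  shows "summable (\<lambda>n. ln (real n) * real n powr (-\<sigma>))"
proof (rule summable_comparison_test_ev)
  \<comment> \<open>Half of the excess of \<open>\<sigma>\<close> over \<open>1\<close> absorbs the
    logarithm; the other half keeps the series convergent.\<close>
  define \<epsilon> where "\<epsilon> = (\<sigma> - 1) / 2"
  have "\<epsilon> > 0" using assms by (simp add: \<epsilon>_def)
  show "summable (\<lambda>n. real n powr (-\<sigma> + \<epsilon>))"
    using assms by (auto simp: summable_real_powr_iff \<epsilon>_def field_simps)
  have "eventually (\<lambda>n. ln (real n) \<le> real n powr \<epsilon>) sequentially"
    using \<open>\<epsilon> > 0\<close> by real_asymp
  then show "eventually (\<lambda>n. norm (ln (real n) * real n powr (-\<sigma>)) \<le> real n powr (-\<sigma> + \<epsilon>)) sequentially"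
    using eventually_gt_at_top [of 0]
  proof eventually_elim
    case (elim n)
    then have "ln (real n) * real n powr (-\<sigma>) \<le> real n powr \<epsilon> * real n powr (-\<sigma>)"
      by (intro mult_right_mono) auto
    then show ?case using elim by (simp add: powr_add [symmetric] add.commute)
  qed
qed

lemma summable_norm_mangoldt_nat_pow:
  assumes "Re s > 1"
  shows "summable (\<lambda>n. norm (mangoldt n * nat_pow n s))"
proof (rule summable_comparison_test')
  show "summable (\<lambda>n. ln (real n) * real n powr (- Re s))"
    by (rule summable_ln_powr) fact
  show "norm (norm (mangoldt n * nat_pow n s)) \<le> ln (real n) * real n powr (- Re s)" for n
    by (cases "n = 0") (auto simp: norm_mult abs_mult norm_nat_pow intro!: mult_right_mono mangoldt_le)
qed

lemma summable_norm_ln_nat_pow: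
  assumes "Re s > 1"
  shows "summable (\<lambda>n. norm (of_real (ln (real n)) * nat_pow n s))"
proof (rule summable_comparison_test')
  show "summable (\<lambda>n. ln (real n) * real n powr (- Re s))"
    by (rule summable_ln_powr) fact
  show "norm (norm (of_real (ln (real n)) * nat_pow n s)) \<le> ln (real n) * real n powr (- Re s)" for n
    by (cases "n = 0") (auto simp: norm_mult norm_nat_pow)
qed

text \<open>This is \<open>- \<zeta>'/\<zeta>\<close> in the half-plane of absolute convergence,
  introduced through its coefficients so that it is available before zeta is continued.\<close>

definition mangoldt_series :: "complex \<Rightarrow> complex" where
  "mangoldt_series s = (\<Sum>n. mangoldt n * nat_pow n s)"

text \<open>The convolution identity \<open>\<Sum> \<Lambda>(d) = ln N\<close> over
  \<open>d dvd N\<close>: an absolutely convergent double series over pairs \<open>(d, m)\<close> is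
  summed once by rows and once along the hyperbolas \<open>d * m = N\<close>.\<close>

lemma mangoldt_series_mult:
  assumes "Re s > 1"
  shows "mangoldt_series s * (\<Sum>n. nat_pow n s) = (\<Sum>n. of_real (ln (real n)) * nat_pow n s)"
proof -
  define Z where "Z = (\<Sum>n. nat_pow n s)"
  have Z: "((\<lambda>n. nat_pow n s) has_sum Z) UNIV" unfolding Z_def
    using summable_norm_nat_pow [OF assms] by (intro norm_summable_imp_has_sum summable_sums) (auto dest: summable_norm_cancel)
  have Z': "(\<lambda>n. norm (nat_pow n s)) summable_on UNIV"
    using summable_norm_nat_pow [OF assms] by (simp add: summable_on_UNIV_nonneg_real_iff)
  have D: "((\<lambda>n. mangoldt n * nat_pow n s) has_sum mangoldt_series s) UNIV" unfolding mangoldt_series_def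
    using summable_norm_mangoldt_nat_pow [OF assms] by (intro norm_summable_imp_has_sum summable_sums) (auto dest: summable_norm_cancel)
  have D': "(\<lambda>n. norm (mangoldt n * nat_pow n s)) summable_on UNIV"
    using summable_norm_mangoldt_nat_pow [OF assms] by (subst summable_on_UNIV_nonneg_real_iff) auto
  define f where "f = (\<lambda>(d, m). mangoldt d * nat_pow d s * nat_pow m s)"
  have fn: "norm (f (d, m)) = norm (mangoldt d * nat_pow d s) * norm (nat_pow m s)" for d m by (simp only: f_def prod.case norm_mult)
  have f1: "(\<lambda>m. norm (f (d, m))) summable_on UNIV" for d
    unfolding fn by (rule summable_on_cmult_right [OF Z'])
  have f2: "infsum (\<lambda>m. norm (f (d, m))) UNIV = norm (mangoldt d * nat_pow d s) * infsum (\<lambda>m. norm (nat_pow m s)) UNIV" for d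
    unfolding fn by (rule infsum_cmult_right')
  have "(\<lambda>d. infsum (\<lambda>m. norm (f (d, m))) UNIV) summable_on UNIV"
    unfolding f2 by (rule summable_on_cmult_left [OF D'])
  moreover have "norm (infsum (\<lambda>m. norm (f (d, m))) UNIV) = infsum (\<lambda>m. norm (f (d, m))) UNIV" for d
    by (simp add: infsum_nonneg)
  ultimately have f3: "(\<lambda>d. norm (infsum (\<lambda>m. norm (f (d, m))) UNIV)) summable_on UNIV"
    by simp
  have "(\<lambda>z. norm (f z)) summable_on UNIV \<times> UNIV"
    using f1 f3 Infinite_Sum.abs_summable_on_Sigma_iff [where f = f and A = UNIV and B = "\<lambda>_. UNIV"] by simp
  then have "f summable_on UNIV \<times> UNIV"
    by (rule abs_summable_summable)
  then obtain S where S: "(f has_sum S) (UNIV \<times> UNIV)"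
    by (auto simp: summable_on_def)
  have "((\<lambda>d. mangoldt d * nat_pow d s * Z) has_sum S) UNIV"
    by (rule has_sum_SigmaD [OF S]) (auto simp: f_def intro!: has_sum_cmult_right Z)
  moreover have "((\<lambda>d. mangoldt d * nat_pow d s * Z) has_sum (mangoldt_series s * Z)) UNIV"
    by (intro has_sum_cmult_left D)
  ultimately have S_eq: "S = mangoldt_series s * Z"
    by (rule has_sum_unique)
  define g where "g = (\<lambda>(N, d). mangoldt d * nat_pow N s)"
  \<comment> \<open>Pairs with a zero entry contribute nothing and have to go before the regrouping,
    because every \<open>d\<close> divides \<open>0\<close> and the fibre over \<open>N = 0\<close>
    would be infinite.\<close>
  have "(f has_sum S) (UNIV \<times> UNIV) \<longleftrightarrow> (f has_sum S) ({0<..} \<times> {0<..})"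
  proof (rule has_sum_cong_neutral, goal_cases)
    case (1 z) then show ?case by (cases z) (auto simp: f_def)
  next
    case (2 z) then show ?case by (cases z) (auto simp: f_def)
  next
    case (3 z) then show ?case by (cases z) (auto simp: f_def)
  qed
  with S have "(f has_sum S) ({0<..} \<times> {0<..})" by simp
  also have "(f has_sum S) ({0<..} \<times> {0<..}) \<longleftrightarrow> (g has_sum S) (SIGMA N:{0<..}. {d. d dvd N})"
  proof (rule has_sum_reindex_bij_witness [of _ "\<lambda>(N, d). (d, N div d)" "\<lambda>(d, m). (d * m, d)"], goal_cases)
    case (1 a) then show ?case by (cases a) simp
  next
    case (2 a) then show ?case by (cases a) simp
  next
    case (3 b) then show ?case by (cases b) simp
  next
    case (4 b)
    then obtain N d where b: "b = (N, d)" "N > 0" "d dvd N" by (cases b) simp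
    then have "d > 0" by (intro Nat.gr0I) auto
    moreover have "N div d > 0" using dvd_imp_le [OF b(3,2)] \<open>d > 0\<close> by (simp add: div_greater_zero_iff)
    ultimately show ?case using b(1) by simp
  next
    case (5 a) then show ?case by (cases a) (simp add: f_def g_def nat_pow_mult)
  qed simp
  finally have g: "(g has_sum S) (SIGMA N:{0<..}. {d. d dvd N})" .
  have "((\<lambda>N. \<Sum>d | d dvd N. g (N, d)) has_sum S) {0<..}"
    by (rule has_sum_SigmaD [OF g]) (rule has_sum_finite, simp)
  also have "?this \<longleftrightarrow> ((\<lambda>N. of_real (ln (real N)) * nat_pow N s) has_sum S) UNIV"
    by (rule has_sum_cong_neutral) (simp_all add: g_def sum_distrib_right [symmetric] mangoldt_sum)
  finally have "(\<lambda>N. of_real (ln (real N)) * nat_pow N s) sums S"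
    by (rule has_sum_imp_sums)
  then show ?thesis
    using S_eq by (simp add: Z_def sums_iff)
qed

text \<open>The terms of the series \<open>(s - 1) \<zeta>(s) = 1 + \<Sum>\<^sub>n zeta_term n s\<close>, which converges for \<open>Re s > 0\<close>.\<close>

definition zeta_term :: "nat \<Rightarrow> complex \<Rightarrow> complex" where
  "zeta_term n s = (s - 1) * nat_pow (Suc n) s - (nat_pow (Suc n) (s - 1) - nat_pow (Suc (Suc n)) (s - 1))"

text \<open>Each term is the error of the first-order Taylor expansion of
  \<open>w powr (1 - s)\<close> at \<open>n + 1\<close>, evaluated at \<open>n + 2\<close>. The
  second derivative decays like \<open>w powr (- Re s - 1)\<close>, which is summable as soon as
  \<open>Re s > 0\<close>; this is the analytic continuation.\<close>

lemma norm_zeta_term_le: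
  assumes "Re s > 0"
  shows "norm (zeta_term n s) \<le> norm s * norm (1 - s) * real (Suc n) powr (- Re s - 1)"
proof -
  define F where "F = (\<lambda>(i::nat) w::complex. (if i = 0 then 1 else if i = 1 then 1 - s else - s * (1 - s)) *
     exp ((1 - s - of_nat i) * Ln w))"
  define x where "x = (of_nat (Suc n) :: complex)"
  have seg: "Re w \<ge> real (Suc n)" "Im w = 0" if w: "w \<in> closed_segment x (x + 1)" for w
  proof -
    obtain u where u: "u \<ge> 0" "w = (1 - u) *\<^sub>R x + u *\<^sub>R (x + 1)" using w by (auto simp: closed_segment_def)
    have "w = x + of_real u" unfolding u(2) by (simp add: scaleR_conv_of_real algebra_simps)
    then show "Re w \<ge> real (Suc n)" "Im w = 0" using u(1) by (simp_all add: x_def)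
  qed
  have D: "((\<lambda>w. exp (a * Ln w)) has_field_derivative exp (a * Ln w) * (a * inverse w)) (at w within T)"
    if "w \<notin> \<real>\<^sub>\<le>\<^sub>0" for a w T
    by (rule DERIV_chain2 [where f = exp], rule DERIV_exp, rule DERIV_cmult,
        rule has_field_derivative_at_within, rule has_field_derivative_Ln, fact)
  have exp_Ln: "exp ((a - 1) * Ln w) = exp (a * Ln w) / w" if "w \<noteq> 0" for a w :: complex
    using that by (simp add: algebra_simps exp_diff)
  have "norm (F 0 (x + 1) - (\<Sum>i\<le>1. F i x * (x + 1 - x) ^ i / fact i))
        \<le> (norm s * norm (1 - s) * real (Suc n) powr (- Re s - 1)) * norm (x + 1 - x) ^ Suc 1 / fact 1"
  proof (rule complex_Taylor)
    fix i w assume w: "w \<in> closed_segment x (x + 1)" and i: "i \<le> (1::nat)"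
    have w0: "w \<notin> \<real>\<^sub>\<le>\<^sub>0" "w \<noteq> 0" using seg [OF w] by (auto simp: complex_nonpos_Reals_iff)
    have "i = 0 \<or> i = 1" using i by auto
    then show "(F i has_field_derivative F (Suc i) w) (at w within closed_segment x (x + 1))"
    proof
      assume [simp]: "i = 0"
      have "((\<lambda>w. exp ((1 - s) * Ln w)) has_field_derivative exp ((1 - s) * Ln w) * ((1 - s) * inverse w))
          (at w within closed_segment x (x + 1))"
        by (rule D [OF w0(1)])
      moreover have "F (Suc i) w = exp ((1 - s) * Ln w) * ((1 - s) * inverse w)"
      proof -
        have "F (Suc i) w = (1 - s) * exp ((1 - s - 1) * Ln w)" by (simp add: F_def)
        then show ?thesis unfolding exp_Ln [OF w0(2)] by (simp add: divide_inverse)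
      qed
      moreover have "F i = (\<lambda>w. exp ((1 - s) * Ln w))" by (simp add: F_def fun_eq_iff)
      ultimately show ?thesis by (simp only:)
    next
      assume [simp]: "i = 1"
      have "((\<lambda>w. (1 - s) * exp (-s * Ln w)) has_field_derivative (1 - s) * (exp (-s * Ln w) * (-s * inverse w)))
          (at w within closed_segment x (x + 1))"
        by (rule DERIV_cmult [OF D [OF w0(1)]])
      moreover have "F (Suc i) w = (1 - s) * (exp (-s * Ln w) * (-s * inverse w))"
      proof -
        have e: "1 - s - of_nat (Suc i) = - s - 1" by simp
        have "F (Suc i) w = - s * (1 - s) * exp ((- s - 1) * Ln w)" unfolding F_def e by simp
        then show ?thesis unfolding exp_Ln [OF w0(2)] by (simp add: divide_inverse)
      qed
      moreover have "F i = (\<lambda>w. (1 - s) * exp (- s * Ln w))" by (simp add: F_def fun_eq_iff)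
      ultimately show ?thesis by (simp only:)
    qed
  next
    fix w assume w: "w \<in> closed_segment x (x + 1)"
    define r where "r = Re w"
    have r: "r \<ge> real (Suc n)" and w_eq: "w = of_real r"
      using seg [OF w] by (auto simp: r_def complex_eq_iff)
    have "norm (F (Suc 1) w) = norm s * norm (1 - s) * r powr (- Re s - 1)"
      using r by (simp add: F_def w_eq norm_mult Ln_of_real powr_def)
    also have "\<dots> \<le> norm s * norm (1 - s) * real (Suc n) powr (- Re s - 1)"
      using r assms by (intro mult_left_mono powr_mono2') auto
    finally show "norm (F (Suc 1) w) \<le> norm s * norm (1 - s) * real (Suc n) powr (- Re s - 1)" .
  qed auto
  moreover have "Ln x = of_real (ln (real (Suc n)))" "Ln (x + 1) = of_real (ln (real (Suc (Suc n))))"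
    using Ln_of_real [of "real (Suc n)"] Ln_of_real [of "real (Suc (Suc n))"] by (simp_all add: x_def add_ac)
  then have "F 0 (x + 1) - (\<Sum>i\<le>1. F i x * (x + 1 - x) ^ i / fact i) = zeta_term n s"
    by (simp add: F_def zeta_term_def nat_pow_def algebra_simps)
  ultimately show ?thesis by simp
qed

text \<open>The factor \<open>s - 1\<close> removes the pole, so orders of vanishing and continuity
  can be discussed at all points of the line \<open>Re s = 1\<close> alike.\<close>

definition zetaZ :: "complex \<Rightarrow> complex" where
  "zetaZ s = 1 + (\<Sum>n. zeta_term n s)"

lemma zeta_term_deriv:
  "(zeta_term n has_field_derivative
     (nat_pow (Suc n) s - (s - 1) * (of_real (ln (real (Suc n))) * nat_pow (Suc n) s)
      + (of_real (ln (real (Suc n))) * nat_pow (Suc n) (s - 1) - of_real (ln (real (Suc (Suc n)))) * nat_pow (Suc (Suc n)) (s - 1)))) (at s)"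
  unfolding zeta_term_def [abs_def]
  by (auto intro!: derivative_eq_intros nat_pow_deriv DERIV_chain2 [OF nat_pow_deriv] simp del: of_nat_Suc simp: algebra_simps)

text \<open>Convergence and termwise differentiation are recorded together: the derivative gives
  holomorphy, and its explicit series gives \<open>deriv zetaZ\<close> for
  \<open>Re s > 1\<close>.\<close>

lemma zeta_series:
  "\<exists>g g'. \<forall>s\<in>{s. Re s > 0}. (\<lambda>n. zeta_term n s) sums g s \<and>
      (\<lambda>n. nat_pow (Suc n) s - (s - 1) * (of_real (ln (real (Suc n))) * nat_pow (Suc n) s)
      + (of_real (ln (real (Suc n))) * nat_pow (Suc n) (s - 1) - of_real (ln (real (Suc (Suc n)))) * nat_pow (Suc (Suc n)) (s - 1))) sums g' s \<and>
      (g has_field_derivative g' s) (at s)"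
proof (rule series_and_derivative_comparison_local)
  show "open {s. Re s > 0}" by (rule open_halfspace_Re_gt)
  show "(zeta_term n has_field_derivative
     (nat_pow (Suc n) s - (s - 1) * (of_real (ln (real (Suc n))) * nat_pow (Suc n) s)
      + (of_real (ln (real (Suc n))) * nat_pow (Suc n) (s - 1) - of_real (ln (real (Suc (Suc n)))) * nat_pow (Suc (Suc n)) (s - 1)))) (at s)" for n s
    by (rule zeta_term_deriv)
  fix s :: complex assume "s \<in> {s. Re s > 0}"
  then have s: "Re s > 0" by simp
  \<comment> \<open>On the ball of this radius \<open>Re y \<ge> d\<close> still holds, so one
    summable majorant serves all its points.\<close>
  define d where "d = Re s / 2"
  define C where "C = (norm s + d) * (1 + norm s + d)"
  have "d > 0" using s by (simp add: d_def)
  have "C \<ge> 0" using \<open>d > 0\<close> by (simp add: C_def)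
  have "summable (\<lambda>n. C * real (Suc n) powr (- d - 1))"
    using summable_real_powr_iff [of "-d - 1"] \<open>d > 0\<close>
    by (intro summable_mult) (subst summable_Suc_iff, simp)
  moreover have "norm (zeta_term n y) \<le> C * real (Suc n) powr (- d - 1)" if y: "y \<in> ball s d \<inter> {s. Re s > 0}" for n y
  proof -
    have dy: "norm (y - s) < d" using y by (auto simp: dist_norm norm_minus_commute)
    have "\<bar>Re (y - s)\<bar> \<le> norm (y - s)" by (rule abs_Re_le_cmod)
    then have Re_y: "Re y \<ge> d" using dy by (simp add: d_def abs_le_iff)
    have ny: "norm y \<le> norm s + d" using norm_triangle_ineq [of s "y - s"] dy by simp
    have ny': "norm (1 - y) \<le> 1 + norm s + d" using norm_triangle_ineq4 [of 1 y] ny by simp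
    have "norm (zeta_term n y) \<le> norm y * norm (1 - y) * real (Suc n) powr (- Re y - 1)"
      using y by (intro norm_zeta_term_le) auto
    also have "\<dots> \<le> C * real (Suc n) powr (- d - 1)"
      unfolding C_def using ny ny' Re_y \<open>d > 0\<close>
      by (intro mult_mono powr_mono) (auto intro!: mult_nonneg_nonneg add_nonneg_nonneg)
    finally show ?thesis .
  qed
  ultimately show "\<exists>d h. 0 < d \<and> summable h \<and> (\<forall>\<^sub>F n in sequentially. \<forall>y\<in>ball s d \<inter> {s. 0 < Re s}. norm (zeta_term n y) \<le> h n)"
    using \<open>d > 0\<close>
    by (intro exI [of _ d] exI [of _ "\<lambda>n. C * real (Suc n) powr (- d - 1)"] conjI always_eventually allI ballI)
qed

lemma zetaZ_holomorphic: "zetaZ holomorphic_on {s. Re s > 0}"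
proof -
  obtain g g' where g: "\<And>s. Re s > 0 \<Longrightarrow> (\<lambda>n. zeta_term n s) sums g s \<and> (g has_field_derivative g' s) (at s)"
    using zeta_series by fastforce
  have "(\<lambda>s. 1 + g s) holomorphic_on {s. Re s > 0}"
    unfolding holomorphic_on_open [OF open_halfspace_Re_gt]
  proof (intro ballI exI)
    fix s assume "s \<in> {s. 0 < Re s}"
    then show "((\<lambda>s. 1 + g s) has_field_derivative 0 + g' s) (at s)"
      using g [of s] by (intro DERIV_add DERIV_const) auto
  qed
  then show ?thesis
    by (rule holomorphic_transform) (use g in \<open>auto simp: zetaZ_def sums_iff\<close>)
qed

lemma zetaZ_1: "zetaZ 1 = 1"
  by (simp add: zetaZ_def zeta_term_def nat_pow_def)

text \<open>For \<open>Re s > 1\<close> the two parts of \<open>zeta_term\<close> converge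
  separately. The telescoping part sums to \<open>1\<close> and cancels the leading \<open>1\<close>
  of \<open>zetaZ\<close>; its derivative telescopes to \<open>0\<close>.\<close>

lemma zetaZ_eq:
  assumes "Re s > 1"
  shows "zetaZ s = (s - 1) * (\<Sum>n. nat_pow n s)"
    and "deriv zetaZ s = (\<Sum>n. nat_pow n s) - (s - 1) * (\<Sum>n. of_real (ln (real n)) * nat_pow n s)"
proof -
  obtain g g' where g: "\<And>s. Re s > 0 \<Longrightarrow> (\<lambda>n. zeta_term n s) sums g s \<and> 
      (\<lambda>n. nat_pow (Suc n) s - (s - 1) * (of_real (ln (real (Suc n))) * nat_pow (Suc n) s)
      + (of_real (ln (real (Suc n))) * nat_pow (Suc n) (s - 1) - of_real (ln (real (Suc (Suc n)))) * nat_pow (Suc (Suc n)) (s - 1))) sums g' s \<and>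
      (g has_field_derivative g' s) (at s)"
    using zeta_series by fastforce
  define Z where "Z = (\<Sum>n. nat_pow n s)"
  define L where "L = (\<Sum>n. of_real (ln (real n)) * nat_pow n s)"
  have "summable (\<lambda>n. nat_pow n s)" using summable_norm_nat_pow [OF assms] by (rule summable_norm_cancel)
  then have "(\<lambda>n. nat_pow n s) sums Z" unfolding Z_def by (rule summable_sums)
  then have Z: "(\<lambda>n. nat_pow (Suc n) s) sums Z" by (subst sums_Suc_iff) simp
  have "summable (\<lambda>n. of_real (ln (real n)) * nat_pow n s)"
    using summable_norm_ln_nat_pow [OF assms] by (rule summable_norm_cancel)
  then have "(\<lambda>n. of_real (ln (real n)) * nat_pow n s) sums L" unfolding L_def by (rule summable_sums)
  then have L: "(\<lambda>n. of_real (ln (real (Suc n))) * nat_pow (Suc n) s) sums L" by (subst sums_Suc_iff) simp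
  have lim1: "(\<lambda>n. nat_pow (Suc n) (s - 1)) \<longlonglongrightarrow> 0"
  proof (rule tendsto_norm_zero_cancel)
    have "(\<lambda>n. real (Suc n) powr (- Re (s - 1))) \<longlonglongrightarrow> 0" using assms by simp real_asymp
    then show "(\<lambda>n. norm (nat_pow (Suc n) (s - 1))) \<longlonglongrightarrow> 0" by (simp add: norm_nat_pow)
  qed
  have lim2: "(\<lambda>n. of_real (ln (real (Suc n))) * nat_pow (Suc n) (s - 1)) \<longlonglongrightarrow> 0"
  proof (rule tendsto_norm_zero_cancel)
    have "(\<lambda>n. ln (real (Suc n)) * real (Suc n) powr (- Re (s - 1))) \<longlonglongrightarrow> 0" using assms by simp real_asymp
    then show "(\<lambda>n. norm (of_real (ln (real (Suc n))) * nat_pow (Suc n) (s - 1))) \<longlonglongrightarrow> 0" by (simp add: norm_nat_pow norm_mult)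
  qed
  have "(\<lambda>n. zeta_term n s) sums ((s - 1) * Z - (nat_pow (Suc 0) (s - 1) - 0))"
    unfolding zeta_term_def by (intro sums_diff sums_mult Z telescope_sums' lim1)
  moreover have "nat_pow (Suc 0) (s - 1) = 1" by (simp add: nat_pow_def)
  ultimately show "zetaZ s = (s - 1) * (\<Sum>n. nat_pow n s)"
    by (simp add: zetaZ_def sums_iff Z_def)
  have "(\<lambda>n. nat_pow (Suc n) s - (s - 1) * (of_real (ln (real (Suc n))) * nat_pow (Suc n) s)
      + (of_real (ln (real (Suc n))) * nat_pow (Suc n) (s - 1) - of_real (ln (real (Suc (Suc n)))) * nat_pow (Suc (Suc n)) (s - 1))) sums
      (Z - (s - 1) * L + (of_real (ln (real (Suc 0))) * nat_pow (Suc 0) (s - 1) - 0))"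
    by (intro sums_diff sums_add sums_mult Z L telescope_sums' [OF lim2])
  then have g's: "g' s = Z - (s - 1) * L" using g [of s] assms by (auto simp: sums_iff)
  have "((\<lambda>s. 1 + g s) has_field_derivative g' s) (at s)"
    using g [of s] assms by (auto intro!: derivative_eq_intros)
  then have "(zetaZ has_field_derivative g' s) (at s)"
    by (rule has_field_derivative_transform_within_open [OF _ open_halfspace_Re_gt [of 0]])
       (use g assms in \<open>auto simp: zetaZ_def sums_iff\<close>)
  then show "deriv zetaZ s = (\<Sum>n. nat_pow n s) - (s - 1) * (\<Sum>n. of_real (ln (real n)) * nat_pow n s)"
    using g's by (simp add: DERIV_imp_deriv Z_def L_def)
qed

text \<open>Kept in multiplied form, since the non-vanishing of \<open>zetaZ\<close> for
  \<open>Re s > 1\<close> is itself deduced from this identity.\<close>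

lemma mangoldt_series_zetaZ:
  assumes "Re s > 1"
  shows "mangoldt_series s * zetaZ s = zetaZ s / (s - 1) - deriv zetaZ s"
proof -
  have "s \<noteq> 1" using assms by auto
  then show ?thesis
    using mangoldt_series_mult [OF assms] by (simp add: zetaZ_eq [OF assms] field_simps)
qed

section \<open>Non-vanishing of zeta on the line Re s = 1\<close>

text \<open>The number \<open>m\<close> is the order of the zero of \<open>f\<close> at
  \<open>s0\<close>, detected along the horizontal ray to the right of \<open>s0\<close>. What
  matters later is that it is a natural number, positive at a zero.\<close>

lemma logderiv_order:
  fixes f :: "complex \<Rightarrow> complex"
  assumes f: "f holomorphic_on S" and S: "open S" "connected S" "s0 \<in> S" and nc: "\<not> f constant_on S"
  obtains m :: nat where "((\<lambda>\<delta>::real. of_real \<delta> * (deriv f (s0 + of_real \<delta>) / f (s0 + of_real \<delta>))) \<longlongrightarrow> of_nat m) (at_right 0)"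
    and "f s0 = 0 \<Longrightarrow> m > 0"
proof (cases "f s0 = 0")
  case False
  have lim: "((\<lambda>\<delta>::real. s0 + of_real \<delta>) \<longlongrightarrow> s0) (at_right 0)"
    by (auto intro!: tendsto_eq_intros)
  have "isCont f s0" "isCont (deriv f) s0"
    using S(3) holomorphic_on_imp_continuous_on [OF f]
      holomorphic_on_imp_continuous_on [OF holomorphic_deriv [OF f S(1)]]
    by (simp_all add: continuous_on_eq_continuous_at [OF S(1)])
  then have "((\<lambda>\<delta>::real. of_real \<delta> * (deriv f (s0 + of_real \<delta>) / f (s0 + of_real \<delta>))) \<longlongrightarrow> of_real 0 * (deriv f s0 / f s0)) (at_right 0)"
    using False by (intro tendsto_mult tendsto_divide isCont_tendsto_compose [OF _ lim] tendsto_of_real tendsto_ident_at) auto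
  then have "((\<lambda>\<delta>::real. of_real \<delta> * (deriv f (s0 + of_real \<delta>) / f (s0 + of_real \<delta>))) \<longlongrightarrow> of_nat 0) (at_right 0)"
    by simp
  then show ?thesis using False by (intro that [of 0]) simp_all
next
  case True
  obtain g r n where gr: "0 < (n::nat)" "0 < (r::real)" "ball s0 r \<subseteq> S" "g holomorphic_on ball s0 r"
    "\<And>w. w \<in> ball s0 r \<Longrightarrow> f w = (w - s0) ^ n * g w" "\<And>w. w \<in> ball s0 r \<Longrightarrow> g w \<noteq> 0"
    by (rule holomorphic_factor_zero_nonconstant [OF f S True nc]) (rule that)
  have lim: "((\<lambda>\<delta>::real. s0 + of_real \<delta>) \<longlongrightarrow> s0) (at_right 0)"
    by (auto intro!: tendsto_eq_intros)
  have "isCont g s0" "isCont (deriv g) s0"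
    using gr(2) holomorphic_on_imp_continuous_on [OF gr(4)]
      holomorphic_on_imp_continuous_on [OF holomorphic_deriv [OF gr(4) open_ball]]
    by (simp_all add: continuous_on_eq_continuous_at [OF open_ball])
  then have L: "((\<lambda>\<delta>::real. of_nat n + of_real \<delta> * (deriv g (s0 + of_real \<delta>) / g (s0 + of_real \<delta>))) \<longlongrightarrow>
        of_nat n + of_real 0 * (deriv g s0 / g s0)) (at_right 0)"
    using gr(2) gr(6) [of s0] by (intro tendsto_add tendsto_const tendsto_mult tendsto_divide isCont_tendsto_compose [OF _ lim] tendsto_of_real tendsto_ident_at) auto
  have "eventually (\<lambda>\<delta>::real. of_nat n + of_real \<delta> * (deriv g (s0 + of_real \<delta>) / g (s0 + of_real \<delta>)) =
      of_real \<delta> * (deriv f (s0 + of_real \<delta>) / f (s0 + of_real \<delta>))) (at_right 0)"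
  proof (rule eventually_at_rightI [of 0 r])
    fix \<delta> :: real assume \<delta>: "\<delta> \<in> {0<..<r}"
    define w where "w = s0 + of_real \<delta>"
    have w: "w \<in> ball s0 r" using \<delta> by (simp add: w_def dist_norm)
    have "(g has_field_derivative deriv g w) (at w)"
      by (rule holomorphic_derivI [OF gr(4) open_ball w])
    then have "((\<lambda>w. (w - s0) ^ n * g w) has_field_derivative
        of_nat n * (w - s0) ^ (n - 1) * g w + (w - s0) ^ n * deriv g w) (at w)"
      by (auto intro!: derivative_eq_intros)
    then have "(f has_field_derivative of_nat n * (w - s0) ^ (n - 1) * g w + (w - s0) ^ n * deriv g w) (at w)"
      by (rule has_field_derivative_transform_within_open [OF _ open_ball w]) (simp add: gr(5))
    then have "deriv f w = of_nat n * (w - s0) ^ (n - 1) * g w + (w - s0) ^ n * deriv g w"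
      by (rule DERIV_imp_deriv)
    moreover have "f w = (w - s0) ^ n * g w" "g w \<noteq> 0" using gr w by auto
    moreover have "w - s0 = of_real \<delta>" by (simp add: w_def)
    moreover have "of_real \<delta> ^ n = (of_real \<delta> :: complex) * of_real \<delta> ^ (n - 1)"
      using gr(1) by (metis power_minus_mult mult.commute)
    ultimately have "of_nat n + of_real \<delta> * (deriv g w / g w) = of_real \<delta> * (deriv f w / f w)"
      using \<delta> by (simp add: field_simps)
    then show "of_nat n + of_real \<delta> * (deriv g (s0 + of_real \<delta>) / g (s0 + of_real \<delta>)) =
      of_real \<delta> * (deriv f (s0 + of_real \<delta>) / f (s0 + of_real \<delta>))" by (simp add: w_def)
  qed (use gr in auto)
  from Lim_transform_eventually [OF L this] gr(1) show ?thesis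
    by (intro that [of n]) auto
qed

lemma norm_mangoldt_series_le:
  assumes "\<sigma> > 1" "Re s \<ge> \<sigma>"
  shows "norm (mangoldt_series s) \<le> (\<Sum>n. norm (mangoldt n * nat_pow n (of_real \<sigma>)))"
  unfolding mangoldt_series_def
proof (rule norm_suminf_le)
  have "norm (nat_pow n s) \<le> norm (nat_pow n (of_real \<sigma>))" for n
    using assms by (cases "n = 0") (auto simp: norm_nat_pow intro!: powr_mono)
  then show "norm (mangoldt n * nat_pow n s) \<le> norm (mangoldt n * nat_pow n (of_real \<sigma>))" for n
    by (auto simp: norm_mult mangoldt_nonneg intro!: mult_left_mono)
  show "summable (\<lambda>n. norm (mangoldt n * nat_pow n (of_real \<sigma>)))"
    using assms by (intro summable_norm_mangoldt_nat_pow) auto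
qed

abbreviation zeta_logd :: "complex \<Rightarrow> real \<Rightarrow> complex" where
  "zeta_logd s \<delta> \<equiv> of_real \<delta> * (deriv zetaZ (s + of_real \<delta>) / zetaZ (s + of_real \<delta>))"

text \<open>The factorisation at a zero requires a non-constant function. A constant
  \<open>zetaZ\<close> would equal \<open>1\<close> by \<open>zetaZ_1\<close>; this case is covered
  by \<open>m = 0\<close> instead of being refuted.\<close>

lemma zetaZ_logderiv:
  assumes "Re s0 > 0"
  obtains m :: nat where "((\<lambda>\<delta>::real. zeta_logd s0 \<delta>) \<longlongrightarrow> of_nat m) (at_right 0)"
    and "zetaZ s0 = 0 \<Longrightarrow> m > 0"
proof (cases "zetaZ constant_on {s. Re s > 0}")
  case False
  have "connected {s. Re s > 0}" by (intro convex_connected convex_halfspace_Re_gt)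
  from logderiv_order [OF zetaZ_holomorphic open_halfspace_Re_gt this _ False, of s0] assms
  obtain m :: nat where "((\<lambda>\<delta>::real. zeta_logd s0 \<delta>) \<longlongrightarrow> of_nat m) (at_right 0)"
    "zetaZ s0 = 0 \<Longrightarrow> m > 0" by auto
  then show ?thesis by (rule that)
next
  case True
  then have one: "zetaZ s = 1" if "Re s > 0" for s
    using that zetaZ_1 unfolding constant_on_def by (metis mem_Collect_eq one_complex.sel(1) zero_less_one)
  have "eventually (\<lambda>\<delta>::real. 0 = zeta_logd s0 \<delta>) (at_right 0)"
  proof (rule eventually_at_rightI [of 0 1])
    fix \<delta> :: real assume "\<delta> \<in> {0<..<1}"
    then have r: "Re (s0 + of_real \<delta>) > 0" using assms by simp
    have "(zetaZ has_field_derivative 0) (at (s0 + of_real \<delta>))"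
    proof (rule has_field_derivative_transform_within_open [OF DERIV_const [of 1] open_halfspace_Re_gt [of 0]])
      show "s0 + of_real \<delta> \<in> {s. 0 < Re s}" using r by simp
      show "1 = zetaZ s" if "s \<in> {s. 0 < Re s}" for s using one [of s] that by simp
    qed
    then show "0 = zeta_logd s0 \<delta>"
      by (simp add: DERIV_imp_deriv)
  qed auto
  then have "((\<lambda>\<delta>::real. zeta_logd s0 \<delta>) \<longlongrightarrow> of_nat 0) (at_right 0)"
    by (intro tendsto_eventually) (elim eventually_mono, simp only: of_nat_0)
  then show ?thesis using one [OF assms] by (intro that [of 0]) simp_all
qed

text \<open>No Euler product is used: at a zero, \<open>\<delta>\<close> times the logarithmic
  derivative would tend to a positive integer, whereas the absolutely convergent
  \<open>mangoldt_series\<close> keeps the logarithmic derivative bounded to the right of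
  \<open>s0\<close>.\<close>

lemma zetaZ_nonzero_gt:
  assumes "Re s0 > 1"
  shows "zetaZ s0 \<noteq> 0"
proof
  assume "zetaZ s0 = 0"
  then obtain m :: nat where m: "((\<lambda>\<delta>::real. zeta_logd s0 \<delta>) \<longlongrightarrow> of_nat m) (at_right 0)"
    "zetaZ s0 = 0 \<Longrightarrow> m > 0" using zetaZ_logderiv [of s0] assms by auto
  note m = m(1) m(2) [OF \<open>zetaZ s0 = 0\<close>]
  define C where "C = norm (1 / (s0 - 1)) + (\<Sum>n. norm (mangoldt n * nat_pow n (of_real (Re s0))))"
  have bound: "norm (zeta_logd s0 \<delta>) \<le> \<delta> * C" if "\<delta> > 0" for \<delta> :: real
  proof (cases "zetaZ (s0 + of_real \<delta>) = 0")
    \<comment> \<open>Here the quotient is \<open>0\<close> by the convention on division by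
      \<open>0\<close>, so the bound holds at further zeros too.\<close>
    case True
    then show ?thesis using that by (auto simp: C_def intro!: mult_nonneg_nonneg add_nonneg_nonneg suminf_nonneg summable_norm_mangoldt_nat_pow assms)
  next
    case False
    define s where "s = s0 + of_real \<delta>"
    have s: "Re s > 1" "Re s \<ge> Re s0" using that assms by (auto simp: s_def)
    have "deriv zetaZ s / zetaZ s = 1 / (s - 1) - mangoldt_series s"
    proof -
      have "deriv zetaZ s = zetaZ s * (1 / (s - 1) - mangoldt_series s)"
        using mangoldt_series_zetaZ [OF s(1)] by (simp add: algebra_simps)
      then show ?thesis using False by (simp add: s_def)
    qed
    moreover have "norm (1 / (s - 1)) \<le> norm (1 / (s0 - 1))"
    proof -
      have "norm (s0 - 1) \<le> norm (s - 1)"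
        using that assms by (auto simp: s_def cmod_def power2_eq_square intro!: real_sqrt_le_mono add_mono mult_mono)
      moreover have "norm (s0 - 1) > 0" using assms by auto
      ultimately show ?thesis by (simp add: norm_divide frac_le)
    qed
    moreover have "norm (mangoldt_series s) \<le> (\<Sum>n. norm (mangoldt n * nat_pow n (of_real (Re s0))))"
      by (rule norm_mangoldt_series_le) (use assms s in auto)
    moreover have "norm (1 / (s - 1) - mangoldt_series s) \<le> norm (1 / (s - 1)) + norm (mangoldt_series s)"
      by (rule norm_triangle_ineq4)
    ultimately have "norm (deriv zetaZ s / zetaZ s) \<le> C"
      unfolding C_def by simp
    then have "\<delta> * norm (deriv zetaZ s / zetaZ s) \<le> \<delta> * C"
      using that by (intro mult_left_mono) simp_all
    moreover have "norm (of_real \<delta> * (deriv zetaZ s / zetaZ s)) = \<delta> * norm (deriv zetaZ s / zetaZ s)"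
      using that by (subst norm_mult) (simp only: norm_of_real abs_of_pos)
    ultimately show ?thesis by (simp only: s_def)
  qed
  have "((\<lambda>\<delta>::real. zeta_logd s0 \<delta>) \<longlongrightarrow> 0) (at_right 0)"
  proof (rule Lim_null_comparison)
    show "eventually (\<lambda>\<delta>::real. norm (zeta_logd s0 \<delta>) \<le> \<delta> * C) (at_right 0)"
      using eventually_at_right_less [of "0::real"] by eventually_elim (rule bound)
    show "((\<lambda>\<delta>::real. \<delta> * C) \<longlongrightarrow> 0) (at_right 0)"
      by (auto intro!: tendsto_eq_intros)
  qed
  then have "of_nat m = (0::complex)" by (rule tendsto_unique [OF trivial_limit_at_right_real m(1)])
  with m(2) show False by simp
qed

text \<open>The regular part of \<open>- \<zeta>'/\<zeta>\<close>: the pole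
  \<open>1 / (s - 1)\<close> has been split off, and what remains extends continuously to the line
  \<open>Re s = 1\<close>.\<close>

definition zeta_reg :: "complex \<Rightarrow> complex" where
  "zeta_reg s = - deriv zetaZ s / zetaZ s"

lemma mangoldt_series_eq: "Re s > 1 \<Longrightarrow> mangoldt_series s = 1 / (s - 1) + zeta_reg s"
proof -
  assume s: "Re s > 1"
  have "deriv zetaZ s = zetaZ s * (1 / (s - 1) - mangoldt_series s)"
    using mangoldt_series_zetaZ [OF s] by (simp add: algebra_simps)
  then show ?thesis using zetaZ_nonzero_gt [OF s] by (simp add: zeta_reg_def)
qed

lemma Re_mangoldt_series:
  assumes "\<sigma> > 1"
  shows "(\<lambda>n. mangoldt n * real n powr (-\<sigma>) * cos (t * ln (real n))) sums Re (mangoldt_series (Complex \<sigma> t))"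
proof -
  have "(\<lambda>n. mangoldt n * nat_pow n (Complex \<sigma> t)) sums mangoldt_series (Complex \<sigma> t)"
    unfolding mangoldt_series_def using assms
    by (intro summable_sums summable_norm_cancel [OF summable_norm_mangoldt_nat_pow]) auto
  then have "(\<lambda>n. Re (mangoldt n * nat_pow n (Complex \<sigma> t))) sums Re (mangoldt_series (Complex \<sigma> t))"
    by (rule sums_Re)
  moreover have "Re (mangoldt n * nat_pow n (Complex \<sigma> t)) = mangoldt n * real n powr (-\<sigma>) * cos (t * ln (real n))" for n
    by (cases "n = 0") (auto simp: nat_pow_def Re_exp powr_def)
  ultimately show ?thesis by (simp only:)
qed

text \<open>Termwise this is \<open>3 + 4 cos x + cos (2 x) = 2 (1 + cos x)^2 \<ge> 0\<close> with
  the non-negative coefficients of \<open>mangoldt_series\<close>.\<close>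

lemma mertens_inequality:
  assumes "\<sigma> > 1"
  shows "3 * Re (mangoldt_series (Complex \<sigma> 0)) + 4 * Re (mangoldt_series (Complex \<sigma> t)) + Re (mangoldt_series (Complex \<sigma> (2 * t))) \<ge> 0"
proof -
  have "(\<lambda>n. 3 * (mangoldt n * real n powr (-\<sigma>) * cos (0 * ln (real n))) + 4 * (mangoldt n * real n powr (-\<sigma>) * cos (t * ln (real n)))
     + mangoldt n * real n powr (-\<sigma>) * cos (2 * t * ln (real n))) sums
     (3 * Re (mangoldt_series (Complex \<sigma> 0)) + 4 * Re (mangoldt_series (Complex \<sigma> t)) + Re (mangoldt_series (Complex \<sigma> (2 * t))))"
    by (intro sums_add sums_mult Re_mangoldt_series assms)
  moreover have "3 * (mangoldt n * real n powr (-\<sigma>) * cos (0 * ln (real n))) + 4 * (mangoldt n * real n powr (-\<sigma>) * cos (t * ln (real n)))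
     + mangoldt n * real n powr (-\<sigma>) * cos (2 * t * ln (real n)) \<ge> 0" for n
  proof -
    define c where "c = cos (t * ln (real n))"
    have e: "cos (2 * t * ln (real n)) = 2 * c\<^sup>2 - 1"
      using cos_double_cos [of "t * ln (real n)"] by (simp add: c_def mult.assoc)
    then have "3 * (mangoldt n * real n powr (-\<sigma>) * cos (0 * ln (real n))) + 4 * (mangoldt n * real n powr (-\<sigma>) * cos (t * ln (real n)))
     + mangoldt n * real n powr (-\<sigma>) * cos (2 * t * ln (real n)) = mangoldt n * real n powr (-\<sigma>) * (2 * (1 + c)\<^sup>2)"
      unfolding e by (simp add: c_def [symmetric] algebra_simps power2_eq_square)
    also have "\<dots> \<ge> 0" by (intro mult_nonneg_nonneg mangoldt_nonneg) auto
    finally show ?thesis .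
  qed
  ultimately show ?thesis by (rule sums_le [OF _ sums_zero, rotated]) 
qed

text \<open>Multiply the 3-4-1 inequality by \<open>\<delta>\<close> and let \<open>\<delta>\<close>
  tend to \<open>0\<close>: the pole contributes at most \<open>3\<close>, a zero at
  \<open>1 + \<i> t\<close> at most \<open>-4\<close>, and the point \<open>1 + 2 \<i> t\<close>
  nothing positive, so the limit would be negative.\<close>

lemma zetaZ_nonzero_1:
  assumes "Re s0 = 1"
  shows "zetaZ s0 \<noteq> 0"
proof
  assume Z: "zetaZ s0 = 0"
  define t where "t = Im s0"
  have s0: "s0 = Complex 1 t" using assms by (simp add: t_def complex_eq_iff)
  have "t \<noteq> 0" using Z zetaZ_1 s0 by (metis complex_of_real_def of_real_1 zero_neq_one)
  \<comment> \<open>The limit is the residue of \<open>- \<zeta>'/\<zeta>\<close> at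
    \<open>1 + \<i> u\<close>: the pole of zeta counts \<open>1\<close> for \<open>u = 0\<close>
    only, and the order \<open>m\<close> of \<open>zetaZ\<close> is subtracted.\<close>
  have lim: "\<exists>m::nat. ((\<lambda>\<delta>. \<delta> * Re (mangoldt_series (Complex (1 + \<delta>) u))) \<longlongrightarrow> (if u = 0 then 1 else 0) - real m) (at_right 0) \<and>
      (zetaZ (Complex 1 u) = 0 \<longrightarrow> m > 0)" for u
  proof -
    obtain m :: nat where m: "((\<lambda>\<delta>::real. zeta_logd (Complex 1 u) \<delta>) \<longlongrightarrow> of_nat m) (at_right 0)"
      "zetaZ (Complex 1 u) = 0 \<Longrightarrow> m > 0" using zetaZ_logderiv [of "Complex 1 u"] by auto
    have 1: "((\<lambda>\<delta>::real. of_real \<delta> / (Complex 1 u + of_real \<delta> - 1)) \<longlongrightarrow> (if u = 0 then 1 else 0)) (at_right 0)"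
    proof (cases "u = 0")
      case True
      have "eventually (\<lambda>\<delta>::real. of_real \<delta> / (Complex 1 u + of_real \<delta> - 1) = 1) (at_right 0)"
      proof (rule eventually_at_rightI [of 0 1])
        fix \<delta> :: real assume "\<delta> \<in> {0<..<1}"
        moreover have "Complex 1 u + of_real \<delta> - 1 = of_real \<delta>" using True by (simp add: complex_eq_iff)
        ultimately show "of_real \<delta> / (Complex 1 u + of_real \<delta> - 1) = 1" by simp
      qed auto
      then show ?thesis using True by (simp add: tendsto_eventually)
    next
      case False
      have "((\<lambda>\<delta>::real. of_real \<delta> / (Complex 1 u + of_real \<delta> - 1)) \<longlongrightarrow> of_real 0 / (Complex 1 u + of_real 0 - 1)) (at_right 0)"
        using False by (intro tendsto_intros) (auto simp: complex_eq_iff)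
      then show ?thesis using False by simp
    qed
    have "((\<lambda>\<delta>::real. Re (of_real \<delta> / (Complex 1 u + of_real \<delta> - 1) - zeta_logd (Complex 1 u) \<delta>)) \<longlongrightarrow>
        Re ((if u = 0 then 1 else 0) - of_nat m)) (at_right 0)"
      by (intro tendsto_Re tendsto_diff 1 m)
    moreover have "eventually (\<lambda>\<delta>::real. Re (of_real \<delta> / (Complex 1 u + of_real \<delta> - 1) - zeta_logd (Complex 1 u) \<delta>)
       = \<delta> * Re (mangoldt_series (Complex (1 + \<delta>) u))) (at_right 0)"
    proof (rule eventually_at_rightI [of 0 1])
      fix \<delta> :: real assume \<delta>: "\<delta> \<in> {0<..<1}"
      have s: "Complex 1 u + of_real \<delta> = Complex (1 + \<delta>) u" by (simp add: complex_eq_iff)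
      have "of_real \<delta> / (Complex 1 u + of_real \<delta> - 1) - zeta_logd (Complex 1 u) \<delta>
         = of_real \<delta> * mangoldt_series (Complex (1 + \<delta>) u)"
        unfolding s using \<delta> by (subst mangoldt_series_eq) (auto simp: zeta_reg_def algebra_simps)
      then show "Re (of_real \<delta> / (Complex 1 u + of_real \<delta> - 1) - zeta_logd (Complex 1 u) \<delta>)
       = \<delta> * Re (mangoldt_series (Complex (1 + \<delta>) u))" by simp
    qed auto
    ultimately have "((\<lambda>\<delta>. \<delta> * Re (mangoldt_series (Complex (1 + \<delta>) u))) \<longlongrightarrow> Re ((if u = 0 then 1 else 0) - of_nat m)) (at_right 0)"
      by (rule Lim_transform_eventually)
    moreover have "Re ((if u = 0 then 1 else 0) - of_nat m) = (if u = 0 then 1 else 0) - real m" by auto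
    ultimately show ?thesis using m(2) by auto
  qed
  obtain m0 :: nat where m0: "((\<lambda>\<delta>. \<delta> * Re (mangoldt_series (Complex (1 + \<delta>) 0))) \<longlongrightarrow> 1 - real m0) (at_right 0)"
    using lim [of 0] by auto
  obtain m1 :: nat where m1: "((\<lambda>\<delta>. \<delta> * Re (mangoldt_series (Complex (1 + \<delta>) t))) \<longlongrightarrow> 0 - real m1) (at_right 0)" "m1 > 0"
    using lim [of t] \<open>t \<noteq> 0\<close> Z s0 by auto
  obtain m2 :: nat where m2: "((\<lambda>\<delta>. \<delta> * Re (mangoldt_series (Complex (1 + \<delta>) (2 * t)))) \<longlongrightarrow> 0 - real m2) (at_right 0)"
    using lim [of "2 * t"] \<open>t \<noteq> 0\<close> by auto
  have "((\<lambda>\<delta>. 3 * (\<delta> * Re (mangoldt_series (Complex (1 + \<delta>) 0))) + 4 * (\<delta> * Re (mangoldt_series (Complex (1 + \<delta>) t)))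
     + \<delta> * Re (mangoldt_series (Complex (1 + \<delta>) (2 * t)))) \<longlongrightarrow> 3 * (1 - real m0) + 4 * (0 - real m1) + (0 - real m2)) (at_right 0)"
    by (intro tendsto_intros m0 m1 m2)
  moreover have "eventually (\<lambda>\<delta>. 3 * (\<delta> * Re (mangoldt_series (Complex (1 + \<delta>) 0))) + 4 * (\<delta> * Re (mangoldt_series (Complex (1 + \<delta>) t)))
     + \<delta> * Re (mangoldt_series (Complex (1 + \<delta>) (2 * t))) \<ge> 0) (at_right 0)"
  proof (rule eventually_at_rightI [of 0 1])
    fix \<delta> :: real assume \<delta>: "\<delta> \<in> {0<..<1}"
    then have "0 \<le> \<delta> * (3 * Re (mangoldt_series (Complex (1 + \<delta>) 0)) + 4 * Re (mangoldt_series (Complex (1 + \<delta>) t)) + Re (mangoldt_series (Complex (1 + \<delta>) (2 * t))))"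
      by (intro mult_nonneg_nonneg mertens_inequality) auto
    then show "3 * (\<delta> * Re (mangoldt_series (Complex (1 + \<delta>) 0))) + 4 * (\<delta> * Re (mangoldt_series (Complex (1 + \<delta>) t)))
     + \<delta> * Re (mangoldt_series (Complex (1 + \<delta>) (2 * t))) \<ge> 0" by (simp add: algebra_simps)
  qed auto
  ultimately have "0 \<le> 3 * (1 - real m0) + 4 * (0 - real m1) + (0 - real m2)"
    by (rule tendsto_lowerbound) auto
  then show False using m1(2) by simp
qed

text \<open>The boundary line is included. Together with \<open>mangoldt_series_eq\<close> this is
  the analytic input of the limit argument.\<close>

lemma zeta_reg_continuous: "continuous_on {s. Re s \<ge> 1} zeta_reg"
proof -
  have "continuous_on {s. Re s > 0} zetaZ" "continuous_on {s. Re s > 0} (deriv zetaZ)"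
    using zetaZ_holomorphic holomorphic_deriv [OF zetaZ_holomorphic open_halfspace_Re_gt] by (auto intro: holomorphic_on_imp_continuous_on)
  then have "continuous_on {s. Re s \<ge> 1} zetaZ" "continuous_on {s. Re s \<ge> 1} (deriv zetaZ)"
    by (auto elim!: continuous_on_subset)
  moreover have "zetaZ s \<noteq> 0" if "Re s \<ge> 1" for s
    using zetaZ_nonzero_gt zetaZ_nonzero_1 that by (cases "Re s = 1") auto
  ultimately show ?thesis unfolding zeta_reg_def
    by (intro continuous_on_divide continuous_on_minus) auto
qed

section \<open>A positive weight with compactly supported Fourier transform\<close>

definition triangle :: "real \<Rightarrow> real" where "triangle y = max 0 (1 - \<bar>y\<bar>)"

lemma triangle_nonneg [simp]: "triangle y \<ge> 0" by (simp add: triangle_def)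
lemma triangle_eq_0: "\<bar>y\<bar> \<ge> 1 \<Longrightarrow> triangle y = 0" by (simp add: triangle_def)
lemma continuous_triangle [continuous_intros]: "continuous_on A f \<Longrightarrow> continuous_on A (\<lambda>x. triangle (f x))"
  unfolding triangle_def by (intro continuous_intros)
lemma triangle_measurable [measurable]: "triangle \<in> borel_measurable borel"
  by (intro borel_measurable_continuous_onI continuous_intros)

lemma integrable_triangle_mult:
  fixes f :: "real \<Rightarrow> complex"
  assumes "continuous_on UNIV f"
  shows "integrable lborel (\<lambda>y. of_real (triangle y) * f y)"
proof -
  have "integrable lborel (\<lambda>y. indicator {-1..1} y *\<^sub>R (of_real (triangle y) * f y))"
    by (intro borel_integrable_compact [OF compact_Icc] continuous_intros continuous_on_subset [OF assms]) auto
  moreover have "indicator {-1..1} y *\<^sub>R (of_real (triangle y) * f y) = of_real (triangle y) * f y" for y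
    using triangle_eq_0 [of y] by (auto simp: indicator_def)
  ultimately show ?thesis by (simp only:)
qed

lemma integrable_triangle: "integrable lborel triangle"
  using integrable_triangle_mult [of "\<lambda>_. 1"] by (simp add: continuous_on_const complex_of_real_integrable_eq)

section \<open>The Fejer kernel and its Fourier transform\<close>

definition fejer :: "real \<Rightarrow> real" where "fejer x = (sinc (x / 2))\<^sup>2"

lemma fejer_nonneg [simp]: "fejer x \<ge> 0" by (simp add: fejer_def)

lemma fejer_eq: "x \<noteq> 0 \<Longrightarrow> fejer x = 2 * (1 - cos x) / x\<^sup>2"
  using cos_double_sin [of "x / 2"] by (simp add: fejer_def power_divide)

lemma fejer_0: "fejer 0 = 1" by (simp add: fejer_def)

lemma continuous_fejer [continuous_intros]: "continuous_on A f \<Longrightarrow> continuous_on A (\<lambda>x. fejer (f x))"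
proof -
  have "continuous_on UNIV sinc" by (intro continuous_at_imp_continuous_on ballI isCont_sinc)
  then show "continuous_on A f \<Longrightarrow> continuous_on A (\<lambda>x. fejer (f x))"
    unfolding fejer_def by (intro continuous_intros continuous_on_compose2 [of UNIV sinc]) auto
qed

lemma fejer_measurable [measurable]: "fejer \<in> borel_measurable borel"
  by (intro borel_measurable_continuous_onI continuous_intros)

text \<open>One integration by parts on each half of the triangle. With \<open>a = \<i> x\<close>
  the terms \<open>1 / a\<close> at the peak cancel between the halves, leaving
  \<open>(exp a + exp (- a) - 2) / a^2\<close>.\<close>

lemma fejer_transform:
  "(CLINT y|lborel. of_real (triangle y) * iexp (y * x)) = of_real (fejer x)"
proof -
  define f where "f = (\<lambda>y::real. of_real (triangle y) * iexp (y * x))"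
  have int: "integrable lborel f" unfolding f_def
    by (intro integrable_triangle_mult continuous_intros)
  have "(f has_integral of_real (fejer x)) {-1..1}"
  proof (cases "x = 0")
    case True
    have "(f has_integral ((of_real (1 - 1\<^sup>2 / 2) :: complex) - of_real (0 - 0\<^sup>2 / 2))) {0..1}"
    proof (rule fundamental_theorem_of_calculus)
      fix y :: real assume "y \<in> {0..1}"
      then have "f y = of_real (1 - y)" using True by (auto simp: f_def triangle_def)
      then show "((\<lambda>y. of_real (y - y\<^sup>2 / 2)) has_vector_derivative f y) (at y within {0..1})"
        by (auto intro!: derivative_eq_intros simp del: of_real_diff)
    qed auto
    moreover have "(f has_integral ((of_real (0 + 0\<^sup>2 / 2) :: complex) - of_real ((-1) + (-1)\<^sup>2 / 2))) {-1..0}"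
    proof (rule fundamental_theorem_of_calculus)
      fix y :: real assume "y \<in> {-1..0}"
      then have "f y = of_real (1 + y)" using True by (auto simp: f_def triangle_def)
      then show "((\<lambda>y. of_real (y + y\<^sup>2 / 2)) has_vector_derivative f y) (at y within {-1..0})"
        by (auto intro!: derivative_eq_intros simp del: of_real_add)
    qed auto
    ultimately have "(f has_integral (((of_real (0 + 0\<^sup>2 / 2) :: complex) - of_real ((-1) + (-1)\<^sup>2 / 2)) +
        ((of_real (1 - 1\<^sup>2 / 2) :: complex) - of_real (0 - 0\<^sup>2 / 2)))) {-1..1}"
      by (intro has_integral_combine [of "-1" 0 1]) auto
    then show ?thesis using True by (simp add: fejer_0)
  next
    case False
    define a where "a = \<i> * of_real x"
    have a: "a \<noteq> 0" using False by (simp add: a_def)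
    have e: "((\<lambda>y::real. exp (a * of_real y)) has_vector_derivative a * exp (a * of_real y)) (at y within A)" for y A
      by (auto intro!: derivative_eq_intros has_vector_derivative_real_field)
    have fe: "f y = of_real (triangle y) * exp (a * of_real y)" for y by (simp add: f_def a_def algebra_simps)
    have "(f has_integral ((of_real (1 - 1) * (exp (a * of_real 1) / a) + exp (a * of_real 1) / a\<^sup>2) -
        (of_real (1 - 0) * (exp (a * of_real 0) / a) + exp (a * of_real 0) / a\<^sup>2))) {0..1}"
    proof (rule fundamental_theorem_of_calculus)
      fix y :: real assume "y \<in> {0..1}"
      then have "f y = of_real (1 - y) * exp (a * of_real y)" by (auto simp: fe triangle_def)
      also have "\<dots> = (of_real (1 - y) * (a * exp (a * of_real y) / a) + of_real (-1) * (exp (a * of_real y) / a)) + a * exp (a * of_real y) / a\<^sup>2"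
        using a by (simp add: power2_eq_square)
      finally have "f y = \<dots>" .
      moreover have "((\<lambda>y. of_real (1 - y) * (exp (a * of_real y) / a) + exp (a * of_real y) / a\<^sup>2) has_vector_derivative
         (of_real (1 - y) * (a * exp (a * of_real y) / a) + of_real (-1) * (exp (a * of_real y) / a)) + a * exp (a * of_real y) / a\<^sup>2)
         (at y within {0..1})"
        by (intro has_vector_derivative_add has_vector_derivative_mult has_vector_derivative_divide e has_vector_derivative_of_real)
           (auto intro!: derivative_eq_intros)
      ultimately show "((\<lambda>y. of_real (1 - y) * (exp (a * of_real y) / a) + exp (a * of_real y) / a\<^sup>2) has_vector_derivative f y) (at y within {0..1})"
        by (simp only:)
    qed auto
    moreover have "(f has_integral ((of_real (1 + 0) * (exp (a * of_real 0) / a) - exp (a * of_real 0) / a\<^sup>2) -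
        (of_real (1 + - 1) * (exp (a * of_real (-1)) / a) - exp (a * of_real (-1)) / a\<^sup>2))) {-1..0}"
    proof (rule fundamental_theorem_of_calculus)
      fix y :: real assume "y \<in> {-1..0}"
      then have "f y = of_real (1 + y) * exp (a * of_real y)" by (auto simp: fe triangle_def)
      also have "\<dots> = (of_real (1 + y) * (a * exp (a * of_real y) / a) + of_real 1 * (exp (a * of_real y) / a)) - a * exp (a * of_real y) / a\<^sup>2"
        using a by (simp add: power2_eq_square)
      finally have "f y = \<dots>" .
      moreover have "((\<lambda>y. of_real (1 + y) * (exp (a * of_real y) / a) - exp (a * of_real y) / a\<^sup>2) has_vector_derivative
         (of_real (1 + y) * (a * exp (a * of_real y) / a) + of_real 1 * (exp (a * of_real y) / a)) - a * exp (a * of_real y) / a\<^sup>2)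
         (at y within {-1..0})"
        by (intro has_vector_derivative_diff has_vector_derivative_mult has_vector_derivative_divide e has_vector_derivative_of_real)
           (auto intro!: derivative_eq_intros)
      ultimately show "((\<lambda>y. of_real (1 + y) * (exp (a * of_real y) / a) - exp (a * of_real y) / a\<^sup>2) has_vector_derivative f y) (at y within {-1..0})"
        by (simp only:)
    qed auto
    ultimately have "(f has_integral (
        ((of_real (1 + 0) * (exp (a * of_real 0) / a) - exp (a * of_real 0) / a\<^sup>2) -
        (of_real (1 + - 1) * (exp (a * of_real (-1)) / a) - exp (a * of_real (-1)) / a\<^sup>2)) +
        ((of_real (1 - 1) * (exp (a * of_real 1) / a) + exp (a * of_real 1) / a\<^sup>2) -
        (of_real (1 - 0) * (exp (a * of_real 0) / a) + exp (a * of_real 0) / a\<^sup>2)))) {-1..1}"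
      by (intro has_integral_combine [of "-1" 0 1]) auto
    also have "((of_real (1 + 0) * (exp (a * of_real 0) / a) - exp (a * of_real 0) / a\<^sup>2) -
        (of_real (1 + - 1) * (exp (a * of_real (-1)) / a) - exp (a * of_real (-1)) / a\<^sup>2)) +
        ((of_real (1 - 1) * (exp (a * of_real 1) / a) + exp (a * of_real 1) / a\<^sup>2) -
        (of_real (1 - 0) * (exp (a * of_real 0) / a) + exp (a * of_real 0) / a\<^sup>2)) = (exp a + exp (-a) - 2) / a\<^sup>2"
      by (simp add: add_divide_distrib diff_divide_distrib)
    also have "a\<^sup>2 = - of_real (x\<^sup>2)" by (simp add: a_def power_mult_distrib)
    also have "exp a + exp (-a) = of_real (2 * cos x)"
      by (simp add: a_def complex_eq_iff Re_exp Im_exp)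
    also have "(of_real (2 * cos x) - 2) / - of_real (x\<^sup>2) = complex_of_real (fejer x)"
      unfolding fejer_eq [OF False] by (simp add: complex_eq_iff minus_divide_right [symmetric] divide_simps)
    finally show ?thesis .
  qed
  then have "(f has_integral of_real (fejer x)) UNIV"
    by (rule has_integral_on_superset) (auto simp: f_def triangle_def)
  moreover have "(f has_integral integral\<^sup>L lborel f) UNIV"
    using has_integral_integral_lborel [OF int] .
  ultimately show ?thesis unfolding f_def by (rule has_integral_unique [symmetric])
qed

text \<open>The kernel is at most \<open>1\<close> near the origin and at most
  \<open>4 / x^2\<close> elsewhere; the constant \<open>8\<close> covers both, as
  \<open>1 + x^2 \<le> 2 x^2\<close> for \<open>\<bar>x\<bar> \<ge> 1\<close>.\<close>

lemma fejer_le: "fejer x \<le> 8 * inverse (1 + x\<^sup>2)"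
proof (cases "\<bar>x\<bar> \<le> 1")
  case True
  have "\<bar>sin (x / 2)\<bar> \<le> \<bar>x / 2\<bar>" by (rule abs_sin_x_le_abs_x)
  then have "\<bar>sinc (x / 2)\<bar> \<le> 1" by (cases "x = 0") (auto simp: divide_simps)
  then have "fejer x \<le> 1" unfolding fejer_def by (simp add: abs_square_le_1)
  moreover have "x\<^sup>2 \<le> 1" using True by (simp add: abs_square_le_1)
  then have "1 \<le> 8 * inverse (1 + x\<^sup>2)" by (simp add: field_simps add_pos_nonneg)
  ultimately show ?thesis by linarith
next
  case False
  then have "x \<noteq> 0" "x\<^sup>2 \<ge> 1" by (auto simp: abs_square_le_1 intro: less_imp_le) (metis abs_square_le_1 linear)
  have "fejer x \<le> 2 * (1 - (-1)) / x\<^sup>2"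
    unfolding fejer_eq [OF \<open>x \<noteq> 0\<close>] using cos_ge_minus_one [of x] by (intro divide_right_mono mult_left_mono) auto
  also have "\<dots> \<le> 8 * inverse (1 + x\<^sup>2)" using \<open>x\<^sup>2 \<ge> 1\<close> by (simp add: divide_simps add_pos_nonneg)
  finally show ?thesis .
qed

lemma integrable_fejer: "integrable lborel fejer"
proof (rule Bochner_Integration.integrable_bound)
  show "integrable lborel (\<lambda>x::real. 8 * inverse (1 + x\<^sup>2))"
    using integrable_inverse_1_plus_square by (simp add: set_integrable_def)
qed (auto intro!: AE_I2 fejer_le)

text \<open>The Fourier side of the weight \<open>fejer_wt\<close>: a translation by
  \<open>pi\<close> becomes a phase factor, so the support remains that of the triangle.\<close>

definition fejer_ft :: "real \<Rightarrow> complex" where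
  "fejer_ft y = of_real (triangle y) * (1 + iexp (- (pi * y)))"

text \<open>The Fejer kernel has zeros. Adding its translate by \<open>\<pi>\<close> removes them, so that test functions can be divided by the weight.\<close>

definition fejer_wt :: "real \<Rightarrow> real" where
  "fejer_wt x = fejer x + fejer (x - pi)"

lemma continuous_fejer_wt [continuous_intros]: "continuous_on A f \<Longrightarrow> continuous_on A (\<lambda>x. fejer_wt (f x))"
  unfolding fejer_wt_def by (intro continuous_intros)

lemma continuous_fejer_ft [continuous_intros]: "continuous_on A f \<Longrightarrow> continuous_on A (\<lambda>x. fejer_ft (f x))"
  unfolding fejer_ft_def by (intro continuous_intros)

lemma fejer_wt_measurable [measurable]: "fejer_wt \<in> borel_measurable borel"
  unfolding fejer_wt_def by measurable

lemma fejer_ft_measurable [measurable]: "fejer_ft \<in> borel_measurable borel"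
  unfolding fejer_ft_def by measurable

lemma integrable_fejer_wt: "integrable lborel fejer_wt"
  unfolding fejer_wt_def using lborel_integrable_real_affine [OF integrable_fejer, of 1 "-pi"]
  by (intro Bochner_Integration.integrable_add integrable_fejer) (auto simp: add.commute)

text \<open>The numerators \<open>1 - cos x\<close> and \<open>1 - cos (x - pi) = 1 + cos x\<close>
  add up to \<open>2\<close>, so they never vanish together. The resulting quadratic lower bound
  lets the weight dominate exponentially decaying test functions.\<close>

lemma fejer_wt_bound: "fejer_wt x \<ge> 4 / (\<bar>x\<bar> + pi)\<^sup>2"
proof -
  have *: "fejer y \<ge> 2 * (1 - cos y) / (\<bar>x\<bar> + pi)\<^sup>2" if "\<bar>y\<bar> \<le> \<bar>x\<bar> + pi" for y
  proof (cases "y = 0")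
    case False
    have "y\<^sup>2 \<le> (\<bar>x\<bar> + pi)\<^sup>2" using that by (simp add: abs_le_square_iff [symmetric])
    then show ?thesis unfolding fejer_eq [OF False]
      using False by (intro divide_left_mono) (auto simp: zero_less_mult_iff add_nonneg_pos)
  qed simp
  have "4 / (\<bar>x\<bar> + pi)\<^sup>2 = 2 * (1 - cos x) / (\<bar>x\<bar> + pi)\<^sup>2 + 2 * (1 - cos (x - pi)) / (\<bar>x\<bar> + pi)\<^sup>2"
    by (simp add: add_divide_distrib [symmetric])
  also have "\<dots> \<le> fejer_wt x" unfolding fejer_wt_def
    by (intro add_mono *) (use pi_gt_zero in linarith)+
  finally show ?thesis .
qed

lemma fejer_wt_pos: "fejer_wt x > 0"
proof -
  have "\<bar>x\<bar> + pi > 0" using pi_gt_zero by linarith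
  then have "4 / (\<bar>x\<bar> + pi)\<^sup>2 > 0" by simp
  then show ?thesis using fejer_wt_bound [of x] by linarith
qed

lemma fejer_ft_transform: "(CLINT y|lborel. fejer_ft y * iexp (y * x)) = of_real (fejer_wt x)"
proof -
  have "(CLINT y|lborel. fejer_ft y * iexp (y * x)) =
      (CLINT y|lborel. of_real (triangle y) * iexp (y * x) + of_real (triangle y) * iexp (y * (x - pi)))"
    by (intro Bochner_Integration.integral_cong refl)
       (simp add: fejer_ft_def algebra_simps exp_add [symmetric] exp_diff)
  also have "\<dots> = of_real (fejer_wt x)"
    unfolding fejer_wt_def of_real_add fejer_transform [symmetric]
    by (intro Bochner_Integration.integral_add integrable_triangle_mult continuous_intros)
  finally show ?thesis .
qed

lemma norm_fejer_ft_le: "norm (fejer_ft y) \<le> 2 * triangle y"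
proof -
  have "norm (fejer_ft y) = triangle y * norm (1 + iexp (- (pi * y)))" by (simp add: fejer_ft_def norm_mult)
  also have "\<dots> \<le> triangle y * (norm (1::complex) + norm (iexp (- (pi * y))))"
    by (intro mult_left_mono norm_triangle_ineq) auto
  finally show ?thesis by simp
qed

text \<open>Fubini, after writing the weight as a Fourier integral: weighting a measure amounts to
  averaging its characteristic function over the window of radius \<open>1\<close> around
  \<open>u\<close>.\<close>

lemma fejer_wt_char:
  assumes M: "finite_measure M" and [measurable_cong, simp]: "sets M = sets borel"
  shows "(CLINT x|M. of_real (fejer_wt x) * iexp (u * x)) = (CLINT y|lborel. fejer_ft y * char M (y + u))"
proof -
  interpret M: finite_measure M by fact
  interpret P: pair_sigma_finite M lborel ..
  have [measurable]: "(\<lambda>(x, y). fejer_ft y * iexp ((y + u) * x)) \<in> borel_measurable (M \<Otimes>\<^sub>M lborel)"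
    by measurable
  have ik: "integrable lborel (\<lambda>y. norm (fejer_ft y))"
    by (rule Bochner_Integration.integrable_bound [of _ "\<lambda>y. 2 * triangle y"])
       (auto intro!: AE_I2 norm_fejer_ft_le integrable_triangle)
  have ii: "integrable lborel (\<lambda>y. fejer_ft y * iexp ((y + u) * x))" for x
    by (rule Bochner_Integration.integrable_bound [OF ik]) (auto simp: norm_mult)
  have inner: "(CLINT y|lborel. fejer_ft y * iexp ((y + u) * x)) = of_real (fejer_wt x) * iexp (u * x)" for x
  proof -
    have "(CLINT y|lborel. fejer_ft y * iexp ((y + u) * x)) = (CLINT y|lborel. (fejer_ft y * iexp (y * x)) * iexp (u * x))"
      by (intro Bochner_Integration.integral_cong refl) (simp add: algebra_simps exp_add)
    also have "\<dots> = of_real (fejer_wt x) * iexp (u * x)"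
      unfolding fejer_ft_transform [symmetric] by (rule integral_mult_left_zero)
    finally show ?thesis .
  qed
  have "integrable (M \<Otimes>\<^sub>M lborel) (\<lambda>(x, y). fejer_ft y * iexp ((y + u) * x))"
  proof (rule P.Fubini_integrable)
    show "integrable M (\<lambda>x. LINT y|lborel. norm (case (x, y) of (x, y) \<Rightarrow> fejer_ft y * iexp ((y + u) * x)))"
      by (simp add: norm_mult)
    show "AE x in M. integrable lborel (\<lambda>y. case (x, y) of (x, y) \<Rightarrow> fejer_ft y * iexp ((y + u) * x))"
      unfolding prod.case by (intro AE_I2 ii)
  qed measurable
  then have "(CLINT y|lborel. CLINT x|M. fejer_ft y * iexp ((y + u) * x)) = (CLINT x|M. CLINT y|lborel. fejer_ft y * iexp ((y + u) * x))"
    by (rule P.Fubini_integral)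
  then show ?thesis unfolding char_def inner integral_mult_right_zero by (rule sym)
qed

text \<open>Translating by half a period \<open>\<pi> / T\<close> changes the sign of the oscillating factor. Hence uniform continuity
  suffices and no derivative of \<open>\<psi>\<close> is needed.\<close>

lemma riemann_lebesgue_uniform:
  fixes \<psi> :: "real \<Rightarrow> real \<Rightarrow> complex"
  assumes cont: "continuous_on ({0..1} \<times> UNIV) (\<lambda>(e, y). \<psi> e y)"
    and supp: "\<And>e y. \<bar>y\<bar> \<ge> 1 \<Longrightarrow> \<psi> e y = 0"
    and e: "eventually (\<lambda>T. e T \<in> {0..1}) at_top"
  shows "((\<lambda>T. CLINT y|lborel. \<psi> (e T) y * iexp (- (T * y))) \<longlongrightarrow> 0) at_top"
proof (rule tendstoI)
  fix \<epsilon> :: real assume "\<epsilon> > 0"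
  \<comment> \<open>Compact, and large enough to contain \<open>y\<close> and \<open>t + y\<close>
    for \<open>\<bar>y\<bar> \<le> 2\<close> and \<open>t < 1\<close>; uniform continuity is then
    simultaneous in the parameter \<open>e\<close>.\<close>
  define K where "K = {0..1::real} \<times> {-5..5::real}"
  have "uniformly_continuous_on K (\<lambda>(e, y). \<psi> e y)"
    by (intro compact_uniformly_continuous continuous_on_subset [OF cont]) (auto simp: K_def intro: compact_Times)
  moreover have "\<epsilon> / 4 > 0" using \<open>\<epsilon> > 0\<close> by simp
  ultimately have "\<exists>d>0. \<forall>x\<in>K. \<forall>x'\<in>K. dist x' x < d \<longrightarrow> dist (case_prod \<psi> x') (case_prod \<psi> x) < \<epsilon> / 4"
    unfolding uniformly_continuous_on_def by (elim allE [of _ "\<epsilon> / 4"] impE)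
  then obtain d where d: "d > 0" "\<And>x x'. x \<in> K \<Longrightarrow> x' \<in> K \<Longrightarrow> dist x' x < d \<Longrightarrow> dist (case_prod \<psi> x') (case_prod \<psi> x) < \<epsilon> / 4"
    by (elim exE conjE) simp
  have "eventually (\<lambda>T::real. pi / T < min 1 d) at_top"
    using d(1) by (intro order_tendstoD(2) [OF tendsto_divide_0 [OF tendsto_const filterlim_at_top_imp_at_infinity [OF filterlim_ident]]]) auto
  then show "eventually (\<lambda>T. dist (CLINT y|lborel. \<psi> (e T) y * iexp (- (T * y))) 0 < \<epsilon>) at_top"
    using e eventually_gt_at_top [of 0]
  proof eventually_elim
    case (elim T)
    define t where "t = pi / T"
    define f where "f = \<psi> (e T)"
    have t: "t > 0" "t < 1" "t < d" using elim by (auto simp: t_def)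
    have f_cont: "continuous_on UNIV f"
    proof -
      have "continuous_on UNIV (\<lambda>y. case (e T, y) of (e, y) \<Rightarrow> \<psi> e y)"
        by (rule continuous_on_compose2 [OF cont]) (use elim in \<open>auto intro!: continuous_intros\<close>)
      then show ?thesis by (simp add: f_def)
    qed
    have [measurable]: "f \<in> borel_measurable borel" by (intro borel_measurable_continuous_onI f_cont)
    define g where "g = (\<lambda>y. f y * iexp (- (T * y)))"
    have [measurable]: "g \<in> borel_measurable borel" unfolding g_def by measurable
    have "integrable lborel (\<lambda>y. indicator {-1..1} y *\<^sub>R g y)"
      unfolding g_def by (intro borel_integrable_compact [OF compact_Icc] continuous_intros continuous_on_subset [OF f_cont]) auto
    moreover have "indicator {-1..1} y *\<^sub>R g y = g y" for y
      using supp [of y "e T"] by (auto simp: indicator_def f_def g_def)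
    ultimately have ig: "integrable lborel g" by (simp only:)
    have ig': "integrable lborel (\<lambda>y. g (t + 1 * y))"
      by (rule lborel_integrable_real_affine [OF ig]) auto
    have "integral\<^sup>L lborel g = \<bar>1\<bar> *\<^sub>R (CLINT y|lborel. g (t + 1 * y))"
      by (rule lborel_integral_real_affine) auto
    then have "2 * integral\<^sup>L lborel g = integral\<^sup>L lborel g + (CLINT y|lborel. g (t + 1 * y))" by simp
    also have "\<dots> = (CLINT y|lborel. g y + g (t + 1 * y))"
      by (rule Bochner_Integration.integral_add [symmetric, OF ig ig'])
    finally have "2 * norm (integral\<^sup>L lborel g) = norm (CLINT y|lborel. g y + g (t + 1 * y))"
      by (metis norm_mult norm_numeral)
    \<comment> \<open>Both \<open>g\<close> and its translate vanish outside an interval of length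
      \<open>4\<close>, so \<open>\<epsilon> / 4\<close> pointwise gives \<open>\<epsilon>\<close>
      for twice the integral.\<close>
    also have "\<dots> \<le> (LINT y|lborel. indicator {-2..2::real} y * (\<epsilon> / 4))"
    proof (rule Bochner_Integration.integral_norm_bound_integral)
      show "integrable lborel (\<lambda>y. g y + g (t + 1 * y))"
        by (rule Bochner_Integration.integrable_add [OF ig ig'])
      show "integrable lborel (\<lambda>y::real. indicator {-2..2} y * (\<epsilon> / 4))" by simp
      fix y :: real
      have "iexp (- (T * (t + y))) = - iexp (- (T * y))"
      proof -
        have "- (T * (t + y)) = - (T * y) - pi" using elim by (simp add: t_def field_simps)
        then show ?thesis by (simp add: complex_eq_iff Re_exp Im_exp)
      qed
      then have eq: "g y + g (t + 1 * y) = (f y - f (t + y)) * iexp (- (T * y))"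
        by (simp add: g_def algebra_simps)
      show "norm (g y + g (t + 1 * y)) \<le> indicator {-2..2} y * (\<epsilon> / 4)"
      proof (cases "y \<in> {-2..2}")
        case True
        then have "dist (f (t + y)) (f y) < \<epsilon> / 4"
          using d(2) [of "(e T, y)" "(e T, t + y)"] t elim by (auto simp: K_def f_def dist_Pair_Pair dist_norm)
        then show ?thesis unfolding eq norm_mult using True by (simp add: dist_norm norm_minus_commute)
      next
        case False
        then have "f y = 0" "f (t + y) = 0" using supp t by (auto simp: f_def)
        then show ?thesis unfolding eq using False by simp
      qed
    qed
    also have "\<dots> = \<epsilon>" by simp
    finally show ?case using \<open>\<epsilon> > 0\<close> by (simp add: f_def g_def)
  qed
qed

section \<open>The prime number theorem through Levy continuity\<close>

text \<open>This realises the pole \<open>1 / (s - 1)\<close> as the transform of an exponentially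
  damped half-line, the continuous measure with which the prime powers are compared.\<close>

lemma exp_complex_integral:
  assumes "Re s > 0"
  shows "integrable lborel (\<lambda>x::real. indicator {0<..} x *\<^sub>R exp (- s * of_real x))"
    and "(CLINT x|lborel. indicator {0<..} x *\<^sub>R exp (- s * of_real x)) = 1 / s"
proof -
  have s: "s \<noteq> 0" using assms by auto
  have r: "integrable lborel (\<lambda>x::real. indicator {0<..} x *\<^sub>R exp (-(x * Re s)))"
    using integrable_I0i_exp_mscale [OF assms] by (simp add: set_integrable_def)
  show 1: "integrable lborel (\<lambda>x::real. indicator {0<..} x *\<^sub>R exp (- s * of_real x))"
    by (rule Bochner_Integration.integrable_bound [OF r]) (auto simp: indicator_def mult.commute)
  have "(CLBINT x=0..\<infinity>. exp (- s * of_real x)) = 0 - (- 1 / s)"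
  proof (rule interval_integral_FTC_integrable)
    show "((\<lambda>x. - exp (- s * of_real x) / s) has_vector_derivative exp (- s * of_real x)) (at x)" for x :: real
      using s by (auto intro!: derivative_eq_intros has_vector_derivative_real_field)
    show "isCont (\<lambda>x. exp (- s * complex_of_real x)) x" for x
      by (intro continuous_intros)
    show "set_integrable lborel (einterval 0 \<infinity>) (\<lambda>x. exp (- s * complex_of_real x))"
      using 1 by (simp add: set_integrable_def zero_ereal_def)
    have "((\<lambda>x::real. - exp (- s * of_real x) / s) \<longlongrightarrow> - exp (- s * of_real 0) / s) (at_right 0)"
      using s by (intro tendsto_intros) auto
    then show "(((\<lambda>x. - exp (- s * of_real x) / s) \<circ> real_of_ereal) \<longlongrightarrow> - 1 / s) (at_right 0)"
      by (simp add: ereal_tendsto_simps zero_ereal_def)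
    have "((\<lambda>x::real. exp (- Re s * x) / norm s) \<longlongrightarrow> 0) at_top"
      using assms s by real_asymp
    then have "((\<lambda>x::real. norm (- exp (- s * of_real x) / s)) \<longlongrightarrow> 0) at_top"
      by (simp add: norm_divide)
    then show "(((\<lambda>x. - exp (- s * of_real x) / s) \<circ> real_of_ereal) \<longlongrightarrow> 0) (at_left \<infinity>)"
      unfolding ereal_tendsto_simps by (rule tendsto_norm_zero_cancel)
  qed simp
  then show "(CLINT x|lborel. indicator {0<..} x *\<^sub>R exp (- s * of_real x)) = 1 / s"
    by (simp add: interval_lebesgue_integral_0_infty set_lebesgue_integral_def)
qed

text \<open>One construction serves both the discrete measure on prime powers and the continuous one
  on the half-line; \<open>g\<close> places the points on the logarithmic scale and translates them
  by \<open>T\<close>.\<close>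

definition push_density :: "'a measure \<Rightarrow> ('a \<Rightarrow> real) \<Rightarrow> ('a \<Rightarrow> real) \<Rightarrow> real measure" where
  "push_density M f g = distr (density M (\<lambda>x. ennreal (f x))) borel g"

lemma sets_push_density [simp, measurable_cong]: "sets (push_density M f g) = sets borel"
  by (simp add: push_density_def)

lemma emeasure_push_density:
  assumes "integrable M f" "\<And>x. f x \<ge> 0" "g \<in> borel_measurable M"
  shows "emeasure (push_density M f g) (space (push_density M f g)) = ennreal (integral\<^sup>L M f)"
proof -
  have [measurable]: "f \<in> borel_measurable M" "g \<in> borel_measurable M" using assms by auto
  have "emeasure (push_density M f g) (space (push_density M f g)) = emeasure (density M (\<lambda>x. ennreal (f x))) (space M)"
    by (simp add: push_density_def emeasure_distr)
  also have "\<dots> = (\<integral>\<^sup>+ x. ennreal (f x) \<partial>M)"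
    by (subst emeasure_density) (auto intro!: nn_integral_cong)
  also have "\<dots> = ennreal (integral\<^sup>L M f)"
    by (rule nn_integral_eq_integral [OF assms(1)]) (use assms in auto)
  finally show ?thesis .
qed

lemma finite_push_density:
  assumes "integrable M f" "\<And>x. f x \<ge> 0" "g \<in> borel_measurable M"
  shows "finite_measure (push_density M f g)"
  by (rule finite_measureI) (simp only: emeasure_push_density [OF assms], simp)

lemma integral_push_density:
  fixes F :: "real \<Rightarrow> 'b::{banach, second_countable_topology}"
  assumes [measurable]: "f \<in> borel_measurable M" "g \<in> borel_measurable M" "F \<in> borel_measurable borel" and "\<And>x. f x \<ge> 0"
  shows "integral\<^sup>L (push_density M f g) F = (LINT x|M. f x *\<^sub>R F (g x))"
  unfolding push_density_def
  by (subst integral_distr, simp, simp, subst integral_density) (use assms(4) in auto)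

lemma real_distribution_push_density:
  assumes "integrable M f" "\<And>x. f x \<ge> 0" "g \<in> borel_measurable M" "integral\<^sup>L M f = 1"
  shows "real_distribution (push_density M f g)"
proof -
  interpret prob_space "push_density M f g"
    by (rule prob_spaceI) (simp only: emeasure_push_density [OF assms(1-3)] assms(4), simp)
  show ?thesis by standard simp
qed

definition mangoldt_wt :: "real \<Rightarrow> nat \<Rightarrow> real" where
  "mangoldt_wt e n = mangoldt n * real n powr (- (1 + e))"

lemma mangoldt_wt_nonneg [simp]: "mangoldt_wt e n \<ge> 0"
  by (simp add: mangoldt_wt_def mangoldt_nonneg)

lemma mangoldt_wt_eq: "norm (mangoldt n * nat_pow n (of_real (1 + e))) = mangoldt_wt e n"
  by (cases "n = 0") (auto simp: mangoldt_wt_def norm_mult norm_nat_pow)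

lemma integrable_mangoldt_wt: "e > 0 \<Longrightarrow> integrable (count_space UNIV) (mangoldt_wt e)"
  using summable_norm_mangoldt_nat_pow [of "of_real (1 + e)"]
  unfolding mangoldt_wt_eq integrable_count_space_nat_iff by simp

text \<open>The character \<open>exp (\<i> w ln n)\<close> lowers the exponent \<open>s\<close> by
  \<open>\<i> w\<close>, whence the imaginary part \<open>- w\<close>; the translation by
  \<open>T\<close> only produces a phase.\<close>

lemma char_mangoldt_wt:
  assumes "e > 0"
  shows "char (push_density (count_space UNIV) (mangoldt_wt e) (\<lambda>n. ln (real n) - T)) w = 
     iexp (- (w * T)) * mangoldt_series (Complex (1 + e) (- w))"
proof -
  have "char (push_density (count_space UNIV) (mangoldt_wt e) (\<lambda>n. ln (real n) - T)) w =
     (CLINT n|count_space UNIV. mangoldt_wt e n *\<^sub>R iexp (w * (ln (real n) - T)))"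
    unfolding char_def by (intro integral_push_density) auto
  also have "(\<lambda>n. mangoldt_wt e n *\<^sub>R iexp (w * (ln (real n) - T))) = 
      (\<lambda>n. iexp (- (w * T)) * (mangoldt n * nat_pow n (Complex (1 + e) (- w))))"
  proof
    fix n :: nat
    show "mangoldt_wt e n *\<^sub>R iexp (w * (ln (real n) - T)) = iexp (- (w * T)) * (mangoldt n * nat_pow n (Complex (1 + e) (- w)))"
    proof (cases "n = 0")
      case False
      have c: "Complex (1 + e) (- w) = of_real (1 + e) - \<i> * of_real w" by (simp add: complex_eq_iff)
      have "nat_pow n (Complex (1 + e) (- w)) = of_real (real n powr (- (1 + e))) * iexp (w * ln (real n))"
      proof -
        have "nat_pow n (Complex (1 + e) (- w)) = exp (of_real (- (1 + e) * ln (real n)) + \<i> * of_real (w * ln (real n)))"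
          using False by (simp add: c nat_pow_def algebra_simps)
        then show ?thesis
          using False by (simp only: exp_add exp_of_real powr_def of_nat_eq_0_iff if_False)
      qed
      moreover have "iexp (w * (ln (real n) - T)) = iexp (w * ln (real n)) * iexp (- (w * T))"
        by (simp add: exp_add [symmetric] algebra_simps)
      ultimately show ?thesis by (simp add: mangoldt_wt_def scaleR_conv_of_real)
    qed (simp add: mangoldt_wt_def)
  qed
  also have "(CLINT n|count_space UNIV. iexp (- (w * T)) * (mangoldt n * nat_pow n (Complex (1 + e) (- w)))) =
     iexp (- (w * T)) * (CLINT n|count_space UNIV. mangoldt n * nat_pow n (Complex (1 + e) (- w)))"
    by (rule integral_mult_right_zero)
  also have "(CLINT n|count_space UNIV. mangoldt n * nat_pow n (Complex (1 + e) (- w))) = mangoldt_series (Complex (1 + e) (- w))"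
    unfolding mangoldt_series_def using assms
    by (intro integral_count_space_nat) (simp only: integrable_count_space_nat_iff, rule summable_norm_mangoldt_nat_pow, simp)
  finally show ?thesis .
qed

definition exp_wt :: "real \<Rightarrow> real \<Rightarrow> real" where
  "exp_wt e x = indicator {0<..} x * exp (- e * x)"

lemma exp_wt_nonneg [simp]: "exp_wt e x \<ge> 0"
  by (simp add: exp_wt_def)

lemma exp_wt_measurable [measurable]: "exp_wt e \<in> borel_measurable borel"
  unfolding exp_wt_def by measurable

lemma integrable_exp_wt: "e > 0 \<Longrightarrow> integrable lborel (exp_wt e)"
  using integrable_I0i_exp_mscale [of e] unfolding set_integrable_def exp_wt_def by (simp add: mult.commute)

lemma char_exp_wt:
  assumes "e > 0"
  shows "char (push_density lborel (exp_wt e) (\<lambda>x. x - T)) w = iexp (- (w * T)) * (1 / Complex e (- w))"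
proof -
  have "char (push_density lborel (exp_wt e) (\<lambda>x. x - T)) w = (CLINT x|lborel. exp_wt e x *\<^sub>R iexp (w * (x - T)))"
    unfolding char_def by (intro integral_push_density) auto
  also have "(\<lambda>x. exp_wt e x *\<^sub>R iexp (w * (x - T))) = 
      (\<lambda>x. iexp (- (w * T)) * (indicator {0<..} x *\<^sub>R exp (- Complex e (- w) * of_real x)))"
  proof
    fix x :: real
    have c: "Complex e (- w) = of_real e - \<i> * of_real w" by (simp add: complex_eq_iff)
    have "exp (- Complex e (- w) * of_real x) = of_real (exp (- e * x)) * iexp (w * x)"
      unfolding c of_real_exp by (simp add: exp_add [symmetric] algebra_simps)
    moreover have "iexp (w * (x - T)) = iexp (w * x) * iexp (- (w * T))"
      by (simp add: exp_add [symmetric] algebra_simps)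
    ultimately show "exp_wt e x *\<^sub>R iexp (w * (x - T)) = iexp (- (w * T)) * (indicator {0<..} x *\<^sub>R exp (- Complex e (- w) * of_real x))"
      by (simp add: exp_wt_def scaleR_conv_of_real indicator_def)
  qed
  also have "(CLINT x|lborel. iexp (- (w * T)) * (indicator {0<..} x *\<^sub>R exp (- Complex e (- w) * of_real x))) = iexp (- (w * T)) * (1 / Complex e (- w))"
    using assms by (simp only: integral_mult_right_zero exp_complex_integral(2) complex.sel)
  finally show ?thesis .
qed

text \<open>The characteristic function of the translated and weighted measure, not normalised: at
  \<open>u = 0\<close> it is the total mass.\<close>

definition mangoldt_trans :: "real \<Rightarrow> real \<Rightarrow> real \<Rightarrow> complex" where
  "mangoldt_trans e T u = (CLINT n|count_space UNIV. mangoldt_wt e n *\<^sub>R (of_real (fejer_wt (ln (real n) - T)) * iexp (u * (ln (real n) - T))))"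

definition exp_trans :: "real \<Rightarrow> real \<Rightarrow> real \<Rightarrow> complex" where
  "exp_trans e T u = (CLINT x|lborel. exp_wt e x *\<^sub>R (of_real (fejer_wt (x - T)) * iexp (u * (x - T))))"

text \<open>Both transforms carry the same pole, so only \<open>zeta_reg\<close> survives in the
  difference, and it stays bounded on the window as \<open>e\<close> tends to \<open>0\<close>. The
  phase in \<open>T * y\<close> is the one on which Riemann-Lebesgue acts.\<close>

lemma mangoldt_trans_minus_exp_trans:
  assumes e: "e > 0"
  shows "mangoldt_trans e T u - exp_trans e T u =
     iexp (- (u * T)) * (CLINT y|lborel. (fejer_ft y * zeta_reg (Complex (1 + e) (- (y + u)))) * iexp (- (T * y)))"
proof -
  define M1 where "M1 = push_density (count_space UNIV) (mangoldt_wt e) (\<lambda>n. ln (real n) - T)"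
  define M2 where "M2 = push_density lborel (exp_wt e) (\<lambda>x. x - T)"
  have fin: "finite_measure M1" "finite_measure M2" unfolding M1_def M2_def
    using e by (auto intro!: finite_push_density integrable_mangoldt_wt integrable_exp_wt)
  have sets: "sets M1 = sets borel" "sets M2 = sets borel" by (auto simp: M1_def M2_def)
  have "mangoldt_trans e T u = (CLINT x|M1. of_real (fejer_wt x) * iexp (u * x))"
    unfolding mangoldt_trans_def M1_def by (rule integral_push_density [symmetric]) auto
  also have "\<dots> = (CLINT y|lborel. fejer_ft y * char M1 (y + u))" by (rule fejer_wt_char [OF fin(1) sets(1)])
  finally have 1: "mangoldt_trans e T u = (CLINT y|lborel. fejer_ft y * char M1 (y + u))" .
  have "exp_trans e T u = (CLINT x|M2. of_real (fejer_wt x) * iexp (u * x))"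
    unfolding exp_trans_def M2_def by (rule integral_push_density [symmetric]) auto
  also have "\<dots> = (CLINT y|lborel. fejer_ft y * char M2 (y + u))" by (rule fejer_wt_char [OF fin(2) sets(2)])
  finally have 2: "exp_trans e T u = (CLINT y|lborel. fejer_ft y * char M2 (y + u))" .
  have int: "integrable lborel (\<lambda>y. fejer_ft y * char M (y + u))" if M: "finite_measure M" "sets M = sets borel" for M
  proof (rule Bochner_Integration.integrable_bound)
    interpret finite_measure M by fact
    note M(2) [measurable_cong]
    show "integrable lborel (\<lambda>y. 2 * triangle y * measure M (space M))"
      using integrable_triangle by simp
    show "(\<lambda>y. fejer_ft y * char M (y + u)) \<in> borel_measurable lborel"
      unfolding char_def by measurable
    have "norm (fejer_ft y * char M (y + u)) \<le> 2 * triangle y * measure M (space M)" for y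
    proof -
      have "norm (char M (y + u)) \<le> (LINT x|M. norm (iexp ((y + u) * x)))"
        unfolding char_def by (rule integral_norm_bound)
      also have "\<dots> = measure M (space M)" by simp
      finally show ?thesis unfolding norm_mult by (intro mult_mono norm_fejer_ft_le) auto
    qed
    then show "AE y in lborel. norm (fejer_ft y * char M (y + u)) \<le> norm (2 * triangle y * measure M (space M))"
      by (auto simp: abs_mult)
  qed
  have "mangoldt_trans e T u - exp_trans e T u = (CLINT y|lborel. fejer_ft y * char M1 (y + u) - fejer_ft y * char M2 (y + u))"
    unfolding 1 2 by (rule Bochner_Integration.integral_diff [symmetric]) (intro int fin sets)+
  also have "\<dots> = (CLINT y|lborel. iexp (- (u * T)) * ((fejer_ft y * zeta_reg (Complex (1 + e) (- (y + u)))) * iexp (- (T * y))))"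
  proof (intro Bochner_Integration.integral_cong refl)
    fix y :: real
    define w where "w = y + u"
    have "mangoldt_series (Complex (1 + e) (- w)) = 1 / Complex e (- w) + zeta_reg (Complex (1 + e) (- w))"
    proof -
      have "Complex (1 + e) (- w) - 1 = Complex e (- w)" by (simp add: complex_eq_iff)
      then show ?thesis using mangoldt_series_eq [of "Complex (1 + e) (- w)"] e by simp
    qed
    moreover have "iexp (- (w * T)) = iexp (- (u * T)) * iexp (- (T * y))"
      by (simp add: w_def exp_add [symmetric] algebra_simps)
    ultimately show "fejer_ft y * char M1 (y + u) - fejer_ft y * char M2 (y + u) =
       iexp (- (u * T)) * ((fejer_ft y * zeta_reg (Complex (1 + e) (- (y + u)))) * iexp (- (T * y)))"
      unfolding w_def [symmetric] M1_def M2_def char_mangoldt_wt [OF e] char_exp_wt [OF e]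
      by (simp only: algebra_simps)
  qed
  also have "\<dots> = iexp (- (u * T)) * (CLINT y|lborel. (fejer_ft y * zeta_reg (Complex (1 + e) (- (y + u)))) * iexp (- (T * y)))"
    by (rule integral_mult_right_zero)
  finally show ?thesis .
qed

text \<open>The damping moves with \<open>T\<close>, so Riemann-Lebesgue is needed uniformly over
  \<open>e\<close> in \<open>{0..1}\<close>. This interval includes \<open>e = 0\<close>, where
  \<open>zeta_reg\<close> is evaluated on the line \<open>Re s = 1\<close>.\<close>

lemma mangoldt_trans_exp_trans_tendsto: "((\<lambda>T. mangoldt_trans (1 / T\<^sup>2) T u - exp_trans (1 / T\<^sup>2) T u) \<longlongrightarrow> 0) at_top"
proof -
  have "((\<lambda>T. CLINT y|lborel. (fejer_ft y * zeta_reg (Complex (1 + 1 / T\<^sup>2) (- (y + u)))) * iexp (- (T * y))) \<longlongrightarrow> 0) at_top"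
  proof (rule riemann_lebesgue_uniform [where \<psi> = "\<lambda>e y. fejer_ft y * zeta_reg (Complex (1 + e) (- (y + u)))"])
    have "continuous_on ({0..1} \<times> UNIV) (\<lambda>z. fejer_ft (snd z) * zeta_reg (Complex (1 + fst z) (- (snd z + u))))"
      by (intro continuous_intros continuous_on_compose2 [OF zeta_reg_continuous]) (auto simp: Complex_eq)
    then show "continuous_on ({0..1} \<times> UNIV) (\<lambda>(e, y). fejer_ft y * zeta_reg (Complex (1 + e) (- (y + u))))"
      by (simp add: case_prod_unfold)
    show "fejer_ft y * zeta_reg (Complex (1 + e) (- (y + u))) = 0" if "1 \<le> \<bar>y\<bar>" for e y
      using that by (simp add: fejer_ft_def triangle_eq_0)
    show "eventually (\<lambda>T::real. 1 / T\<^sup>2 \<in> {0..1}) at_top"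
      using eventually_ge_at_top [of 1] by eventually_elim (simp add: divide_simps)
  qed
  then have "((\<lambda>T. norm (CLINT y|lborel. (fejer_ft y * zeta_reg (Complex (1 + 1 / T\<^sup>2) (- (y + u)))) * iexp (- (T * y)))) \<longlongrightarrow> 0) at_top"
    by (rule tendsto_norm_zero)
  moreover have "eventually (\<lambda>T. norm (CLINT y|lborel. (fejer_ft y * zeta_reg (Complex (1 + 1 / T\<^sup>2) (- (y + u)))) * iexp (- (T * y))) =
     norm (mangoldt_trans (1 / T\<^sup>2) T u - exp_trans (1 / T\<^sup>2) T u)) at_top"
    using eventually_gt_at_top [of 0] by eventually_elim (simp add: mangoldt_trans_minus_exp_trans norm_mult)
  ultimately have "((\<lambda>T. norm (mangoldt_trans (1 / T\<^sup>2) T u - exp_trans (1 / T\<^sup>2) T u)) \<longlongrightarrow> 0) at_top"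
    by (rule Lim_transform_eventually)
  then show ?thesis by (rule tendsto_norm_zero_cancel)
qed

definition fejer_hat :: "real \<Rightarrow> complex" where
  "fejer_hat u = (CLINT x|lborel. of_real (fejer_wt x) * iexp (u * x))"

text \<open>The choice \<open>\<epsilon> = 1 / T\<^sup>2\<close> keeps the series convergent, while \<open>n powr \<epsilon> \<rightarrow> 1\<close> uniformly for \<open>ln n \<le> T\<close>.\<close>

lemma exp_trans_tendsto: "((\<lambda>T. exp_trans (1 / T\<^sup>2) T u) \<longlongrightarrow> fejer_hat u) at_top"
proof -
  have eq: "exp_trans e T u = (CLINT x|lborel. exp_wt e (T + x) *\<^sub>R (of_real (fejer_wt x) * iexp (u * x)))" for e T
    unfolding exp_trans_def by (subst lborel_integral_real_affine [where c = 1 and t = T]) auto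
  show ?thesis unfolding eq fejer_hat_def
  proof (rule integral_dominated_convergence_at_top)
    show "integrable lborel fejer_wt" by (rule integrable_fejer_wt)
    show "AE x in lborel. ((\<lambda>T. exp_wt (1 / T\<^sup>2) (T + x) *\<^sub>R (of_real (fejer_wt x) * iexp (u * x))) \<longlongrightarrow> of_real (fejer_wt x) * iexp (u * x)) at_top"
    proof (intro AE_I2)
      fix x :: real
      have "((\<lambda>T. exp (- (1 / T\<^sup>2) * (T + x))) \<longlongrightarrow> 1) at_top" by real_asymp
      moreover have "eventually (\<lambda>T. exp (- (1 / T\<^sup>2) * (T + x)) = exp_wt (1 / T\<^sup>2) (T + x)) at_top"
        using eventually_gt_at_top [of "- x"] by eventually_elim (simp add: exp_wt_def)
      ultimately have "((\<lambda>T. exp_wt (1 / T\<^sup>2) (T + x)) \<longlongrightarrow> 1) at_top" by (rule Lim_transform_eventually)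
      then have "((\<lambda>T. exp_wt (1 / T\<^sup>2) (T + x) *\<^sub>R (of_real (fejer_wt x) * iexp (u * x))) \<longlongrightarrow> 1 *\<^sub>R (of_real (fejer_wt x) * iexp (u * x))) at_top"
        by (intro tendsto_intros)
      then show "((\<lambda>T. exp_wt (1 / T\<^sup>2) (T + x) *\<^sub>R (of_real (fejer_wt x) * iexp (u * x))) \<longlongrightarrow> of_real (fejer_wt x) * iexp (u * x)) at_top" by simp
    qed
    show "eventually (\<lambda>T. AE x in lborel. norm (exp_wt (1 / T\<^sup>2) (T + x) *\<^sub>R (of_real (fejer_wt x) * iexp (u * x))) \<le> fejer_wt x) at_top"
      using eventually_gt_at_top [of 0]
    proof eventually_elim
      case (elim T)
      have "exp_wt (1 / T\<^sup>2) z \<le> 1" for z using elim by (auto simp: exp_wt_def indicator_def)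
      then show ?case using less_imp_le [OF fejer_wt_pos]
        by (auto simp: norm_mult intro!: AE_I2 mult_left_le_one_le)
    qed
  qed auto
qed

lemma mangoldt_trans_tendsto: "((\<lambda>T. mangoldt_trans (1 / T\<^sup>2) T u) \<longlongrightarrow> fejer_hat u) at_top"
  using tendsto_add [OF mangoldt_trans_exp_trans_tendsto [of u] exp_trans_tendsto [of u]] by simp

lemma fejer_hat_0: "fejer_hat 0 = of_real (integral\<^sup>L lborel fejer_wt)"
  by (simp add: fejer_hat_def integral_complex_of_real)

lemma integral_fejer_wt_pos: "integral\<^sup>L lborel fejer_wt > 0"
proof (rule ccontr)
  assume "\<not> integral\<^sup>L lborel fejer_wt > 0"
  moreover have nn: "AE x in lborel. 0 \<le> fejer_wt x" using less_imp_le [OF fejer_wt_pos] by simp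
  moreover have "integral\<^sup>L lborel fejer_wt \<ge> 0" using nn by (rule integral_nonneg_AE)
  ultimately have "integral\<^sup>L lborel fejer_wt = 0" by simp
  then have "AE x in lborel. fejer_wt x = 0"
    using integral_nonneg_eq_0_iff_AE [OF integrable_fejer_wt nn] by simp
  moreover have "fejer_wt x \<noteq> 0" for x using fejer_wt_pos [of x] by simp
  ultimately have "AE x in (lborel :: real measure). False" by simp
  then have "ae_filter (lborel :: real measure) = bot" by (simp add: eventually_False [symmetric])
  then show False by (simp add: ae_filter_eq_bot_iff)
qed

lemma fejer_wt_bounded: obtains B where "\<And>x. fejer_wt x \<le> B"
proof -
  have "fejer x \<le> 8" for x
  proof -
    have "inverse (1 + x\<^sup>2) \<le> 1" by (simp add: field_simps add_pos_nonneg)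
    then show ?thesis using fejer_le [of x] by linarith
  qed
  then have "fejer_wt x \<le> 16" for x unfolding fejer_wt_def by (smt (verit))
  then show ?thesis by (rule that)
qed

text \<open>Divided by their total masses the weighted measures are probability distributions, so
  pointwise convergence of characteristic functions gives weak convergence. Testing against the
  bounded function \<open>\<phi> / fejer_wt\<close> undoes the weight, and multiplying by the
  convergent masses \<open>m\<close> undoes the normalisation.\<close>

theorem mangoldt_weighted_sequence:
  fixes \<phi> :: "real \<Rightarrow> real"
  assumes T: "filterlim T at_top sequentially"
  assumes \<phi>: "continuous_on UNIV \<phi>" "\<And>x. \<bar>\<phi> x\<bar> \<le> C * fejer_wt x"
  shows "(\<lambda>i. LINT n|count_space UNIV. mangoldt_wt (1 / (T i)\<^sup>2) n * \<phi> (ln (real n) - T i)) \<longlonglongrightarrow> integral\<^sup>L lborel \<phi>"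
proof -
  define F where "F = (\<lambda>i n. mangoldt_wt (1 / (T i)\<^sup>2) n * fejer_wt (ln (real n) - T i))"
  define m where "m = (\<lambda>i. integral\<^sup>L (count_space UNIV) (F i))"
  define H where "H = integral\<^sup>L lborel fejer_wt"
  have H: "H > 0" unfolding H_def by (rule integral_fejer_wt_pos)
  have fejer_wt_nn: "fejer_wt x \<ge> 0" for x using fejer_wt_pos [of x] by simp
  have F_nn: "F i n \<ge> 0" for i n unfolding F_def by (intro mult_nonneg_nonneg mangoldt_wt_nonneg fejer_wt_nn)
  have mt: "(\<lambda>i. mangoldt_trans (1 / (T i)\<^sup>2) (T i) u) \<longlonglongrightarrow> fejer_hat u" for u
    by (rule filterlim_compose [OF mangoldt_trans_tendsto T])
  have m_eq: "mangoldt_trans (1 / (T i)\<^sup>2) (T i) 0 = of_real (m i)" for i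
    unfolding mangoldt_trans_def m_def F_def
    by (subst integral_complex_of_real [symmetric]) (simp add: scaleR_conv_of_real)
  have m_lim: "m \<longlonglongrightarrow> H"
    using tendsto_Re [OF mt [of 0]] by (simp add: m_eq fejer_hat_0 H_def)
  have "eventually (\<lambda>i. T i > 0) sequentially"
    using T by (simp add: filterlim_at_top_dense)
  moreover have "eventually (\<lambda>i. m i > 0) sequentially"
    using m_lim H by (rule order_tendstoD)
  ultimately have ev: "eventually (\<lambda>i. T i > 0 \<and> m i > 0) sequentially"
    by (rule eventually_conj)
  define N where "N = push_density lborel (\<lambda>x. fejer_wt x / H) (\<lambda>x. x)"
  \<comment> \<open>The default \<open>N\<close> at the finitely many exceptional indices makes
    every member a distribution, as \<open>levy_continuity\<close> demands.\<close>
  define M where "M = (\<lambda>i. if T i > 0 \<and> m i > 0 then push_density (count_space UNIV) (\<lambda>n. F i n / m i) (\<lambda>n. ln (real n) - T i) else N)"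
  have N: "real_distribution N" unfolding N_def
    using H fejer_wt_nn integrable_fejer_wt by (intro real_distribution_push_density) (auto simp: H_def)
  obtain B where B: "\<And>x. fejer_wt x \<le> B" using fejer_wt_bounded by blast
  have F_int: "integrable (count_space UNIV) (F i)" if "T i > 0" for i
    by (rule Bochner_Integration.integrable_bound [of _ "\<lambda>n. mangoldt_wt (1 / (T i)\<^sup>2) n * B"])
       (use that B fejer_wt_nn in \<open>auto simp: F_def abs_mult intro!: integrable_mangoldt_wt AE_I2 mult_left_mono order_trans [OF B abs_ge_self]\<close>)
  have M: "real_distribution (M i)" for i
  proof (cases "T i > 0 \<and> m i > 0")
    case True
    then show ?thesis using F_int [of i] F_nn [of i]
      by (auto simp: M_def m_def intro!: real_distribution_push_density divide_nonneg_pos)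
  next
    case False
    then have "M i = N" unfolding M_def by (rule if_not_P)
    then show ?thesis by (simp add: N)
  qed
  have M_int: "integral\<^sup>L (M i) f = (LINT n|count_space UNIV. (F i n / m i) *\<^sub>R f (ln (real n) - T i))"
    if "T i > 0 \<and> m i > 0" "f \<in> borel_measurable borel" for i and f :: "real \<Rightarrow> 'b::{banach,second_countable_topology}"
    using that F_nn [of i] unfolding M_def if_P [OF that(1)]
    by (intro integral_push_density) (auto intro!: divide_nonneg_pos)
  have N_int: "integral\<^sup>L N f = (LINT x|lborel. (fejer_wt x / H) *\<^sub>R f x)"
    if "f \<in> borel_measurable borel" for f :: "real \<Rightarrow> 'b::{banach,second_countable_topology}"
    using that H fejer_wt_nn unfolding N_def by (intro integral_push_density) auto
  have "weak_conv_m M N"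
  proof (rule levy_continuity [OF M N])
    fix u :: real
    have "(\<lambda>i. mangoldt_trans (1 / (T i)\<^sup>2) (T i) u / of_real (m i)) \<longlonglongrightarrow> fejer_hat u / of_real H"
      using H by (intro tendsto_divide mt tendsto_of_real m_lim) auto
    moreover have "fejer_hat u / of_real H = char N u"
      unfolding char_def fejer_hat_def by (subst N_int, simp) (simp add: scaleR_conv_of_real)
    moreover have "eventually (\<lambda>i. mangoldt_trans (1 / (T i)\<^sup>2) (T i) u / of_real (m i) = char (M i) u) sequentially"
      using ev
    proof eventually_elim
      case (elim i)
      have "char (M i) u = (CLINT n|count_space UNIV. (mangoldt_wt (1 / (T i)\<^sup>2) n *\<^sub>R (of_real (fejer_wt (ln (real n) - T i)) * iexp (u * (ln (real n) - T i)))) / of_real (m i))"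
      proof -
        have "char (M i) u = (LINT n|count_space UNIV. (F i n / m i) *\<^sub>R iexp (u * (ln (real n) - T i)))"
          unfolding char_def by (rule M_int [OF elim]) measurable
        also have "(\<lambda>n. (F i n / m i) *\<^sub>R iexp (u * (ln (real n) - T i))) =
            (\<lambda>n. (mangoldt_wt (1 / (T i)\<^sup>2) n *\<^sub>R (of_real (fejer_wt (ln (real n) - T i)) * iexp (u * (ln (real n) - T i)))) / of_real (m i))"
          by (simp add: F_def scaleR_conv_of_real mult.assoc)
        finally show ?thesis .
      qed
      then show ?case unfolding mangoldt_trans_def by simp
    qed
    ultimately show "(\<lambda>i. char (M i) u) \<longlonglongrightarrow> char N u"
      by (simp only: Lim_transform_eventually)
  qed
  then have "(\<lambda>i. LINT x|M i. \<phi> x / fejer_wt x) \<longlonglongrightarrow> (LINT x|N. \<phi> x / fejer_wt x)"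
  proof (rule weak_conv_imp_integral_bdd_continuous_conv [OF M N])
    have "continuous_on UNIV (\<lambda>x. \<phi> x / fejer_wt x)"
      using fejer_wt_pos by (intro continuous_intros \<phi>) (auto simp: less_le)
    then show "isCont (\<lambda>x. \<phi> x / fejer_wt x) x" for x
      by (simp add: continuous_on_eq_continuous_at)
    show "norm (\<phi> x / fejer_wt x) \<le> C" for x
      using \<phi>(2) [of x] fejer_wt_pos [of x] by (simp add: abs_if divide_simps split: if_splits)
  qed
  moreover have "(LINT x|N. \<phi> x / fejer_wt x) = integral\<^sup>L lborel \<phi> / H"
  proof -
    have [measurable]: "\<phi> \<in> borel_measurable borel" by (intro borel_measurable_continuous_onI \<phi>)
    have "(fejer_wt x / H) *\<^sub>R (\<phi> x / fejer_wt x) = \<phi> x / H" for x using fejer_wt_pos [of x] by simp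
    then show ?thesis by (subst N_int) simp_all
  qed
  ultimately have "(\<lambda>i. m i * (LINT x|M i. \<phi> x / fejer_wt x)) \<longlonglongrightarrow> H * (integral\<^sup>L lborel \<phi> / H)"
    using m_lim by (intro tendsto_mult) simp_all
  moreover have "eventually (\<lambda>i. m i * (LINT x|M i. \<phi> x / fejer_wt x) =
     (LINT n|count_space UNIV. mangoldt_wt (1 / (T i)\<^sup>2) n * \<phi> (ln (real n) - T i))) sequentially"
    using ev
  proof eventually_elim
    case (elim i)
    have [measurable]: "\<phi> \<in> borel_measurable borel" by (intro borel_measurable_continuous_onI \<phi>)
    have eq: "(F i n / m i) *\<^sub>R (\<phi> (ln (real n) - T i) / fejer_wt (ln (real n) - T i)) = mangoldt_wt (1 / (T i)\<^sup>2) n * \<phi> (ln (real n) - T i) / m i" for n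
      using fejer_wt_pos [of "ln (real n) - T i"] by (simp add: F_def)
    have "(LINT x|M i. \<phi> x / fejer_wt x) = (LINT n|count_space UNIV. mangoldt_wt (1 / (T i)\<^sup>2) n * \<phi> (ln (real n) - T i) / m i)"
      by (subst M_int [OF elim]) (simp_all only: eq, measurable)
    then show ?case using elim by simp
  qed
  ultimately have "(\<lambda>i. LINT n|count_space UNIV. mangoldt_wt (1 / (T i)\<^sup>2) n * \<phi> (ln (real n) - T i)) \<longlonglongrightarrow> H * (integral\<^sup>L lborel \<phi> / H)"
    by (rule Lim_transform_eventually)
  then show ?thesis using H by simp
qed

text \<open>This is the prime number theorem on the logarithmic scale.\<close>

theorem mangoldt_weighted:
  fixes \<phi> :: "real \<Rightarrow> real"
  assumes \<phi>: "continuous_on UNIV \<phi>" "\<And>x. \<phi> x \<le> C * fejer_wt x" "\<And>x. \<phi> x \<ge> 0" "\<And>x. x > 0 \<Longrightarrow> \<phi> x = 0"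
  shows "((\<lambda>T. \<Sum>n | 0 < n \<and> ln (real n) \<le> T. mangoldt n / real n * \<phi> (ln (real n) - T)) \<longlongrightarrow> integral\<^sup>L lborel \<phi>) at_top"
proof (rule tendsto_at_topI_sequentially)
  fix T :: "nat \<Rightarrow> real" assume T: "filterlim T at_top sequentially"
  define A where "A = (\<lambda>i. {n::nat. 0 < n \<and> ln (real n) \<le> T i})"
  have fin: "finite (A i)" for i
  proof (rule finite_subset)
    show "A i \<subseteq> {..nat \<lceil>exp (T i)\<rceil>}"
    proof
      fix n assume "n \<in> A i"
      then have "real n \<le> exp (T i)" unfolding A_def by (metis (mono_tags) exp_le_cancel_iff exp_ln mem_Collect_eq of_nat_0_less_iff)
      then show "n \<in> {..nat \<lceil>exp (T i)\<rceil>}" by (simp add: le_nat_iff) linarith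
    qed
  qed simp
  define S where "S = (\<lambda>i. \<Sum>n\<in>A i. mangoldt_wt (1 / (T i)\<^sup>2) n * \<phi> (ln (real n) - T i))"
  define R where "R = (\<lambda>i. \<Sum>n\<in>A i. mangoldt n / real n * \<phi> (ln (real n) - T i))"
  have "(LINT n|count_space UNIV. mangoldt_wt (1 / (T i)\<^sup>2) n * \<phi> (ln (real n) - T i)) = S i" for i
  proof -
    have "(LINT n|count_space UNIV. mangoldt_wt (1 / (T i)\<^sup>2) n * \<phi> (ln (real n) - T i)) = (\<Sum>n. mangoldt_wt (1 / (T i)\<^sup>2) n * \<phi> (ln (real n) - T i))"
      using fin [of i] \<phi>(4) by (intro integral_count_space_nat) (subst integrable_count_space_nat_iff, rule summable_finite [OF fin [of i]], force simp: A_def mangoldt_wt_def)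
    also have "\<dots> = S i"
      unfolding S_def by (rule suminf_finite [OF fin [of i]]) (use \<phi>(4) in \<open>force simp: A_def mangoldt_wt_def\<close>)
    finally show ?thesis .
  qed
  moreover have "\<bar>\<phi> x\<bar> \<le> C * fejer_wt x" for x using \<phi>(2,3) [of x] by simp
  ultimately have S: "S \<longlonglongrightarrow> integral\<^sup>L lborel \<phi>"
    using mangoldt_weighted_sequence [OF T \<phi>(1), of C] by (simp only:)
  have ev: "eventually (\<lambda>i. T i > 0) sequentially"
    using T by (simp add: filterlim_at_top_dense)
  have "((\<lambda>t::real. exp (1 / t)) \<longlongrightarrow> 1) at_top" by real_asymp
  from filterlim_compose [OF this T] have "(\<lambda>i. exp (1 / T i)) \<longlonglongrightarrow> 1" .
  from tendsto_mult [OF this S] have U: "(\<lambda>i. exp (1 / T i) * S i) \<longlonglongrightarrow> integral\<^sup>L lborel \<phi>" by simp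
  have bound: "mangoldt_wt (1 / (T i)\<^sup>2) n \<le> mangoldt n / real n \<and> mangoldt n / real n \<le> exp (1 / T i) * mangoldt_wt (1 / (T i)\<^sup>2) n"
    if "T i > 0" "n \<in> A i" for i n
  proof -
    have n: "n > 0" "ln (real n) \<le> T i" using that by (auto simp: A_def)
    define e where "e = 1 / (T i)\<^sup>2"
    have mw: "mangoldt_wt e n = mangoldt n / real n * real n powr (- e)"
    proof -
      have "- (1 + e) = - e - 1" by simp
      then have "real n powr (- (1 + e)) = real n powr (- e) / real n"
        using n by (simp only: powr_diff) simp
      then show ?thesis by (simp add: mangoldt_wt_def)
    qed
    have "e * ln (real n) \<le> e * T i" using n that by (intro mult_left_mono) (auto simp: e_def)
    then have "e * ln (real n) \<le> 1 / T i" using that by (simp add: e_def power2_eq_square)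
    then have "exp (1 / T i) * real n powr (- e) \<ge> 1"
      using n by (simp add: powr_def exp_add [symmetric])
    moreover have "real n powr (- e) \<le> 1" using n that by (simp add: powr_def e_def)
    moreover have "mangoldt n / real n \<ge> 0" by (simp add: mangoldt_nonneg)
    ultimately show ?thesis unfolding e_def [symmetric] mw
      using mult_left_mono [of 1 "exp (1 / T i) * real n powr (- e)" "mangoldt n / real n"]
        mult_left_mono [of "real n powr (- e)" 1 "mangoldt n / real n"] by (simp add: mult_ac)
  qed
  \<comment> \<open>On the finite range the damping factor lies between \<open>exp (- 1 / T)\<close>
    and \<open>1\<close>; since \<open>\<phi>\<close> is non-negative, the undamped sum is
    squeezed.\<close>
  have "R \<longlonglongrightarrow> integral\<^sup>L lborel \<phi>"
  proof (rule tendsto_sandwich [OF _ _ S U])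
    show "eventually (\<lambda>i. S i \<le> R i) sequentially"
      using ev
    proof eventually_elim
      case (elim i)
      show ?case unfolding R_def S_def
        using elim bound \<phi>(3) by (intro sum_mono mult_right_mono) auto
    qed
    show "eventually (\<lambda>i. R i \<le> exp (1 / T i) * S i) sequentially"
      using ev
    proof eventually_elim
      case (elim i)
      show ?case unfolding R_def S_def sum_distrib_left mult.assoc [symmetric]
        using elim bound \<phi>(3) by (intro sum_mono mult_right_mono) auto
    qed
  qed
  then show "(\<lambda>i. \<Sum>n | 0 < n \<and> ln (real n) \<le> T i. mangoldt n / real n * \<phi> (ln (real n) - T i)) \<longlonglongrightarrow> integral\<^sup>L lborel \<phi>"
    by (simp add: R_def A_def)
qed

section \<open>The limit constant\<close>

text \<open>The variance of an indicator with probability \<open>frac t\<close>; at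
  \<open>t = k / p\<close> it is the factor of \<open>(ln p)^2\<close> in \<open>V\<close>.\<close>

definition frac_parab :: "real \<Rightarrow> real" where "frac_parab t = frac t * (1 - frac t)"

lemma frac_parab_nonneg [simp]: "frac_parab t \<ge> 0"
  using frac_lt_1 [of t] by (simp add: frac_parab_def less_imp_le)

lemma frac_parab_le_1: "frac_parab t \<le> 1"
  using frac_lt_1 [of t] frac_ge_0 [of t] unfolding frac_parab_def by (intro mult_le_one) auto

text \<open>The right end point may be included because both sides vanish there, which permits
  integration over closed unit intervals.\<close>

lemma frac_parab_eq: "real_of_int j \<le> t \<Longrightarrow> t \<le> real_of_int j + 1 \<Longrightarrow> frac_parab t = (t - of_int j) * (of_int j + 1 - t)"
proof (cases "t = of_int j + 1")
  case True
  then have "t = of_int (j + 1)" by simp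
  then have "frac t = 0" by (simp only: frac_of_int)
  then show ?thesis using True by (simp add: frac_parab_def)
next
  case False
  assume "real_of_int j \<le> t" "t \<le> real_of_int j + 1"
  then have "\<lfloor>t\<rfloor> = j" using False by (intro floor_unique) auto
  then show ?thesis by (simp add: frac_parab_def frac_def algebra_simps)
qed

text \<open>Inside a unit interval the slope is at most \<open>1\<close> in absolute value. Across
  an integer, both values are bounded by the distance to the zero in between. Hence continuity,
  although \<open>frac\<close> itself jumps.\<close>

lemma frac_parab_lipschitz: "s \<le> t \<Longrightarrow> \<bar>frac_parab s - frac_parab t\<bar> \<le> t - s"
proof (cases "\<lfloor>s\<rfloor> = \<lfloor>t\<rfloor>")
  case True
  assume "s \<le> t"
  have "frac_parab s - frac_parab t = (s - t) * (1 - frac s - frac t)"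
    using True by (simp add: frac_parab_def frac_def algebra_simps)
  moreover have "\<bar>1 - frac s - frac t\<bar> \<le> 1"
    using frac_lt_1 [of t] frac_ge_0 [of t] frac_lt_1 [of s] frac_ge_0 [of s] by linarith
  ultimately have "\<bar>frac_parab s - frac_parab t\<bar> \<le> \<bar>s - t\<bar> * 1"
    by (simp only: abs_mult) (intro mult_left_mono, auto)
  then show ?thesis using \<open>s \<le> t\<close> by simp
next
  case False
  assume "s \<le> t"
  then have "\<lfloor>s\<rfloor> \<le> \<lfloor>t\<rfloor>" by (rule floor_mono)
  with False have fl: "\<lfloor>s\<rfloor> + 1 \<le> \<lfloor>t\<rfloor>" by linarith
  have "frac_parab s \<le> 1 - frac s" unfolding frac_parab_def
    using frac_lt_1 [of s] frac_ge_0 [of s] by (intro mult_left_le_one_le) auto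
  moreover have "frac_parab t \<le> frac t" unfolding frac_parab_def
    using frac_lt_1 [of t] frac_ge_0 [of t] by (intro mult_right_le_one_le) auto
  moreover have "1 - frac s + frac t \<le> t - s"
    using fl unfolding frac_def by linarith
  moreover have "frac_parab s \<ge> 0" "frac_parab t \<ge> 0" by simp_all
  ultimately show ?thesis by linarith
qed

lemma continuous_frac_parab: "continuous_on UNIV frac_parab"
proof (rule lipschitz_on_continuous_on [of 1])
  show "1-lipschitz_on UNIV frac_parab"
  proof (rule lipschitz_onI)
    fix s t :: real
    show "dist (frac_parab s) (frac_parab t) \<le> 1 * dist s t"
      using frac_parab_lipschitz [of s t] frac_parab_lipschitz [of t s] by (auto simp: dist_real_def abs_if split: if_splits)
  qed simp
qed

lemma frac_parab_1: "frac_parab 1 = 0" by (simp add: frac_parab_def)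

text \<open>With \<open>x = ln (n / k)\<close> this is \<open>(n / k) * frac_parab (k / n)\<close>;
  the factor \<open>n / k\<close> compensates the weight \<open>1 / n\<close> of the limit theorem.
  The \<open>max\<close> cuts off \<open>n > k\<close> without a jump, since
  \<open>frac_parab\<close> vanishes at \<open>1\<close>.\<close>

definition profile :: "real \<Rightarrow> real" where "profile x = exp x * frac_parab (max 1 (exp (- x)))"

lemma profile_nonneg [simp]: "profile x \<ge> 0" by (simp add: profile_def)

lemma profile_pos_0: "x \<ge> 0 \<Longrightarrow> profile x = 0" by (simp add: profile_def max_def frac_parab_1)

lemma profile_neg: "x \<le> 0 \<Longrightarrow> profile x = exp x * frac_parab (exp (- x))" by (simp add: profile_def max_def)

lemma continuous_profile: "continuous_on UNIV profile"
  unfolding profile_def by (intro continuous_intros continuous_on_compose2 [OF continuous_frac_parab]) auto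

text \<open>Exponential decay beats the quadratic decay of the weight; the factor
  \<open>1 - x\<close> leaves room for the profile multiplied by \<open>- x\<close>. The constant
  comes from \<open>(y / 3)^3 \<le> exp y\<close> with \<open>y = 4 - x\<close>, which is at least
  \<open>\<bar>x\<bar> + pi\<close>.\<close>

lemma exp_le_fejer_wt:
  assumes "x \<le> 0"
  shows "exp x * (1 - x) \<le> 27 * exp 4 * fejer_wt x"
proof -
  define y where "y = 4 - x"
  have y: "y \<ge> 4" using assms by (simp add: y_def)
  have "(y / 3) ^ 3 \<le> exp (y / 3) ^ 3"
  proof (rule power_mono)
    show "y / 3 \<le> exp (y / 3)" using exp_ge_add_one_self [of "y / 3"] by linarith
  qed (use y in simp)
  also have "\<dots> = exp y" by (simp add: exp_of_nat_mult [symmetric])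
  finally have 1: "y ^ 3 \<le> 27 * exp y" by (simp add: power_divide)
  have "exp x * (1 - x) * y\<^sup>2 \<le> exp x * y * y\<^sup>2"
    using assms by (intro mult_right_mono mult_left_mono) (auto simp: y_def)
  also have "\<dots> = exp x * y ^ 3" by (simp add: power3_eq_cube power2_eq_square)
  also have "\<dots> \<le> exp x * (27 * exp y)" using 1 by (intro mult_left_mono) auto
  also have "\<dots> = 27 * exp 4" by (simp add: y_def exp_add [symmetric])
  finally have "exp x * (1 - x) \<le> 27 * exp 4 / y\<^sup>2" using y by (simp add: field_simps)
  also have "\<dots> \<le> 27 * exp 4 * (4 / (\<bar>x\<bar> + pi)\<^sup>2)"
  proof -
    have "1 / y\<^sup>2 \<le> 1 / (\<bar>x\<bar> + pi)\<^sup>2"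
    proof (rule divide_left_mono)
      have h: "\<bar>x\<bar> + pi \<le> y" "\<bar>x\<bar> + pi > 0" unfolding y_def using assms pi_less_4 pi_gt_zero by linarith+
      show "(\<bar>x\<bar> + pi)\<^sup>2 \<le> y\<^sup>2" using h by (intro power_mono) auto
      show "0 < y\<^sup>2 * (\<bar>x\<bar> + pi)\<^sup>2" using h y by simp
    qed simp
    also have "\<dots> \<le> 4 / (\<bar>x\<bar> + pi)\<^sup>2" by (intro divide_right_mono) auto
    finally have "1 / y\<^sup>2 \<le> 4 / (\<bar>x\<bar> + pi)\<^sup>2" .
    from mult_left_mono [OF this, of "27 * exp 4"] show ?thesis by simp
  qed
  also have "\<dots> \<le> 27 * exp 4 * fejer_wt x" by (intro mult_left_mono fejer_wt_bound) auto
  finally show ?thesis .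
qed

lemma profile_le: "profile x \<le> 27 * exp 4 * fejer_wt x"
proof (cases "x \<le> 0")
  case True
  have "profile x \<le> exp x * 1" unfolding profile_def by (intro mult_left_mono frac_parab_le_1) auto
  also have "\<dots> \<le> exp x * (1 - x)" using True by (intro mult_left_mono) auto
  also have "\<dots> \<le> 27 * exp 4 * fejer_wt x" by (rule exp_le_fejer_wt [OF True])
  finally show ?thesis .
qed (use fejer_wt_pos [of x] in \<open>simp add: profile_pos_0\<close>)

lemma profile_tilt_le: "max 0 (- x) * profile x \<le> 27 * exp 4 * fejer_wt x"
proof (cases "x \<le> 0")
  case True
  have "max 0 (- x) * profile x \<le> (1 - x) * (exp x * 1)" unfolding profile_def using True
    by (intro mult_mono mult_left_mono frac_parab_le_1) auto
  also have "\<dots> \<le> 27 * exp 4 * fejer_wt x" using exp_le_fejer_wt [OF True] by (simp add: mult.commute)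
  finally show ?thesis .
qed (use fejer_wt_pos [of x] in \<open>simp add: profile_pos_0\<close>)

lemma integrable_profile: "integrable lborel profile"
  by (rule Bochner_Integration.integrable_bound [of _ "\<lambda>x. 27 * exp 4 * fejer_wt x"])
     (auto intro!: AE_I2 integrable_fejer_wt borel_measurable_continuous_onI continuous_profile order_trans [OF profile_le abs_ge_self])

text \<open>The closed form of the integral of \<open>frac_parab t / t^2\<close> over
  \<open>[1, N + 1]\<close>.\<close>

definition profile_partial :: "nat \<Rightarrow> real" where
  "profile_partial N = (2 * real N + 1) * ln (real (Suc N)) - 2 * ln (fact N) - 2 * real N"

text \<open>Under \<open>t = exp (- x)\<close> the unit interval from \<open>j\<close> to
  \<open>j + 1\<close> corresponds to \<open>[- ln (j + 1), - ln j]\<close>, where the profile has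
  an elementary antiderivative. The factorial arises from collecting the terms
  \<open>ln j\<close>.\<close>

lemma has_integral_profile: "(profile has_integral profile_partial N) {- ln (real (Suc N))..0}"
proof (induction N)
  case 0
  then show ?case by (simp add: profile_partial_def has_integral_refl)
next
  case (Suc N)
  define j where "j = real (Suc N)"
  have j: "j > 0" by (simp add: j_def)
  define F where "F = (\<lambda>x::real. (2 * j + 1) * x + exp (- x) - j * (j + 1) * exp x)"
  have "(profile has_integral (F (- ln j) - F (- ln (j + 1)))) {- ln (j + 1)..- ln j}"
  proof (rule fundamental_theorem_of_calculus)
    fix x assume x: "x \<in> {- ln (j + 1)..- ln j}"
    have "ln j \<ge> 0" by (simp add: j_def)
    then have "x \<le> 0" using x by simp
    have "exp (- x) \<ge> exp (ln j)" "exp (- x) \<le> exp (ln (j + 1))" using x by auto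
    then have b: "exp (- x) \<ge> j" "exp (- x) \<le> j + 1" using j by simp_all
    have "frac_parab (exp (- x)) = (exp (- x) - j) * (j + 1 - exp (- x))"
      using frac_parab_eq [of "int (Suc N)" "exp (- x)"] b by (simp add: j_def)
    then have "profile x = exp x * ((exp (- x) - j) * (j + 1 - exp (- x)))"
      using profile_neg [OF \<open>x \<le> 0\<close>] by simp
    also have "\<dots> = (2 * j + 1) * (exp x * exp (- x)) - (exp x * exp (- x)) * exp (- x) - j * (j + 1) * exp x"
      by (simp only: algebra_simps)
    also have "exp x * exp (- x) = 1" by (simp add: exp_minus)
    finally have "profile x = (2 * j + 1) - exp (- x) - j * (j + 1) * exp x" by simp
    then show "(F has_vector_derivative profile x) (at x within {- ln (j + 1)..- ln j})"
      unfolding F_def by (auto intro!: derivative_eq_intros simp: has_real_derivative_iff_has_vector_derivative [symmetric])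
  qed (use j in simp)
  from has_integral_combine [OF _ _ this [unfolded j_def] Suc.IH]
  have "(profile has_integral (F (- ln j) - F (- ln (j + 1)) + profile_partial N)) {- ln (j + 1)..0}"
    by (simp add: j_def)
  moreover have "F (- ln j) - F (- ln (j + 1)) + profile_partial N = profile_partial (Suc N)"
  proof -
    have Fa: "F (- ln a) = - (2 * j + 1) * ln a + a - j * (j + 1) / a" if "a > 0" for a
      using that by (simp add: F_def exp_minus divide_inverse algebra_simps)
    have F1: "F (- ln j) = - (2 * j + 1) * ln j - 1"
      using Fa [OF j] j by simp
    have F2: "F (- ln (j + 1)) = - (2 * j + 1) * ln (j + 1) + 1"
      using Fa [of "j + 1"] j by simp
    have "ln (fact (Suc N) :: real) = ln j + ln (fact N)"
      unfolding j_def fact_Suc by (subst ln_mult) auto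
    then show ?thesis unfolding F1 F2 profile_partial_def by (simp add: j_def algebra_simps)
  qed
  ultimately show ?case by (simp add: j_def add_ac)
qed

text \<open>Convergence comes from integrability of the profile, so that no form of Stirling is needed beforehand.\<close>

lemma profile_partial_tendsto: "profile_partial \<longlonglongrightarrow> integral\<^sup>L lborel profile"
proof -
  have "(\<lambda>N. LINT x|lborel. indicator {- ln (real (Suc N))..0} x * profile x) \<longlonglongrightarrow> integral\<^sup>L lborel profile"
  proof (rule integral_dominated_convergence)
    show "integrable lborel profile" by (rule integrable_profile)
    show "AE x in lborel. (\<lambda>N. indicator {- ln (real (Suc N))..0} x * profile x) \<longlonglongrightarrow> profile x"
    proof (intro AE_I2)
      fix x :: real
      show "(\<lambda>N. indicator {- ln (real (Suc N))..0} x * profile x) \<longlonglongrightarrow> profile x"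
      proof (cases "x \<le> 0")
        case True
        have "filterlim (\<lambda>N. ln (real (Suc N))) at_top sequentially" by real_asymp
        then have "eventually (\<lambda>N. ln (real (Suc N)) \<ge> - x) sequentially" by (simp add: filterlim_at_top)
        then have "eventually (\<lambda>N. indicator {- ln (real (Suc N))..0} x * profile x = profile x) sequentially"
          by eventually_elim (use True in simp)
        then show ?thesis by (rule tendsto_eventually)
      qed (simp add: profile_pos_0)
    qed
    show "AE x in lborel. norm (indicator {- ln (real (Suc N))..0} x * profile x) \<le> profile x" for N
      by (auto simp: indicator_def)
  qed (use borel_measurable_integrable [OF integrable_profile] in measurable)
  moreover have "(LINT x|lborel. indicator {- ln (real (Suc N))..0} x * profile x) = profile_partial N" for N
  proof -
    have "integrable lborel (\<lambda>x. indicator {- ln (real (Suc N))..0} x *\<^sub>R profile x)"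
      by (intro borel_integrable_compact compact_Icc continuous_on_subset [OF continuous_profile]) auto
    then have "((\<lambda>x. indicator {- ln (real (Suc N))..0} x * profile x) has_integral (LINT x|lborel. indicator {- ln (real (Suc N))..0} x * profile x)) UNIV"
      using has_integral_integral_lborel by simp
    moreover have "((\<lambda>x. indicator {- ln (real (Suc N))..0} x * profile x) has_integral profile_partial N) UNIV"
      using has_integral_profile [of N] unfolding has_integral_restrict_UNIV [of _ profile, symmetric]
      by (rule has_integral_eq [rotated]) (simp add: indicator_def)
    ultimately show ?thesis by (rule has_integral_unique)
  qed
  ultimately show ?thesis by simp
qed

text \<open>The logarithmic form of \<open>(2 n choose n) ~ 4^n / sqrt (pi n)\<close>, obtained
  because the partial Wallis product equals
  \<open>16^n / ((2 n + 1) (2 n choose n)^2)\<close>.\<close>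

lemma wallis_choose:
  "(\<lambda>n. 2 * ln (real ((2 * n) choose n)) - 4 * real n * ln 2 + ln (real n)) \<longlonglongrightarrow> - ln pi"
proof -
  have prod: "(\<Prod>k=1..n. (4*real k^2) / (4*real k^2 - 1)) = 16 ^ n / ((2 * real n + 1) * (real ((2 * n) choose n))\<^sup>2)" for n
  proof (induction n)
    case (Suc n)
    define c where "c = real ((2 * n) choose n)"
    have c: "c > 0" by (simp add: c_def)
    have "real ((2 * Suc n) choose (Suc n)) * (real n + 1) = 2 * (2 * real n + 1) * c"
    proof -
      have "(2 * Suc n choose Suc n) * Suc n = 2 * (2 * n + 1) * (2 * n choose n)"
      proof -
        have a: "Suc n * (Suc (2 * n + 1) choose Suc n) = Suc (2 * n + 1) * ((2 * n + 1) choose n)"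
          by (rule Suc_times_binomial)
        have "Suc n * (Suc (2 * n) choose Suc n) = Suc (2 * n) * ((2 * n) choose n)"
          by (rule Suc_times_binomial)
        moreover have "Suc (2 * n) choose Suc n = (2 * n + 1) choose n"
          using binomial_symmetric [of "Suc n" "Suc (2 * n)"] by simp
        ultimately have b: "Suc n * ((2 * n + 1) choose n) = (2 * n + 1) * ((2 * n) choose n)" by simp
        have "Suc (2 * n + 1) = 2 * Suc n" by simp
        then show ?thesis using a b by (simp add: algebra_simps)
      qed
      then have "real ((2 * Suc n choose Suc n) * Suc n) = real (2 * (2 * n + 1) * (2 * n choose n))" by (simp only:)
      then show ?thesis unfolding c_def of_nat_mult by (simp add: add.commute)
    qed
    then have c': "real ((2 * Suc n) choose (Suc n)) = 2 * (2 * real n + 1) * c / (real n + 1)"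
      by (simp add: field_simps)
    have "(\<Prod>k=1..Suc n. (4*real k^2) / (4*real k^2 - 1)) = 16 ^ n / ((2 * real n + 1) * c\<^sup>2) * ((4*real (Suc n)^2) / (4*real (Suc n)^2 - 1))"
      using Suc.IH by (simp add: c_def)
    also have "4*real (Suc n)^2 - 1 = (2 * real n + 1) * (2 * real n + 3)"
      by (simp add: power2_eq_square algebra_simps)
    also have "16 ^ n / ((2 * real n + 1) * c\<^sup>2) * ((4*real (Suc n)^2) / ((2 * real n + 1) * (2 * real n + 3))) =
       16 ^ Suc n / ((2 * real (Suc n) + 1) * (2 * (2 * real n + 1) * c / (real n + 1))\<^sup>2)"
      using c by (simp add: divide_simps power2_eq_square) (simp add: algebra_simps)
    finally show ?case unfolding c' .
  qed simp
  have "(\<lambda>n. ln (\<Prod>k=1..n. (4*real k^2) / (4*real k^2 - 1))) \<longlonglongrightarrow> ln (pi / 2)"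
    by (intro tendsto_ln wallis) auto
  moreover have "ln (\<Prod>k=1..n. (4*real k^2) / (4*real k^2 - 1)) = 4 * real n * ln 2 - ln (2 * real n + 1) - 2 * ln (real ((2 * n) choose n))" for n
  proof -
    have "ln (16 ^ n :: real) = real n * ln (2 ^ 4)" by (simp add: ln_realpow)
    also have "\<dots> = 4 * real n * ln 2" by (simp only: ln_realpow)
    finally have "ln (16 ^ n :: real) = 4 * real n * ln 2" .
    then show ?thesis unfolding prod
      by (subst ln_div) (auto simp: ln_mult ln_realpow zero_less_mult_iff add_nonneg_pos)
  qed
  ultimately have "(\<lambda>n. 4 * real n * ln 2 - ln (2 * real n + 1) - 2 * ln (real ((2 * n) choose n))) \<longlonglongrightarrow> ln (pi / 2)" by simp
  moreover have "(\<lambda>n. ln (real n) - ln (2 * real n + 1)) \<longlonglongrightarrow> - ln 2" by real_asymp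
  ultimately have "(\<lambda>n. (ln (real n) - ln (2 * real n + 1)) - (4 * real n * ln 2 - ln (2 * real n + 1) - 2 * ln (real ((2 * n) choose n)))) \<longlonglongrightarrow> - ln 2 - ln (pi / 2)"
    by (intro tendsto_diff)
  then show ?thesis by (simp add: ln_div algebra_simps)
qed

text \<open>As \<open>profile_partial\<close> is already known to converge, twice its
  \<open>n\<close>-th term minus its \<open>2 n\<close>-th term has the same limit. In this
  combination the factorials merge into the central binomial coefficient, which Wallis
  controls.\<close>

lemma integral_profile: "integral\<^sup>L lborel profile = 2 - ln (2 * pi)"
proof -
  have "filterlim (\<lambda>n::nat. 2 * n) sequentially sequentially"
    by (intro filterlim_subseq strict_monoI) simp
  then have "(\<lambda>n. profile_partial (2 * n)) \<longlonglongrightarrow> integral\<^sup>L lborel profile"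
    by (rule filterlim_compose [OF profile_partial_tendsto])
  then have "(\<lambda>n. 2 * profile_partial n - profile_partial (2 * n)) \<longlonglongrightarrow> 2 * integral\<^sup>L lborel profile - integral\<^sup>L lborel profile"
    by (intro tendsto_intros profile_partial_tendsto)
  moreover have eq: "2 * profile_partial n - profile_partial (2 * n) = (2 * ln (real ((2 * n) choose n)) - 4 * real n * ln 2 + ln (real n)) +
      ((4 * real n + 2) * ln (real n + 1) - (4 * real n + 1) * ln (2 * real n + 1) + 4 * real n * ln 2 - ln (real n))" for n
  proof -
    have "real ((2 * n) choose n) = fact (2 * n) / (fact n * fact n)"
      using binomial_fact [of n "2 * n", where 'a = real] by simp
    then have "ln (real ((2 * n) choose n)) = ln (fact (2 * n)) - 2 * ln (fact n)"
      by (simp add: ln_div ln_mult)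
    then show ?thesis by (simp add: profile_partial_def algebra_simps)
  qed
  moreover have "(\<lambda>n. (4 * real n + 2) * ln (real n + 1) - (4 * real n + 1) * ln (2 * real n + 1) + 4 * real n * ln 2 - ln (real n)) \<longlonglongrightarrow> 2 - ln 2"
    by real_asymp
  ultimately have "2 * integral\<^sup>L lborel profile - integral\<^sup>L lborel profile = - ln pi + (2 - ln 2)"
    using tendsto_add [OF wallis_choose] LIMSEQ_unique unfolding eq by blast
  then show ?thesis by (simp add: ln_mult)
qed

text \<open>The leading constant is thus positive and \<open>V\<close> has exact order
  \<open>k ln k\<close>, so that normalising by its square root makes sense. The chain is
  \<open>2 pi < 7 < 2.7^2 \<le> exp 2\<close>.\<close>

lemma ln_2pi_less_2: "ln (2 * pi) < 2"
proof -
  have "2 * pi < 7" using pi_approx by simp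
  also have "(7::real) \<le> 1 + 2 + 2\<^sup>2 / 2 + 2" by simp
  have "(7::real) < (27 / 10) ^ 2" by (simp add: power2_eq_square)
  also have "(27 / 10 :: real) ^ 2 \<le> exp 1 ^ 2"
    using e_approx_32 by (intro power_mono) (auto simp: abs_if split: if_splits)
  also have "exp 1 ^ 2 = exp (2::real)" by (simp add: exp_of_nat_mult [symmetric])
  finally have "2 * pi < exp 2" .
  then have "ln (2 * pi) < ln (exp 2)" by (subst ln_less_cancel_iff) auto
  then show ?thesis by simp
qed

section \<open>Asymptotics of the variance\<close>

text \<open>Multiplied by \<open>ln K\<close> this is the main term of \<open>V\<close>. Proper
  prime powers are included because the limit theorem speaks of \<open>mangoldt\<close>.\<close>

definition frac_sum :: "nat \<Rightarrow> real" where
  "frac_sum K = (\<Sum>n=1..K. mangoldt n * frac_parab (real K / real n))"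

text \<open>It bounds the loss incurred when one factor \<open>ln p\<close> in \<open>V\<close> is
  replaced by \<open>ln K\<close>.\<close>

definition frac_log_sum :: "nat \<Rightarrow> real" where
  "frac_log_sum K = (\<Sum>n=1..K. mangoldt n * frac_parab (real K / real n) * ln (real K / real n))"

text \<open>Specialisation to \<open>T = ln K\<close>. The free factor \<open>c\<close> covers both
  sums: \<open>c = 1\<close> for \<open>frac_sum\<close> and the truncated \<open>- x\<close> for
  \<open>frac_log_sum\<close>.\<close>

lemma weighted_at_ln:
  fixes c :: "real \<Rightarrow> real"
  assumes "((\<lambda>T. \<Sum>n | 0 < n \<and> ln (real n) \<le> T. mangoldt n / real n * (c (ln (real n) - T) * profile (ln (real n) - T))) \<longlongrightarrow> L) at_top"
  shows "(\<lambda>K. (\<Sum>n=1..K. mangoldt n * frac_parab (real K / real n) * c (ln (real n) - ln (real K))) / real K) \<longlonglongrightarrow> L"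
proof -
  have "filterlim (\<lambda>K::nat. ln (real K)) at_top sequentially" by real_asymp
  from filterlim_compose [OF assms this]
  have "(\<lambda>K. \<Sum>n | 0 < n \<and> ln (real n) \<le> ln (real K). mangoldt n / real n * (c (ln (real n) - ln (real K)) * profile (ln (real n) - ln (real K)))) \<longlonglongrightarrow> L" .
  then show ?thesis
  proof (rule Lim_transform_eventually)
    show "eventually (\<lambda>K. (\<Sum>n | 0 < n \<and> ln (real n) \<le> ln (real K). mangoldt n / real n * (c (ln (real n) - ln (real K)) * profile (ln (real n) - ln (real K)))) =
       (\<Sum>n=1..K. mangoldt n * frac_parab (real K / real n) * c (ln (real n) - ln (real K))) / real K) sequentially"
      using eventually_gt_at_top [of 0]
    proof eventually_elim
      case (elim K)
      have A: "{n. 0 < n \<and> ln (real n) \<le> ln (real K)} = {1..K}" using elim by auto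
      show ?case unfolding A sum_divide_distrib
      proof (rule sum.cong [OF refl])
        fix n assume "n \<in> {1..K}"
        then have n: "n > 0" "n \<le> K" by auto
        have e: "exp (ln (real n) - ln (real K)) = real n / real K" using n elim by (simp add: exp_diff)
        have e': "exp (- (ln (real n) - ln (real K))) = real K / real n" using n elim by (simp add: exp_diff)
        have "ln (real n) - ln (real K) \<le> 0" using n elim by simp
        from profile_neg [OF this] have "profile (ln (real n) - ln (real K)) = real n / real K * frac_parab (real K / real n)"
          unfolding e e' .
        then show "mangoldt n / real n * (c (ln (real n) - ln (real K)) * profile (ln (real n) - ln (real K))) =
           mangoldt n * frac_parab (real K / real n) * c (ln (real n) - ln (real K)) / real K"
          using n by simp
      qed
    qed
  qed
qed

lemma frac_sum_tendsto: "(\<lambda>K. frac_sum K / real K) \<longlonglongrightarrow> 2 - ln (2 * pi)"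
proof -
  have "((\<lambda>T. \<Sum>n | 0 < n \<and> ln (real n) \<le> T. mangoldt n / real n * profile (ln (real n) - T)) \<longlongrightarrow> integral\<^sup>L lborel profile) at_top"
    by (rule mangoldt_weighted [OF continuous_profile profile_le]) (auto simp: profile_pos_0)
  then show ?thesis
    using weighted_at_ln [of "\<lambda>_. 1" "2 - ln (2 * pi)"] by (simp add: integral_profile frac_sum_def)
qed

text \<open>The value of the limit is left open: convergence makes this sum \<open>O(K)\<close>, of
  lower order than the main term \<open>K ln K\<close>.\<close>

lemma frac_log_sum_tendsto: "\<exists>L. (\<lambda>K. frac_log_sum K / real K) \<longlonglongrightarrow> L"
proof -
  define L where "L = (LINT x|lborel. max 0 (- x) * profile x)"
  have c: "continuous_on UNIV (\<lambda>x. max 0 (- x) * profile x)"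
    by (intro continuous_intros continuous_profile)
  have "((\<lambda>T. \<Sum>n | 0 < n \<and> ln (real n) \<le> T. mangoldt n / real n * (max 0 (- (ln (real n) - T)) * profile (ln (real n) - T))) \<longlongrightarrow> L) at_top"
    unfolding L_def by (rule mangoldt_weighted [OF c profile_tilt_le]) (auto simp: profile_pos_0)
  from weighted_at_ln [OF this] 
  have "(\<lambda>K. (\<Sum>n=1..K. mangoldt n * frac_parab (real K / real n) * max 0 (- (ln (real n) - ln (real K)))) / real K) \<longlonglongrightarrow> L" .
  also have "(\<lambda>K. (\<Sum>n=1..K. mangoldt n * frac_parab (real K / real n) * max 0 (- (ln (real n) - ln (real K)))) / real K) =
      (\<lambda>K. frac_log_sum K / real K)"
    unfolding frac_log_sum_def
    by (intro ext arg_cong2 [where f = "(/)"] sum.cong refl) (auto simp: ln_div max_def)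
  finally show ?thesis by blast
qed

text \<open>A proper prime power \<open>p^a \<le> K\<close> has \<open>p \<le> sqrt K\<close> and
  \<open>a \<le> log 2 K\<close>, which bounds their number; each one contributes at most
  \<open>ln K\<close>.\<close>

lemma sum_mangoldt_nonprime:
  assumes K: "K \<ge> 2"
  shows "(\<Sum>n | n \<in> {1..K} \<and> \<not> prime n. mangoldt n) \<le> sqrt (real K) * log 2 (real K) * ln (real K)"
proof -
  define P where "P = {n. n \<in> {1..K} \<and> \<not> prime n \<and> primepow n}"
  define R where "R = {1..nat \<lfloor>sqrt (real K)\<rfloor>} \<times> {1..nat \<lfloor>log 2 (real K)\<rfloor>}"
  have fin: "finite P" by (simp add: P_def)
  have "P \<subseteq> (\<lambda>(p, a). p ^ a) ` R"
  proof
    fix n assume n: "n \<in> P"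
    then obtain p a where pa: "prime p" "a > 0" "n = p ^ a" by (auto simp: P_def primepow_def)
    have "a \<noteq> 1" using n pa by (auto simp: P_def)
    then have a: "a \<ge> 2" using pa by simp
    have p: "p \<ge> 2" using pa(1) by (rule prime_ge_2_nat)
    have nK: "n \<le> K" using n by (simp add: P_def)
    have "p\<^sup>2 \<le> p ^ a" using p a by (intro power_increasing) auto
    then have "real (p\<^sup>2) \<le> real K" using pa nK by (simp only: of_nat_le_iff)
    then have "real p \<le> sqrt (real K)" by (intro real_le_rsqrt) simp
    then have "p \<le> nat \<lfloor>sqrt (real K)\<rfloor>" by (simp add: le_nat_iff le_floor_iff)
    moreover have "2 ^ a \<le> p ^ a" using p by (intro power_mono) auto
    then have "real (2 ^ a) \<le> real K" using pa nK by (simp only: of_nat_le_iff)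
    then have "real a \<le> log 2 (real K)" using K by (simp add: le_log_iff powr_realpow)
    then have "a \<le> nat \<lfloor>log 2 (real K)\<rfloor>" by (simp add: le_nat_iff le_floor_iff)
    ultimately have "(p, a) \<in> R" using p a by (simp add: R_def)
    then show "n \<in> (\<lambda>(p, a). p ^ a) ` R" using pa(3) by force
  qed
  then have "card P \<le> card ((\<lambda>(p, a). p ^ a) ` R)"
    by (intro card_mono finite_imageI) (simp add: R_def)
  also have "\<dots> \<le> card R"
    by (rule card_image_le) (simp add: R_def)
  also have "card R = nat \<lfloor>sqrt (real K)\<rfloor> * nat \<lfloor>log 2 (real K)\<rfloor>" by (simp add: R_def)
  finally have "real (card P) \<le> real (nat \<lfloor>sqrt (real K)\<rfloor>) * real (nat \<lfloor>log 2 (real K)\<rfloor>)"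
    by (simp only: of_nat_le_iff of_nat_mult [symmetric])
  also have "\<dots> \<le> sqrt (real K) * log 2 (real K)"
  proof (rule mult_mono)
    have "log 2 (real K) \<ge> 0" using K by simp
    then show "real (nat \<lfloor>log 2 (real K)\<rfloor>) \<le> log 2 (real K)" by simp
  qed auto
  finally have cP: "real (card P) \<le> sqrt (real K) * log 2 (real K)" .
  have "(\<Sum>n | n \<in> {1..K} \<and> \<not> prime n. mangoldt n :: real) = (\<Sum>n\<in>P. mangoldt n)"
    by (rule sum.mono_neutral_right) (auto simp: P_def mangoldt_def)
  also have "\<dots> \<le> real (card P) * ln (real K)"
  proof (rule sum_bounded_above)
    fix n assume "n \<in> P"
    then have n: "n > 0" "n \<le> K" by (auto simp: P_def)
    have "mangoldt n \<le> ln (real n)" using n by (intro mangoldt_le) auto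
    also have "\<dots> \<le> ln (real K)" using n by simp
    finally show "mangoldt n \<le> ln (real K)" .
  qed
  also have "\<dots> \<le> sqrt (real K) * log 2 (real K) * ln (real K)"
    using K by (intro mult_right_mono cP) simp
  finally show ?thesis .
qed

lemma primes_upto_int: "primes_upto (int K) = int ` {p. prime p \<and> p \<le> K}"
proof (intro equalityI subsetI)
  fix p assume "p \<in> primes_upto (int K)"
  then have p: "prime p" "p \<le> int K" by (auto simp: primes_upto_def)
  have "p = int (nat p)" using prime_gt_0_int [OF p(1)] by simp
  moreover have "prime (nat p)" using p(1) by (metis prime_int_nat_transfer)
  moreover have "nat p \<le> K" using p(2) by simp
  ultimately show "p \<in> int ` {p. prime p \<and> p \<le> K}" by blast
qed (auto simp: primes_upto_def)

lemma V_eq: "V (int K) = (\<Sum>p | prime p \<and> p \<le> K. (ln (real p))\<^sup>2 * frac_parab (real K / real p))"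
  unfolding V_def primes_upto_int
  by (subst sum.reindex) (auto simp: alpha_eq_frac frac_parab_def mult.assoc intro!: sum.cong)

text \<open>On primes \<open>(ln p)^2 = ln p * mangoldt p\<close>. Replacing \<open>ln p\<close> by
  \<open>ln K\<close> overestimates by at most \<open>frac_log_sum\<close>, and adding the proper
  prime powers costs at most \<open>sum_mangoldt_nonprime\<close> times \<open>ln K\<close>.\<close>

lemma V_bounds:
  assumes K: "K \<ge> 2"
  shows "V (int K) \<le> ln (real K) * frac_sum K"
    and "ln (real K) * frac_sum K - frac_log_sum K - ln (real K) * (sqrt (real K) * log 2 (real K) * ln (real K)) \<le> V (int K)"
proof -
  define P where "P = {p. prime p \<and> p \<le> K}"
  define Q where "Q = {n. n \<in> {1..K} \<and> \<not> prime n}"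
  have PQ: "{1..K} = P \<union> Q" "P \<inter> Q = {}" "finite P" "finite Q"
    by (auto simp: P_def Q_def prime_gt_0_nat Suc_le_eq)
  have lnK: "ln (real K) \<ge> 0" using K by simp
  define f where "f = (\<lambda>n. frac_parab (real K / real n))"
  have f: "0 \<le> f n" "f n \<le> 1" for n by (auto simp: f_def frac_parab_le_1)
  have V: "V (int K) = (\<Sum>p\<in>P. ln (real p) * (mangoldt p * f p))"
    unfolding V_eq by (auto simp: P_def f_def power2_eq_square intro!: sum.cong)
  have le: "ln (real p) \<le> ln (real K)" "ln (real p) \<ge> 0" if "p \<in> P" for p
    using that prime_gt_0_nat [of p] by (auto simp: P_def)
  have lam: "frac_sum K = (\<Sum>n\<in>P. mangoldt n * f n) + (\<Sum>n\<in>Q. mangoldt n * f n)"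
    unfolding frac_sum_def PQ(1) f_def by (rule sum.union_disjoint) (use PQ in auto)
  have Q0: "(\<Sum>n\<in>Q. mangoldt n * f n) \<ge> 0"
    by (intro sum_nonneg mult_nonneg_nonneg mangoldt_nonneg f)
  have "V (int K) \<le> (\<Sum>p\<in>P. ln (real K) * (mangoldt p * f p))"
    unfolding V by (intro sum_mono mult_right_mono le mult_nonneg_nonneg mangoldt_nonneg f)
  also have "\<dots> \<le> ln (real K) * frac_sum K"
    unfolding lam using Q0 lnK by (simp add: sum_distrib_left [symmetric] distrib_left)
  finally show "V (int K) \<le> ln (real K) * frac_sum K" .
  have "(\<Sum>n\<in>Q. mangoldt n * f n) \<le> (\<Sum>n\<in>Q. mangoldt n)"
    using f by (intro sum_mono mult_left_le mangoldt_nonneg)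
  also have "\<dots> \<le> sqrt (real K) * log 2 (real K) * ln (real K)"
    unfolding Q_def by (rule sum_mangoldt_nonprime [OF K])
  finally have Q1: "(\<Sum>n\<in>Q. mangoldt n * f n) \<le> sqrt (real K) * log 2 (real K) * ln (real K)" .
  have "ln (real K) * (\<Sum>n\<in>P. mangoldt n * f n) - V (int K) = (\<Sum>n\<in>P. mangoldt n * f n * ln (real K / real n))"
    unfolding V sum_distrib_left sum_subtractf [symmetric]
  proof (rule sum.cong [OF refl])
    fix n assume "n \<in> P"
    then have "n > 0" by (simp add: P_def prime_gt_0_nat)
    then show "ln (real K) * (mangoldt n * f n) - ln (real n) * (mangoldt n * f n) = mangoldt n * f n * ln (real K / real n)"
      using K by (simp add: ln_div algebra_simps)
  qed
  also have "\<dots> \<le> frac_log_sum K"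
    unfolding frac_log_sum_def f_def
  proof (rule sum_mono2)
    show "P \<subseteq> {1..K}" using PQ(1) by simp
    fix n assume "n \<in> {1..K} - P"
    then have "ln (real K / real n) \<ge> 0" by simp
    then show "0 \<le> mangoldt n * frac_parab (real K / real n) * ln (real K / real n)"
      by (intro mult_nonneg_nonneg mangoldt_nonneg frac_parab_nonneg)
  qed simp
  finally show "ln (real K) * frac_sum K - frac_log_sum K - ln (real K) * (sqrt (real K) * log 2 (real K) * ln (real K)) \<le> V (int K)"
    unfolding lam using mult_left_mono [OF Q1 lnK] by (simp add: distrib_left)
qed

theorem V_asymptotics: "(\<lambda>K. V (int K) / (real K * ln (real K))) \<longlonglongrightarrow> 2 - ln (2 * pi)"
proof -
  obtain L where L: "(\<lambda>K. frac_log_sum K / real K) \<longlonglongrightarrow> L" using frac_log_sum_tendsto by blast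
  have "(\<lambda>K. 1 / ln (real K)) \<longlonglongrightarrow> 0" by real_asymp
  from tendsto_mult [OF L this] have L0: "(\<lambda>K. frac_log_sum K / real K * (1 / ln (real K))) \<longlonglongrightarrow> 0" by simp
  have E: "(\<lambda>K. sqrt (real K) * log 2 (real K) * ln (real K) / real K) \<longlonglongrightarrow> 0"
    by real_asymp
  show ?thesis
  proof (rule tendsto_sandwich [OF _ _ _ frac_sum_tendsto])
    show "(\<lambda>K. frac_sum K / real K - frac_log_sum K / real K * (1 / ln (real K)) - sqrt (real K) * log 2 (real K) * ln (real K) / real K) \<longlonglongrightarrow> 2 - ln (2 * pi)"
      using tendsto_diff [OF tendsto_diff [OF frac_sum_tendsto L0] E] by simp
    show "eventually (\<lambda>K. V (int K) / (real K * ln (real K)) \<le> frac_sum K / real K) sequentially"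
      using eventually_ge_at_top [of 2]
    proof eventually_elim
      case (elim K)
      then have "ln (real K) > 0" "real K > 0" by auto
      then show ?case using V_bounds(1) [OF elim] by (simp add: field_simps)
    qed
    show "eventually (\<lambda>K. frac_sum K / real K - frac_log_sum K / real K * (1 / ln (real K)) - sqrt (real K) * log 2 (real K) * ln (real K) / real K
       \<le> V (int K) / (real K * ln (real K))) sequentially"
      using eventually_ge_at_top [of 2]
    proof eventually_elim
      case (elim K)
      define l where "l = ln (real K)"
      have l: "l > 0" "real K > 0" using elim by (auto simp: l_def)
      have "frac_sum K / real K - frac_log_sum K / real K * (1 / l) - sqrt (real K) * log 2 (real K) * l / real K
        = (l * frac_sum K - frac_log_sum K - l * (sqrt (real K) * log 2 (real K) * l)) / (real K * l)"
        using l by (simp add: field_simps)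
      also have "\<dots> \<le> V (int K) / (real K * l)"
        using l V_bounds(2) [OF elim] by (intro divide_right_mono) (auto simp: l_def)
      finally show ?case unfolding l_def .
    qed
  qed
qed

section \<open>Carries and periodic functions\<close>

text \<open>Legendre's formula by induction: passing to \<open>n + 1\<close> raises
  \<open>n div p^a\<close> by one exactly when \<open>p^a\<close> divides \<open>n + 1\<close>, that
  is, for \<open>a\<close> up to the multiplicity of \<open>p\<close>. The bound on \<open>n\<close>
  ensures that the range \<open>1..L\<close> misses no such \<open>a\<close>.\<close>

lemma multiplicity_fact:
  assumes p: "prime (p :: int)" and n: "int n < p ^ L"
  shows "int (multiplicity p (fact n)) = (\<Sum>a=1..L. int n div p ^ a)"
  using n
proof (induction n)
  case 0
  then show ?case by simp
next
  case (Suc n)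
  have p1: "p > 1" using p by (rule prime_gt_1_int)
  define m where "m = multiplicity p (int (Suc n))"
  have "p ^ m dvd int (Suc n)" by (simp add: m_def multiplicity_dvd)
  then have "p ^ m \<le> int (Suc n)" by (rule zdvd_imp_le) simp
  also note Suc.prems
  finally have "m < L" using p1 by (simp add: power_strict_increasing_iff)
  have "multiplicity p (int (Suc n) * fact n) = m + multiplicity p (fact n)"
    unfolding m_def by (rule prime_elem_multiplicity_mult_distrib [OF prime_imp_prime_elem [OF p]]) simp_all
  then have "multiplicity p (fact (Suc n)) = m + multiplicity p (fact n)"
    by (simp only: fact_Suc)
  moreover have "int m = (\<Sum>a=1..L. of_bool (p ^ a dvd int (Suc n)))"
  proof -
    have nu: "\<not> is_unit p" using p not_prime_unit by blast
    then have "p ^ a dvd int (Suc n) \<longleftrightarrow> a \<le> m" for a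
      unfolding m_def using power_dvd_iff_le_multiplicity [of "int (Suc n)" p a] nu by simp
    then have "(\<Sum>a=1..L. of_bool (p ^ a dvd int (Suc n))) = (\<Sum>a=1..L. of_bool (a \<le> m) :: int)" by simp
    also have "\<dots> = (\<Sum>a=1..m. 1)"
      using \<open>m < L\<close> by (intro sum.mono_neutral_cong_right) auto
    finally show ?thesis by simp
  qed
  moreover have "(\<Sum>a=1..L. of_bool (p ^ a dvd int (Suc n))) + (\<Sum>a=1..L. int n div p ^ a) = (\<Sum>a=1..L. int (Suc n) div p ^ a)"
    unfolding sum.distrib [symmetric]
  proof (rule sum.cong [OF refl])
    fix a
    have q: "p ^ a > 0" using p1 by simp
    show "of_bool (p ^ a dvd int (Suc n)) + int n div p ^ a = int (Suc n) div p ^ a"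
    proof (cases "p ^ a dvd int (Suc n)")
      case True
      then obtain c where c: "int (Suc n) = p ^ a * c" by (elim dvdE)
      have "int n = p ^ a * (c - 1) + (p ^ a - 1)" using c by (simp add: algebra_simps)
      then have "int n div p ^ a = c - 1" by (rule int_div_pos_eq) (use q in auto)
      moreover have "int (Suc n) div p ^ a = c"
        unfolding c by (rule nonzero_mult_div_cancel_left) (use q in linarith)
      ultimately show ?thesis using True by simp
    next
      case False
      define c where "c = int (Suc n) div p ^ a"
      define r where "r = int (Suc n) mod p ^ a"
      have r: "r \<noteq> 0" "r \<ge> 0" "r < p ^ a" using False q by (auto simp: r_def dvd_eq_mod_eq_0)
      have "int (Suc n) = p ^ a * c + r" by (simp add: c_def r_def)
      then have "int n = p ^ a * c + (r - 1)" by simp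
      then have "int n div p ^ a = c" by (rule int_div_pos_eq) (use r in auto)
      then show ?thesis using False by (simp add: c_def)
    qed
  qed
  ultimately show ?case using Suc by simp
qed

text \<open>The remainders of \<open>k\<close> and \<open>n - k\<close> add up to \<open>q\<close>
  or more exactly when the remainder of \<open>n\<close> has dropped below that of \<open>k\<close>;
  this is the carry in adding \<open>k\<close> and \<open>n - k\<close>.\<close>

lemma div_carry:
  fixes n k q :: int
  assumes "q > 0"
  shows "n div q - k div q - (n - k) div q = of_bool (n mod q < k mod q)"
proof -
  define m where "m = n - k"
  have n: "n = k + m" by (simp add: m_def)
  define s where "s = k mod q + m mod q"
  have b: "0 \<le> k mod q" "k mod q < q" "0 \<le> m mod q" "m mod q < q" using assms by auto
  have d: "n div q = k div q + m div q + s div q" unfolding n s_def by (rule div_add1_eq)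
  have md: "n mod q = s mod q" unfolding n s_def by (simp add: mod_add_eq)
  show ?thesis
  proof (cases "s < q")
    case True
    then have "s div q = 0" "s mod q = s" using b by (auto simp: s_def)
    then show ?thesis using d md b by (simp add: m_def s_def)
  next
    case False
    then have sq: "s = q * 1 + (s - q)" "0 \<le> s - q" "s - q < q" using b unfolding s_def by linarith+
    then have "s div q = 1" by (rule int_div_pos_eq)
    moreover have "s mod q = s - q" using sq by (rule int_mod_pos_eq)
    ultimately show ?thesis using d md b by (simp add: m_def s_def)
  qed
qed

text \<open>Legendre's formula for the three factorials, with a common cutoff \<open>L\<close>,
  subtracted exponent by exponent.\<close>

lemma multiplicity_binomial:
  assumes p: "prime (p :: int)" and k: "0 \<le> k" "k \<le> n" and L: "n < p ^ L"
  shows "int (multiplicity p (int (nat n choose nat k))) = (\<Sum>a=1..L. of_bool (n mod p ^ a < k mod p ^ a))"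
proof -
  have p1: "p > 1" using p by (rule prime_gt_1_int)
  define N K where "N = nat n" and "K = nat k"
  have NK: "K \<le> N" "int N = n" "int K = k" "int (N - K) = n - k" using k by (auto simp: N_def K_def)
  have "fact K * fact (N - K) * (N choose K) = (fact N :: nat)" by (rule binomial_fact_lemma) fact
  then have "int (fact K * fact (N - K) * (N choose K)) = int (fact N)" by (simp only:)
  then have "fact K * fact (N - K) * int (N choose K) = (fact N :: int)" by simp
  then have "multiplicity p (fact N :: int) = multiplicity p (fact K) + multiplicity p (fact (N - K)) + multiplicity p (int (N choose K))"
    using NK(1) prime_elem_multiplicity_mult_distrib [OF prime_imp_prime_elem [OF p], of "fact K * fact (N - K)" "int (N choose K)"]
      prime_elem_multiplicity_mult_distrib [OF prime_imp_prime_elem [OF p], of "fact K" "fact (N - K) :: int"] by simp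
  moreover have "int (multiplicity p (fact N)) = (\<Sum>a=1..L. n div p ^ a)"
    using multiplicity_fact [OF p, of N L] NK L by simp
  moreover have "int (multiplicity p (fact K)) = (\<Sum>a=1..L. k div p ^ a)"
    using multiplicity_fact [OF p, of K L] NK L k by simp
  moreover have "int (multiplicity p (fact (N - K))) = (\<Sum>a=1..L. (n - k) div p ^ a)"
    using multiplicity_fact [OF p, of "N - K" L] NK L k by simp
  ultimately have "int (multiplicity p (int (N choose K))) = (\<Sum>a=1..L. n div p ^ a - k div p ^ a - (n - k) div p ^ a)"
    by (simp add: sum_subtractf)
  also have "\<dots> = (\<Sum>a=1..L. of_bool (n mod p ^ a < k mod p ^ a))"
    using p1 by (intro sum.cong refl div_carry) simp
  finally show ?thesis by (simp add: N_def K_def)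
qed

text \<open>The carry indicator minus its mean over a full period \<open>q\<close>. The subtracted
  fractions are the terms of \<open>mean_const\<close>.\<close>

definition carry :: "int \<Rightarrow> int \<Rightarrow> int \<Rightarrow> real" where
  "carry k q n = of_bool (n mod q < k mod q) - real_of_int (k mod q) / real_of_int q"

lemma U_eq:
  assumes k: "0 \<le> k" "k \<le> n" and L: "\<And>p. p \<in> primes_upto k \<Longrightarrow> n < p ^ L"
  shows "U k n = (\<Sum>p\<in>primes_upto k. ln (real_of_int p) * (\<Sum>a=1..L. of_bool (n mod p ^ a < k mod p ^ a)))"
proof -
  have "real_of_int (smooth_part_binom n k) = (\<Prod>p\<in>primes_upto k. real_of_int p ^ multiplicity p (int (nat n choose nat k)))"
    by (simp add: smooth_part_binom_def)
  then have "U k n = ln (\<Prod>p\<in>primes_upto k. real_of_int p ^ multiplicity p (int (nat n choose nat k)))"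
    by (simp add: U_def)
  also have "\<dots> = (\<Sum>p\<in>primes_upto k. ln (real_of_int p ^ multiplicity p (int (nat n choose nat k))))"
    by (rule ln_prod [OF finite_primes_upto]) (auto simp: primes_upto_def prime_gt_0_int)
  also have "\<dots> = (\<Sum>p\<in>primes_upto k. ln (real_of_int p) * (\<Sum>a=1..L. of_bool (n mod p ^ a < k mod p ^ a)))"
  proof (rule sum.cong [OF refl])
    fix p assume p: "p \<in> primes_upto k"
    then have "prime p" by (simp add: primes_upto_def)
    from multiplicity_binomial [OF this k L [OF p]]
    have "real_of_int (int (multiplicity p (int (nat n choose nat k)))) = real_of_int (\<Sum>a=1..L. of_bool (n mod p ^ a < k mod p ^ a))"
      by (simp only:)
    then have "real (multiplicity p (int (nat n choose nat k))) = (\<Sum>a=1..L. of_bool (n mod p ^ a < k mod p ^ a))"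
      by simp
    then show "ln (real_of_int p ^ multiplicity p (int (nat n choose nat k))) = ln (real_of_int p) * (\<Sum>a=1..L. of_bool (n mod p ^ a < k mod p ^ a))"
      using prime_gt_0_int [OF \<open>prime p\<close>] by (simp add: ln_realpow)
  qed
  finally show ?thesis .
qed

section \<open>Sums of periodic functions over intervals and over coprime moduli\<close>

definition periodic :: "int \<Rightarrow> (int \<Rightarrow> 'a) \<Rightarrow> bool" where
  "periodic q f \<longleftrightarrow> (\<forall>n. f (n mod q) = f n)"

lemma periodicD: "periodic q f \<Longrightarrow> f (n mod q) = f n"
  by (simp add: periodic_def)

lemma periodic_dvd: "periodic q f \<Longrightarrow> q dvd r \<Longrightarrow> periodic r f"
  unfolding periodic_def by (metis mod_mod_cancel)

lemma periodic_carry: "q > 0 \<Longrightarrow> periodic q (carry k q)"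
  by (simp add: periodic_def carry_def)

lemma periodic_compose: "periodic q f \<Longrightarrow> periodic q (\<lambda>n. g (f n))"
  by (simp add: periodic_def)

lemma periodic_mult: "periodic q f \<Longrightarrow> periodic q g \<Longrightarrow> periodic q (\<lambda>n. f n * g n)"
  by (simp add: periodic_def)

lemma sum_period_block:
  fixes f :: "int \<Rightarrow> 'a :: comm_monoid_add"
  assumes "q > 0" "periodic q f"
  shows "(\<Sum>n=a..<a + q. f n) = (\<Sum>n=0..<q. f n)"
proof -
  have "bij_betw (\<lambda>n. n mod q) {a..<a + q} {0..<q}"
  proof (rule bij_betw_imageI)
    show inj: "inj_on (\<lambda>n. n mod q) {a..<a + q}"
    proof (rule inj_onI)
      fix x y assume xy: "x \<in> {a..<a + q}" "y \<in> {a..<a + q}" "x mod q = y mod q"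
      then have "q dvd (x - y)" by (simp add: mod_eq_dvd_iff)
      moreover have "\<bar>x - y\<bar> < q" using xy by auto
      ultimately show "x = y" using dvd_imp_le_int [of "x - y" q] assms(1) by auto
    qed
    show "(\<lambda>n. n mod q) ` {a..<a + q} = {0..<q}"
      by (rule card_subset_eq) (use assms(1) card_image [OF inj] in auto)
  qed
  from sum.reindex_bij_betw [OF this, of f] show ?thesis
    using periodicD [OF assms(2)] by simp
qed

lemma sum_period_blocks:
  fixes f :: "int \<Rightarrow> real"
  assumes "q > 0" "periodic q f"
  shows "(\<Sum>n=a..<a + int d * q. f n) = real d * (\<Sum>n=0..<q. f n)"
proof (induction d)
  case (Suc d)
  have "{a..<a + int (Suc d) * q} = {a..<a + int d * q} \<union> {a + int d * q..<(a + int d * q) + q}"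
    using assms(1) by (auto simp: algebra_simps) (smt (verit) mult_nonneg_nonneg of_nat_0_le_iff)
  then have "(\<Sum>n=a..<a + int (Suc d) * q. f n) = (\<Sum>n=a..<a + int d * q. f n) + (\<Sum>n=a + int d * q..<(a + int d * q) + q. f n)"
    by (simp only:) (rule sum.union_disjoint, auto)
  then show ?case unfolding Suc.IH sum_period_block [OF assms] by (simp add: algebra_simps)
qed simp

text \<open>The error is measured by the absolute sum over one period instead of the period times a
  supremum. This matters for high prime powers, where \<open>q\<close> may exceed \<open>N\<close>
  although the absolute sum of the carries remains of size \<open>k\<close>.\<close>

lemma sum_interval_periodic:
  fixes f :: "int \<Rightarrow> real"
  assumes q: "q > 0" and f: "periodic q f" and N: "N \<ge> 0"
  shows "\<bar>(\<Sum>n=a..<a + N. f n) - real_of_int N / real_of_int q * (\<Sum>n=0..<q. f n)\<bar> \<le> 2 * (\<Sum>n=0..<q. \<bar>f n\<bar>)"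
proof -
  define d where "d = nat (N div q)"
  define r where "r = N mod q"
  define B where "B = (\<Sum>n=0..<q. f n)"
  define A where "A = (\<Sum>n=0..<q. \<bar>f n\<bar>)"
  have d: "int d = N div q" using N q by (simp add: d_def pos_imp_zdiv_nonneg_iff)
  have r: "0 \<le> r" "r < q" using q by (auto simp: r_def)
  have Nd: "N = int d * q + r" unfolding d r_def by simp
  have "{a..<a + N} = {a..<a + int d * q} \<union> {a + int d * q..<a + int d * q + r}"
    using r q unfolding Nd by auto (smt (verit) mult_nonneg_nonneg of_nat_0_le_iff)
  then have "(\<Sum>n=a..<a + N. f n) = (\<Sum>n=a..<a + int d * q. f n) + (\<Sum>n=a + int d * q..<a + int d * q + r. f n)"
    by (simp only:) (rule sum.union_disjoint, auto)
  then have s: "(\<Sum>n=a..<a + N. f n) = real d * B + (\<Sum>n=a + int d * q..<a + int d * q + r. f n)"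
    unfolding sum_period_blocks [OF q f] B_def .
  have "\<bar>\<Sum>n=a + int d * q..<a + int d * q + r. f n\<bar> \<le> (\<Sum>n=a + int d * q..<a + int d * q + r. \<bar>f n\<bar>)"
    by (rule sum_abs)
  also have "\<dots> \<le> (\<Sum>n=a + int d * q..<a + int d * q + q. \<bar>f n\<bar>)"
    using r by (intro sum_mono2) auto
  also have "\<dots> = A" unfolding A_def
    by (rule sum_period_block [OF q]) (rule periodic_compose [OF f])
  finally have 1: "\<bar>\<Sum>n=a + int d * q..<a + int d * q + r. f n\<bar> \<le> A" .
  have "real_of_int N / real_of_int q * B = real d * B + real_of_int r / real_of_int q * B"
    using q by (simp add: Nd add_divide_distrib distrib_right)
  moreover have "\<bar>real_of_int r / real_of_int q * B\<bar> \<le> A"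
  proof -
    have "\<bar>B\<bar> \<le> A" unfolding A_def B_def by (rule sum_abs)
    moreover have "\<bar>real_of_int r / real_of_int q\<bar> \<le> 1" using r q by (simp add: divide_simps)
    ultimately have "\<bar>real_of_int r / real_of_int q\<bar> * \<bar>B\<bar> \<le> 1 * A"
      by (intro mult_mono) auto
    then show ?thesis by (simp add: abs_mult)
  qed
  ultimately show ?thesis
    using 1 abs_triangle_ineq4 [of "\<Sum>n=a + int d * q..<a + int d * q + r. f n" "real_of_int r / real_of_int q * B"]
    unfolding s A_def [symmetric] B_def [symmetric] by simp
qed

text \<open>Residues modulo coprime numbers are jointly uniform, so over the full period functions
  of the two residues are independent.\<close>

lemma sum_crt:
  fixes f g :: "int \<Rightarrow> 'a :: comm_semiring_1"
  assumes q: "q1 > 0" "q2 > 0" "coprime q1 q2" and f: "periodic q1 f" "periodic q2 g"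
  shows "(\<Sum>n=0..<q1 * q2. f n * g n) = (\<Sum>n=0..<q1. f n) * (\<Sum>n=0..<q2. g n)"
proof -
  have bij: "bij_betw (\<lambda>n. (n mod q1, n mod q2)) {0..<q1 * q2} ({0..<q1} \<times> {0..<q2})"
  proof (rule bij_betw_imageI)
    show inj: "inj_on (\<lambda>n. (n mod q1, n mod q2)) {0..<q1 * q2}"
    proof (rule inj_onI)
      fix x y assume xy: "x \<in> {0..<q1 * q2}" "y \<in> {0..<q1 * q2}" "(x mod q1, x mod q2) = (y mod q1, y mod q2)"
      then have "[x = y] (mod q1 * q2)" using q by (intro coprime_cong_mult) (auto simp: cong_def)
      then show "x = y" using xy by (simp add: cong_def)
    qed
    show "(\<lambda>n. (n mod q1, n mod q2)) ` {0..<q1 * q2} = {0..<q1} \<times> {0..<q2}"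
      by (rule card_subset_eq) (use q card_image [OF inj] in \<open>auto simp: nat_mult_distrib\<close>)
  qed
  have "(\<Sum>n=0..<q1 * q2. f n * g n) = (\<Sum>n=0..<q1 * q2. (\<lambda>(x, y). f x * g y) (n mod q1, n mod q2))"
    using periodicD [OF f(1)] periodicD [OF f(2)] by simp
  also have "\<dots> = (\<Sum>(x, y)\<in>{0..<q1} \<times> {0..<q2}. f x * g y)"
    by (rule sum.reindex_bij_betw [OF bij])
  also have "\<dots> = (\<Sum>n=0..<q1. f n) * (\<Sum>n=0..<q2. g n)"
    by (simp add: sum.cartesian_product sum_product)
  finally show ?thesis .
qed

lemma sum_prod_crt:
  fixes h :: "int \<Rightarrow> int \<Rightarrow> 'a :: comm_semiring_1"
  assumes "finite P" "\<And>p. p \<in> P \<Longrightarrow> prime p" "\<And>p. p \<in> P \<Longrightarrow> periodic p (h p)"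
  shows "(\<Sum>n=0..<\<Prod>P. \<Prod>p\<in>P. h p n) = (\<Prod>p\<in>P. \<Sum>n=0..<p. h p n)"
  using assms
proof (induction P rule: finite_induct)
  case empty
  then show ?case by simp
next
  case (insert p P)
  have pos: "q > 0" if "q \<in> insert p P" for q using insert.prems(1) that by (auto intro: prime_gt_0_int)
  have "coprime p (\<Prod>P)"
    using insert.hyps insert.prems(1) by (intro prod_coprime_right) (auto intro!: primes_coprime)
  moreover have "periodic (\<Prod>P) (\<lambda>n. \<Prod>q\<in>P. h q n)"
    unfolding periodic_def
  proof (intro allI prod.cong refl)
    fix n q assume q: "q \<in> P"
    then have "periodic (\<Prod>P) (h q)"
      using insert.prems(2) [of q] dvd_prodI [OF insert.hyps(1) q, of "\<lambda>x. x"] by (auto intro: periodic_dvd)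
    then show "h q (n mod \<Prod>P) = h q n" by (rule periodicD)
  qed
  ultimately have A: "(\<Sum>n=0..<p * \<Prod>P. h p n * (\<Prod>q\<in>P. h q n)) = (\<Sum>n=0..<p. h p n) * (\<Sum>n=0..<\<Prod>P. \<Prod>q\<in>P. h q n)"
    using pos insert.prems(2) by (intro sum_crt) (auto intro!: prod_pos)
  have B: "(\<Sum>n=0..<\<Prod>P. \<Prod>q\<in>P. h q n) = (\<Prod>q\<in>P. \<Sum>n=0..<q. h q n)"
    by (rule insert.IH) (use insert.prems in auto)
  show ?case unfolding prod.insert [OF insert.hyps(1,2)] A B ..
qed

section \<open>Size, mean and variance of a single carry indicator\<close>

lemma abs_carry_le: "q > 0 \<Longrightarrow> \<bar>carry k q n\<bar> \<le> 1"
proof -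
  assume q: "q > 0"
  then have "0 \<le> k mod q" "k mod q < q" by auto
  then have "0 \<le> real_of_int (k mod q) / real_of_int q" "real_of_int (k mod q) / real_of_int q \<le> 1" by auto
  then show ?thesis unfolding carry_def by (cases "n mod q < k mod q") auto
qed

lemma sum_of_bool_mod:
  assumes "q > 0"
  shows "(\<Sum>n=0..<q. of_bool (n mod q < k mod q) :: real) = real_of_int (k mod q)"
proof -
  have m: "0 \<le> k mod q" "k mod q < q" using assms by auto
  have "(\<Sum>n=0..<q. of_bool (n mod q < k mod q) :: real) = (\<Sum>n=0..<k mod q. 1)"
    using m by (intro sum.mono_neutral_cong_right) auto
  also have "\<dots> = real_of_int (k mod q)" using m by simp
  finally show ?thesis .
qed

lemma sum_carry:
  assumes "q > 0"
  shows "(\<Sum>n=0..<q. carry k q n) = 0"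
  unfolding carry_def sum_subtractf sum_of_bool_mod [OF assms] using assms by simp

text \<open>Only \<open>k mod q \<le> k\<close> residues have a carry, and the centring adds the
  same amount in total; hence a bound independent of \<open>q\<close>.\<close>

lemma sum_abs_carry_le:
  assumes "q > 0" "k \<ge> 0"
  shows "(\<Sum>n=0..<q. \<bar>carry k q n\<bar>) \<le> 2 * real_of_int k"
proof -
  have m: "0 \<le> k mod q" "k mod q \<le> k" using assms by (auto simp: zmod_le_nonneg_dividend)
  have "(\<Sum>n=0..<q. \<bar>carry k q n\<bar>) \<le> (\<Sum>n=0..<q. of_bool (n mod q < k mod q) + real_of_int (k mod q) / real_of_int q)"
    using m assms by (intro sum_mono) (auto simp: carry_def abs_if)
  also have "\<dots> = 2 * real_of_int (k mod q)"
    unfolding sum.distrib sum_of_bool_mod [OF assms(1)] using assms by simp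
  also have "\<dots> \<le> 2 * real_of_int k" using m by simp
  finally show ?thesis .
qed

lemma sum_carry_squared:
  assumes "q > 0"
  shows "(\<Sum>n=0..<q. (carry k q n)\<^sup>2) = real_of_int q * (alpha q k * (1 - alpha q k))"
proof -
  define r where "r = alpha q k"
  have "(carry k q n)\<^sup>2 = (1 - 2 * r) * of_bool (n mod q < k mod q) + r\<^sup>2" for n
    by (auto simp: carry_def r_def alpha_def power2_eq_square algebra_simps)
  then have "(\<Sum>n=0..<q. (carry k q n)\<^sup>2) = (1 - 2 * r) * real_of_int (k mod q) + real_of_int q * r\<^sup>2"
    using sum_of_bool_mod [OF assms, of k] assms by (simp add: sum.distrib sum_distrib_left [symmetric])
  also have "real_of_int (k mod q) = real_of_int q * r" using assms by (simp add: r_def alpha_def)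
  finally show ?thesis by (simp add: r_def [symmetric] power2_eq_square algebra_simps)
qed

section \<open>Moments and characteristic functions of the prime part\<close>

text \<open>Generic in the field, so that real moments and complex characteristic functions share
  the same algebra.\<close>

definition avg :: "int set \<Rightarrow> (int \<Rightarrow> 'a) \<Rightarrow> 'a :: real_normed_field" where
  "avg S f = (\<Sum>n\<in>S. f n) / of_nat (card S)"

lemma avg_add: "avg S (\<lambda>n. f n + g n) = avg S f + avg S g"
  by (simp add: avg_def sum.distrib add_divide_distrib)

lemma avg_diff: "avg S (\<lambda>n. f n - g n) = avg S f - avg S g"
  by (simp add: avg_def sum_subtractf diff_divide_distrib)

lemma avg_cmult: "avg S (\<lambda>n. c * f n) = c * avg S f"
  by (simp add: avg_def sum_distrib_left [symmetric])

lemma avg_sum: "avg S (\<lambda>n. \<Sum>i\<in>A. f i n) = (\<Sum>i\<in>A. avg S (f i))"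
  unfolding avg_def sum_divide_distrib [symmetric] by (subst sum.swap) simp

lemma avg_const: "finite S \<Longrightarrow> S \<noteq> {} \<Longrightarrow> avg S (\<lambda>_. c) = c"
  by (simp add: avg_def)

lemma avg_mono: "(\<And>n. n \<in> S \<Longrightarrow> f n \<le> (g n :: real)) \<Longrightarrow> avg S f \<le> avg S g"
  by (simp add: avg_def divide_right_mono sum_mono)

lemma avg_nonneg: "(\<And>n. n \<in> S \<Longrightarrow> (0::real) \<le> f n) \<Longrightarrow> 0 \<le> avg S f"
  by (simp add: avg_def sum_nonneg)

lemma norm_avg_le: "norm (avg S f) \<le> avg S (\<lambda>n. norm (f n))"
  by (simp add: avg_def norm_divide divide_right_mono norm_sum)

lemma abs_avg_le: "\<bar>avg S f\<bar> \<le> avg S (\<lambda>n. \<bar>f n :: real\<bar>)"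
  using norm_avg_le [of S f] by simp

lemma of_real_avg: "of_real (avg S f) = avg S (\<lambda>n. of_real (f n))"
  by (simp add: avg_def)

lemma avg_periodic_multiple:
  fixes f :: "int \<Rightarrow> real"
  assumes "q > 0" "periodic q f" "q dvd Q" "Q > 0"
  shows "avg {0..<Q} f = avg {0..<q} f"
proof -
  obtain m where m: "Q = q * m" using assms(3) by (elim dvdE)
  have mpos: "m > 0" using m assms(1,4) by (simp add: zero_less_mult_iff)
  have "(\<Sum>n=0..<Q. f n) = real (nat m) * (\<Sum>n=0..<q. f n)"
    using sum_period_blocks [OF assms(1,2), of 0 "nat m"] mpos by (simp add: m mult.commute)
  then show ?thesis using mpos assms(1) by (simp add: avg_def m nat_mult_distrib)
qed

lemma avg_interval_periodic:
  fixes f :: "int \<Rightarrow> real"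
  assumes q: "q > 0" "periodic q f" and N: "N > 0"
  shows "\<bar>avg {a..<a + N} f - avg {0..<q} f\<bar> \<le> 2 * (\<Sum>n=0..<q. \<bar>f n\<bar>) / real_of_int N"
proof -
  have "avg {a..<a + N} f - avg {0..<q} f =
      ((\<Sum>n=a..<a + N. f n) - real_of_int N / real_of_int q * (\<Sum>n=0..<q. f n)) / real_of_int N"
    using q N by (simp add: avg_def diff_divide_distrib)
  also have "\<bar>\<dots>\<bar> \<le> 2 * (\<Sum>n=0..<q. \<bar>f n\<bar>) / real_of_int N"
    using N sum_interval_periodic [OF q, of N a] by (simp add: abs_divide divide_right_mono)
  finally show ?thesis .
qed

text \<open>For \<open>x = - y\<close> negative, the claim reads
  \<open>1 \<le> (1 - y + y^2) exp y\<close>, which follows from the quadratic Taylor lower bound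
  for \<open>exp y\<close>.\<close>

lemma exp_le_quadratic:
  fixes x :: real
  assumes "x \<le> 1"
  shows "exp x \<le> 1 + x + x\<^sup>2"
proof (cases "x \<ge> 0")
  case True
  then show ?thesis using assms exp_bound by blast
next
  case False
  define y where "y = - x"
  have y: "y > 0" using False by (simp add: y_def)
  have "1 \<le> (1 - y + y\<^sup>2) * (1 + y + y\<^sup>2 / 2)"
  proof -
    have "(1 - y + y\<^sup>2) * (1 + y + y\<^sup>2 / 2) = 1 + y\<^sup>2 / 2 + y ^ 3 / 2 + y ^ 4 / 2"
      by (simp add: field_simps power2_eq_square power3_eq_cube power4_eq_xxxx)
    then show ?thesis using y by simp
  qed
  also have "\<dots> \<le> (1 - y + y\<^sup>2) * exp y"
  proof (rule mult_left_mono)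
    have "1 - y + y\<^sup>2 = (1 - y / 2)\<^sup>2 + 3 / 4 * y\<^sup>2" by (simp add: power2_eq_square field_simps)
    then show "0 \<le> 1 - y + y\<^sup>2" by simp
    show "1 + y + y\<^sup>2 / 2 \<le> exp y" using exp_lower_Taylor_quadratic [of y] y by simp
  qed
  finally have "exp (- y) \<le> 1 - y + y\<^sup>2" by (simp add: exp_minus field_simps)
  then show ?thesis by (simp add: y_def)
qed

lemma power_fact_le_exp:
  fixes x :: real
  assumes "x \<ge> 0"
  shows "x ^ n / fact n \<le> exp x"
proof -
  have "(\<Sum>i\<in>{n}. x ^ i / fact i) \<le> (\<Sum>i. x ^ i / fact i)"
    using assms summable_exp [of x] by (intro sum_le_suminf) (auto simp: divide_inverse mult.commute)
  also have "\<dots> = exp x" by (simp add: exp_def divide_inverse mult.commute)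
  finally show ?thesis by simp
qed

lemma even_power_fact_le:
  fixes x :: real
  shows "x ^ (2 * r) / fact (2 * r) \<le> exp x + exp (- x)"
proof (cases "x \<ge> 0")
  case True
  then show ?thesis using power_fact_le_exp [of x "2 * r"] by (simp add: add_increasing2)
next
  case False
  then show ?thesis using power_fact_le_exp [of "- x" "2 * r"] by (simp add: add_increasing)
qed

text \<open>Weights on the primes, normalised so that the weighted sum of carries has variance
  \<open>1\<close> in the independent model. The instance of interest has weights
  \<open>ln p / sqrt (V k)\<close>.\<close>

locale carry_sum =
  fixes k a N :: int and c :: "int \<Rightarrow> real"
  assumes k: "k \<ge> 2" and N: "N > 0" and c: "\<And>p. c p \<ge> 0"
    and var: "(\<Sum>p\<in>primes_upto k. (c p)\<^sup>2 * (alpha p k * (1 - alpha p k))) = 1"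
begin

abbreviation "P \<equiv> primes_upto k"
abbreviation "Q \<equiv> \<Prod>P"
abbreviation "I \<equiv> {a..<a + N}"

definition s :: "int \<Rightarrow> real" where "s n = (\<Sum>p\<in>P. c p * carry k p n)"
definition C :: real where "C = (\<Sum>p\<in>P. c p)"

lemma finP: "finite P" by (rule finite_primes_upto)
lemma P: "p \<in> P \<Longrightarrow> prime p" "p \<in> P \<Longrightarrow> p > 0" "p \<in> P \<Longrightarrow> p \<le> k"
  by (auto simp: primes_upto_def prime_gt_0_int)
lemma Qpos: "Q > 0" by (intro prod_pos) (auto intro: P)
lemma dvdQ: "p \<in> P \<Longrightarrow> p dvd Q" using finP by (auto intro: dvd_prodI)
lemma C0: "C \<ge> 0" unfolding C_def by (intro sum_nonneg c)

lemma avg_diff_periodic: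
  assumes "q > 0" "q dvd Q" "periodic q G" "\<And>n. \<bar>G n\<bar> \<le> 1"
  shows "\<bar>avg I G - avg {0..<Q} G\<bar> \<le> 2 * real_of_int q / real_of_int N"
proof -
  have "\<bar>avg I G - avg {0..<q} G\<bar> \<le> 2 * (\<Sum>n=0..<q. \<bar>G n\<bar>) / real_of_int N"
    by (rule avg_interval_periodic [OF assms(1,3) N])
  also have "\<dots> \<le> 2 * real_of_int q / real_of_int N"
  proof -
    have "(\<Sum>n=0..<q. \<bar>G n\<bar>) \<le> (\<Sum>n=0..<q. 1)" by (intro sum_mono assms)
    also have "\<dots> = real_of_int q" using assms by simp
    finally show ?thesis using N by (intro divide_right_mono mult_left_mono) auto
  qed
  finally show ?thesis unfolding avg_periodic_multiple [OF assms(1,3,2) Qpos] .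
qed

text \<open>The factor \<open>G\<close> of period \<open>q\<close> collects the summands already split off from the power of \<open>s\<close>.\<close>

lemma moment_compare_aux:
  assumes "q > 0" "q dvd Q" "periodic q G" "\<And>n. \<bar>G n\<bar> \<le> 1"
  shows "\<bar>avg I (\<lambda>n. s n ^ j * G n) - avg {0..<Q} (\<lambda>n. s n ^ j * G n)\<bar>
     \<le> C ^ j * real_of_int k ^ j * (2 * real_of_int q / real_of_int N)"
  using assms
proof (induction j arbitrary: q G)
  case 0
  then show ?case using avg_diff_periodic [of q G] by simp
next
  case (Suc j)
  have eq: "avg S (\<lambda>n. s n ^ Suc j * G n) = (\<Sum>p\<in>P. c p * avg S (\<lambda>n. s n ^ j * (carry k p n * G n)))" for S
  proof -
    have "(\<lambda>n. s n ^ Suc j * G n) = (\<lambda>n. \<Sum>p\<in>P. c p * (s n ^ j * (carry k p n * G n)))"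
      unfolding power_Suc by (subst s_def) (simp add: sum_distrib_right sum_distrib_left mult_ac)
    then show ?thesis by (simp only: avg_sum avg_cmult)
  qed
  have "\<bar>avg I (\<lambda>n. s n ^ Suc j * G n) - avg {0..<Q} (\<lambda>n. s n ^ Suc j * G n)\<bar> =
     \<bar>\<Sum>p\<in>P. c p * (avg I (\<lambda>n. s n ^ j * (carry k p n * G n)) - avg {0..<Q} (\<lambda>n. s n ^ j * (carry k p n * G n)))\<bar>"
    unfolding eq by (simp add: sum_subtractf right_diff_distrib)
  also have "\<dots> \<le> (\<Sum>p\<in>P. \<bar>c p * (avg I (\<lambda>n. s n ^ j * (carry k p n * G n)) - avg {0..<Q} (\<lambda>n. s n ^ j * (carry k p n * G n)))\<bar>)"
    by (rule sum_abs)
  also have "\<dots> \<le> (\<Sum>p\<in>P. c p * (C ^ j * real_of_int k ^ j * (2 * real_of_int (k * q) / real_of_int N)))"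
  proof (rule sum_mono)
    fix p assume p: "p \<in> P"
    \<comment> \<open>The prime \<open>p\<close> may already divide \<open>q\<close>, so the new
      period is the least common multiple; this keeps it a divisor of \<open>Q\<close>, and it is
      still at most \<open>k * q\<close>.\<close>
    have l: "lcm p q > 0" using P(2) [OF p] Suc.prems(1) by (simp add: lcm_pos_int)
    have lk: "lcm p q \<le> k * q"
    proof -
      have "lcm p q \<le> p * q" using P(2) [OF p] Suc.prems(1) by (intro zdvd_imp_le) (auto simp: lcm_least)
      also have "\<dots> \<le> k * q" using P(3) [OF p] Suc.prems(1) by (intro mult_right_mono) auto
      finally show ?thesis .
    qed
    have "\<bar>avg I (\<lambda>n. s n ^ j * (carry k p n * G n)) - avg {0..<Q} (\<lambda>n. s n ^ j * (carry k p n * G n))\<bar>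
      \<le> C ^ j * real_of_int k ^ j * (2 * real_of_int (lcm p q) / real_of_int N)"
    proof (rule Suc.IH [OF l])
      show "lcm p q dvd Q" using dvdQ [OF p] Suc.prems(2) by (rule lcm_least)
      show "periodic (lcm p q) (\<lambda>n. carry k p n * G n)"
        by (intro periodic_mult periodic_dvd [OF periodic_carry [OF P(2) [OF p]]] periodic_dvd [OF Suc.prems(3)]) auto
      show "\<bar>carry k p n * G n\<bar> \<le> 1" for n
        using mult_mono [OF abs_carry_le [OF P(2) [OF p], of k n] Suc.prems(4) [of n]] by (simp add: abs_mult)
    qed
    also have "\<dots> \<le> C ^ j * real_of_int k ^ j * (2 * real_of_int (k * q) / real_of_int N)"
      using lk [folded of_int_le_iff [where 'a = real]] N k C0
      by (intro mult_left_mono divide_right_mono mult_nonneg_nonneg zero_le_power) (auto simp del: of_int_mult)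
    finally show "\<bar>c p * (avg I (\<lambda>n. s n ^ j * (carry k p n * G n)) - avg {0..<Q} (\<lambda>n. s n ^ j * (carry k p n * G n)))\<bar>
      \<le> c p * (C ^ j * real_of_int k ^ j * (2 * real_of_int (k * q) / real_of_int N))"
      unfolding abs_mult using c [of p] by (simp only: abs_of_nonneg) (rule mult_left_mono)
  qed
  also have "\<dots> = C ^ Suc j * real_of_int k ^ Suc j * (2 * real_of_int q / real_of_int N)"
    unfolding sum_distrib_right [symmetric] C_def [symmetric] by simp
  finally show ?case .
qed

definition err :: "nat \<Rightarrow> real" where
  "err j = C ^ j * real_of_int k ^ j * (2 / real_of_int N)"

lemma moment_compare: "\<bar>avg I (\<lambda>n. s n ^ j) - avg {0..<Q} (\<lambda>n. s n ^ j)\<bar> \<le> err j"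
  using moment_compare_aux [of 1 "\<lambda>_. 1" j] by (simp add: periodic_def err_def)

section \<open>The independent model: averages over a full period \<open>Q\<close>\<close>

lemma avgQ_prod:
  fixes h :: "int \<Rightarrow> int \<Rightarrow> 'a :: real_normed_field"
  assumes "\<And>p. p \<in> P \<Longrightarrow> periodic p (h p)"
  shows "avg {0..<Q} (\<lambda>n. \<Prod>p\<in>P. h p n) = (\<Prod>p\<in>P. avg {0..<p} (h p))"
proof -
  have "(\<Prod>p\<in>P. of_nat (card {0..<p}) :: 'a) = of_nat (card {0..<Q})"
  proof -
    have "(\<Prod>p\<in>P. of_nat (card {0..<p}) :: 'a) = (\<Prod>p\<in>P. of_int p)"
      using P(2) by (intro prod.cong refl) (simp add: less_imp_le)
    also have "\<dots> = of_int Q" by (simp add: of_int_prod)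
    finally show ?thesis using Qpos by simp
  qed
  then show ?thesis
    unfolding avg_def using sum_prod_crt [OF finP P(1) assms] by (simp add: prod_dividef)
qed

lemma avg_carry: "p \<in> P \<Longrightarrow> avg {0..<p} (carry k p) = 0"
  using sum_carry [OF P(2)] by (simp add: avg_def)

lemma avg_carry_squared: "p \<in> P \<Longrightarrow> avg {0..<p} (\<lambda>n. (carry k p n)\<^sup>2) = alpha p k * (1 - alpha p k)"
  using sum_carry_squared [OF P(2), of p k] P(2) [of p] by (simp add: avg_def)

lemma alpha_bounds: "p \<in> P \<Longrightarrow> 0 \<le> alpha p k" "p \<in> P \<Longrightarrow> alpha p k \<le> 1"
  using P(2) [of p] pos_mod_bound [of p k] by (auto simp: alpha_def divide_simps less_imp_le)

lemma v_bounds: "p \<in> P \<Longrightarrow> 0 \<le> alpha p k * (1 - alpha p k)" "p \<in> P \<Longrightarrow> alpha p k * (1 - alpha p k) \<le> 1"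
  using alpha_bounds [of p] by (auto intro!: mult_le_one)

lemma avgQ_s: "avg {0..<Q} s = 0"
proof -
  have "avg {0..<Q} s = (\<Sum>p\<in>P. c p * avg {0..<Q} (carry k p))"
    unfolding s_def avg_sum avg_cmult ..
  also have "\<dots> = 0"
    by (intro sum.neutral ballI) (simp add: avg_periodic_multiple [OF P(2) periodic_carry [OF P(2)] dvdQ Qpos] avg_carry)
  finally show ?thesis .
qed

lemma avgQ_carry_mult:
  assumes "p \<in> P" "p' \<in> P" "p \<noteq> p'"
  shows "avg {0..<Q} (\<lambda>n. carry k p n * carry k p' n) = 0"
proof -
  have cop: "coprime p p'" using assms P(1) by (intro primes_coprime) auto
  have per: "periodic (p * p') (\<lambda>n. carry k p n * carry k p' n)"
    by (intro periodic_mult periodic_dvd [OF periodic_carry [OF P(2) [OF assms(1)]]] periodic_dvd [OF periodic_carry [OF P(2) [OF assms(2)]]]) auto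
  have "p * p' dvd Q" using cop dvdQ assms by (intro divides_mult) auto
  then have "avg {0..<Q} (\<lambda>n. carry k p n * carry k p' n) = avg {0..<p * p'} (\<lambda>n. carry k p n * carry k p' n)"
    using P(2) assms by (intro avg_periodic_multiple per Qpos) auto
  also have "(\<Sum>n=0..<p * p'. carry k p n * carry k p' n) = (\<Sum>n=0..<p. carry k p n) * (\<Sum>n=0..<p'. carry k p' n)"
    using P(2) assms cop by (intro sum_crt periodic_carry) auto
  then have "avg {0..<p * p'} (\<lambda>n. carry k p n * carry k p' n) = 0"
    using sum_carry [OF P(2) [OF assms(1)]] by (simp add: avg_def)
  finally show ?thesis .
qed

lemma avgQ_s_squared: "avg {0..<Q} (\<lambda>n. (s n)\<^sup>2) = 1"
proof -
  have "(s n)\<^sup>2 = (\<Sum>p\<in>P. \<Sum>p'\<in>P. c p * c p' * (carry k p n * carry k p' n))" for n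
    unfolding s_def power2_eq_square sum_product by (intro sum.cong refl) (simp add: mult_ac)
  then have "avg {0..<Q} (\<lambda>n. (s n)\<^sup>2) = (\<Sum>p\<in>P. \<Sum>p'\<in>P. c p * c p' * avg {0..<Q} (\<lambda>n. carry k p n * carry k p' n))"
    by (simp only: avg_sum avg_cmult)
  also have "\<dots> = (\<Sum>p\<in>P. (c p)\<^sup>2 * (alpha p k * (1 - alpha p k)))"
  proof (rule sum.cong [OF refl])
    fix p assume p: "p \<in> P"
    have "(\<Sum>p'\<in>P. c p * c p' * avg {0..<Q} (\<lambda>n. carry k p n * carry k p' n)) =
      (\<Sum>p'\<in>{p}. c p * c p' * avg {0..<Q} (\<lambda>n. carry k p n * carry k p' n))"
      using p finP avgQ_carry_mult [OF p] by (intro sum.mono_neutral_right) auto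
    also have "\<dots> = (c p)\<^sup>2 * avg {0..<Q} (\<lambda>n. (carry k p n)\<^sup>2)"
      by (simp add: power2_eq_square)
    also have "avg {0..<Q} (\<lambda>n. (carry k p n)\<^sup>2) = avg {0..<p} (\<lambda>n. (carry k p n)\<^sup>2)"
      by (intro avg_periodic_multiple P p Qpos dvdQ periodic_compose [OF periodic_carry])
    also have "\<dots> = alpha p k * (1 - alpha p k)" by (rule avg_carry_squared [OF p])
    finally show "(\<Sum>p'\<in>P. c p * c p' * avg {0..<Q} (\<lambda>n. carry k p n * carry k p' n)) = (c p)\<^sup>2 * (alpha p k * (1 - alpha p k))" .
  qed
  finally show ?thesis using var by simp
qed

text \<open>The exponential average factors over the primes. As the exponents are at most
  \<open>1\<close> in size, the quadratic bound for \<open>exp\<close> applies; the linear terms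
  average to \<open>0\<close> and the quadratic ones sum to \<open>l^2\<close> by the
  normalisation.\<close>

lemma avgQ_exp_le:
  assumes l: "\<And>p. p \<in> P \<Longrightarrow> \<bar>l\<bar> * c p \<le> 1"
  shows "avg {0..<Q} (\<lambda>n. exp (l * s n)) \<le> exp (l\<^sup>2)"
proof -
  have "(\<lambda>n. exp (l * s n)) = (\<lambda>n. \<Prod>p\<in>P. exp (l * c p * carry k p n))"
    using finP by (simp add: s_def sum_distrib_left exp_sum mult.assoc)
  then have "avg {0..<Q} (\<lambda>n. exp (l * s n)) = (\<Prod>p\<in>P. avg {0..<p} (\<lambda>n. exp (l * c p * carry k p n)))"
    by (simp only:) (intro avgQ_prod periodic_compose [OF periodic_carry] P)
  also have "\<dots> \<le> (\<Prod>p\<in>P. exp (l\<^sup>2 * ((c p)\<^sup>2 * (alpha p k * (1 - alpha p k)))))"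
  proof (rule prod_mono, intro conjI)
    fix p assume p: "p \<in> P"
    show "0 \<le> avg {0..<p} (\<lambda>n. exp (l * c p * carry k p n))" by (intro avg_nonneg) simp
    have "avg {0..<p} (\<lambda>n. exp (l * c p * carry k p n)) \<le>
        avg {0..<p} (\<lambda>n. 1 + l * c p * carry k p n + (l * c p)\<^sup>2 * (carry k p n)\<^sup>2)"
    proof (rule avg_mono)
      fix n
      have "\<bar>l * c p * carry k p n\<bar> \<le> 1 * 1"
        unfolding abs_mult [of "l * c p"] using l [OF p] c [of p] abs_carry_le [OF P(2) [OF p], of k n]
        by (intro mult_mono) (auto simp: abs_mult)
      then have "exp (l * c p * carry k p n) \<le> 1 + l * c p * carry k p n + (l * c p * carry k p n)\<^sup>2"
        by (intro exp_le_quadratic) auto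
      then show "exp (l * c p * carry k p n) \<le> 1 + l * c p * carry k p n + (l * c p)\<^sup>2 * (carry k p n)\<^sup>2"
        by (simp add: power_mult_distrib)
    qed
    also have "\<dots> = 1 + (l * c p)\<^sup>2 * (alpha p k * (1 - alpha p k))"
      using P(2) [OF p] by (simp add: avg_add avg_cmult avg_const avg_carry [OF p] avg_carry_squared [OF p])
    also have "\<dots> \<le> exp ((l * c p)\<^sup>2 * (alpha p k * (1 - alpha p k)))" by (rule exp_ge_add_one_self)
    finally show "avg {0..<p} (\<lambda>n. exp (l * c p * carry k p n)) \<le> exp (l\<^sup>2 * ((c p)\<^sup>2 * (alpha p k * (1 - alpha p k))))"
      by (simp add: power_mult_distrib mult.assoc)
  qed
  also have "\<dots> = exp (l\<^sup>2 * 1)"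
    using finP by (simp add: exp_sum [symmetric] sum_distrib_left [symmetric] var)
  finally show ?thesis by simp
qed

text \<open>Even moments are read off from the exponential average. With \<open>l\<close> larger
  than \<open>\<bar>t\<bar>\<close> the bound decays geometrically in \<open>r\<close>, uniformly in
  \<open>k\<close>.\<close>

lemma avgQ_even_moment:
  assumes "l > 0" "\<And>p. p \<in> P \<Longrightarrow> l * c p \<le> 1"
  shows "\<bar>t\<bar> ^ (2 * r) / fact (2 * r) * avg {0..<Q} (\<lambda>n. s n ^ (2 * r)) \<le> (\<bar>t\<bar> / l) ^ (2 * r) * (2 * exp (l\<^sup>2))"
proof -
  have "\<bar>t\<bar> ^ (2 * r) / fact (2 * r) * avg {0..<Q} (\<lambda>n. s n ^ (2 * r)) =
     (\<bar>t\<bar> / l) ^ (2 * r) * avg {0..<Q} (\<lambda>n. (l * s n) ^ (2 * r) / fact (2 * r))"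
    unfolding avg_cmult [symmetric] using assms(1) by (simp add: power_divide power_mult_distrib)
  also have "\<dots> \<le> (\<bar>t\<bar> / l) ^ (2 * r) * avg {0..<Q} (\<lambda>n. exp (l * s n) + exp ((- l) * s n))"
    using assms(1) even_power_fact_le [of "l * _" r] by (intro mult_left_mono avg_mono) auto
  also have "\<dots> \<le> (\<bar>t\<bar> / l) ^ (2 * r) * (2 * exp (l\<^sup>2))"
  proof (rule mult_left_mono)
    have "avg {0..<Q} (\<lambda>n. exp (l * s n)) \<le> exp (l\<^sup>2)" using assms by (intro avgQ_exp_le) auto
    moreover have "avg {0..<Q} (\<lambda>n. exp ((- l) * s n)) \<le> exp ((- l)\<^sup>2)" using assms by (intro avgQ_exp_le) auto
    ultimately show "avg {0..<Q} (\<lambda>n. exp (l * s n) + exp ((- l) * s n)) \<le> 2 * exp (l\<^sup>2)"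
      unfolding avg_add by simp
  qed (use assms(1) in simp)
  finally show ?thesis .
qed

text \<open>The Taylor remainder is dominated by a moment of order \<open>2 * r\<close>, on either
  side. Over the interval this moment is the model moment up to \<open>err (2 * r)\<close>, which
  explains both the last summand of the error sum and the factor \<open>2\<close> before the
  tail.\<close>

lemma char_compare:
  assumes "l > 0" "\<And>p. p \<in> P \<Longrightarrow> l * c p \<le> 1" and r: "r > 0"
  shows "norm (avg I (\<lambda>n. iexp (t * s n)) - avg {0..<Q} (\<lambda>n. iexp (t * s n)))
     \<le> (\<Sum>j\<le>2 * r. \<bar>t\<bar> ^ j / fact j * err j) + 2 * ((\<bar>t\<bar> / l) ^ (2 * r) * (2 * exp (l\<^sup>2)))"
proof -
  \<comment> \<open>The degree is odd so that the remainder is an even power, whose average is a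
    plain moment without absolute values.\<close>
  define T where "T = (\<lambda>x::real. \<Sum>j\<le>2 * r - 1. (\<i> * of_real x) ^ j / fact j)"
  have T: "norm (iexp x - T x) \<le> x ^ (2 * r) / fact (2 * r)" for x
  proof -
    have "norm (iexp x - T x) \<le> \<bar>x\<bar> ^ Suc (2 * r - 1) / fact (Suc (2 * r - 1))"
      unfolding T_def by (rule iexp_approx1)
    also have "Suc (2 * r - 1) = 2 * r" using r by simp
    finally show ?thesis by (simp add: power_even_abs)
  qed
  define M where "M = (\<lambda>S. \<bar>t\<bar> ^ (2 * r) / fact (2 * r) * avg S (\<lambda>n. s n ^ (2 * r)))"
  have tail: "norm (avg S (\<lambda>n. iexp (t * s n)) - avg S (\<lambda>n. T (t * s n))) \<le> M S" for S
  proof -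
    have "norm (avg S (\<lambda>n. iexp (t * s n)) - avg S (\<lambda>n. T (t * s n))) \<le> avg S (\<lambda>n. norm (iexp (t * s n) - T (t * s n)))"
      unfolding avg_diff [symmetric] by (rule norm_avg_le)
    also have "\<dots> \<le> avg S (\<lambda>n. (t * s n) ^ (2 * r) / fact (2 * r))" by (intro avg_mono T)
    also have "\<dots> = M S" unfolding M_def avg_cmult [symmetric]
      by (simp add: power_mult_distrib power_even_abs)
    finally show ?thesis .
  qed
  have Tavg: "avg S (\<lambda>n. T (t * s n)) = (\<Sum>j\<le>2 * r - 1. (\<i> * of_real t) ^ j / fact j * of_real (avg S (\<lambda>n. s n ^ j)))" for S
    unfolding T_def avg_sum of_real_avg avg_cmult [symmetric] by (simp add: power_mult_distrib mult_ac)
  have "norm (avg I (\<lambda>n. T (t * s n)) - avg {0..<Q} (\<lambda>n. T (t * s n))) =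
      norm (\<Sum>j\<le>2 * r - 1. (\<i> * of_real t) ^ j / fact j * of_real (avg I (\<lambda>n. s n ^ j) - avg {0..<Q} (\<lambda>n. s n ^ j)))"
    unfolding Tavg sum_subtractf [symmetric] of_real_diff right_diff_distrib ..
  also have "\<dots> \<le> (\<Sum>j\<le>2 * r - 1. norm ((\<i> * of_real t) ^ j / fact j * of_real (avg I (\<lambda>n. s n ^ j) - avg {0..<Q} (\<lambda>n. s n ^ j))))"
    by (rule norm_sum)
  also have "\<dots> \<le> (\<Sum>j\<le>2 * r - 1. \<bar>t\<bar> ^ j / fact j * err j)"
  proof (rule sum_mono)
    fix j
    have "norm ((\<i> * of_real t) ^ j / fact j * of_real (avg I (\<lambda>n. s n ^ j) - avg {0..<Q} (\<lambda>n. s n ^ j)) :: complex) =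
       \<bar>t\<bar> ^ j / fact j * \<bar>avg I (\<lambda>n. s n ^ j) - avg {0..<Q} (\<lambda>n. s n ^ j)\<bar>"
      unfolding norm_mult norm_divide norm_power by (simp only: norm_of_real norm_fact norm_ii mult_1)
    also have "\<dots> \<le> \<bar>t\<bar> ^ j / fact j * err j" by (intro mult_left_mono moment_compare) auto
    finally show "norm ((\<i> * of_real t) ^ j / fact j * of_real (avg I (\<lambda>n. s n ^ j) - avg {0..<Q} (\<lambda>n. s n ^ j)) :: complex) \<le> \<bar>t\<bar> ^ j / fact j * err j" .
  qed
  finally have main: "norm (avg I (\<lambda>n. T (t * s n)) - avg {0..<Q} (\<lambda>n. T (t * s n))) \<le> (\<Sum>j\<le>2 * r - 1. \<bar>t\<bar> ^ j / fact j * err j)" .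
  have MQ: "M {0..<Q} \<le> (\<bar>t\<bar> / l) ^ (2 * r) * (2 * exp (l\<^sup>2))"
    unfolding M_def by (rule avgQ_even_moment [OF assms(1,2)])
  have "M I - M {0..<Q} \<le> \<bar>t\<bar> ^ (2 * r) / fact (2 * r) * err (2 * r)"
    unfolding M_def right_diff_distrib [symmetric]
    using moment_compare [of "2 * r"] by (intro mult_left_mono) auto
  moreover have "(\<Sum>j\<le>2 * r. \<bar>t\<bar> ^ j / fact j * err j) = (\<Sum>j\<le>2 * r - 1. \<bar>t\<bar> ^ j / fact j * err j) + \<bar>t\<bar> ^ (2 * r) / fact (2 * r) * err (2 * r)"
    using r sum.atMost_Suc [of "\<lambda>j. \<bar>t\<bar> ^ j / fact j * err j" "2 * r - 1"] by simp
  moreover have "norm (avg I (\<lambda>n. iexp (t * s n)) - avg {0..<Q} (\<lambda>n. iexp (t * s n))) \<le>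
     M I + norm (avg I (\<lambda>n. T (t * s n)) - avg {0..<Q} (\<lambda>n. T (t * s n))) + M {0..<Q}"
    using tail [of I] tail [of "{0..<Q}"]
      norm_triangle_ineq [of "avg I (\<lambda>n. iexp (t * s n)) - avg I (\<lambda>n. T (t * s n))" "avg I (\<lambda>n. T (t * s n)) - avg {0..<Q} (\<lambda>n. iexp (t * s n))"]
      norm_triangle_ineq4 [of "avg I (\<lambda>n. T (t * s n)) - avg {0..<Q} (\<lambda>n. T (t * s n))" "avg {0..<Q} (\<lambda>n. iexp (t * s n)) - avg {0..<Q} (\<lambda>n. T (t * s n))"]
    by simp
  ultimately show ?thesis using main MQ by linarith
qed

text \<open>Factors are replaced one at a time by Gaussian ones; as all have norm at most
  \<open>1\<close>, the differences simply add. Each is of third order, and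
  \<open>c^3 \<le> cm * c^2\<close> lets the normalisation absorb the sum over primes. The term with
  \<open>cm^2\<close> comes from replacing \<open>1 - y\<close> by \<open>exp (- y)\<close>.\<close>

lemma char_limit:
  assumes cm: "\<And>p. p \<in> P \<Longrightarrow> c p \<le> cm"
  shows "norm (avg {0..<Q} (\<lambda>n. iexp (t * s n)) - of_real (exp (- t\<^sup>2 / 2))) \<le> \<bar>t\<bar> ^ 3 * cm / 6 + t ^ 4 * cm\<^sup>2 / 4"
proof -
  define v where "v = (\<lambda>p. (c p)\<^sup>2 * (alpha p k * (1 - alpha p k)))"
  define z where "z = (\<lambda>p. avg {0..<p} (\<lambda>n. iexp (t * c p * carry k p n)))"
  define y where "y = (\<lambda>p. t\<^sup>2 * v p / 2)"
  have v0: "v p \<ge> 0" if "p \<in> P" for p unfolding v_def by (rule mult_nonneg_nonneg [OF _ v_bounds(1) [OF that]]) simp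
  have "(\<lambda>n. iexp (t * s n)) = (\<lambda>n. \<Prod>p\<in>P. iexp (t * c p * carry k p n))"
    using finP by (simp add: s_def sum_distrib_left exp_sum mult.assoc)
  then have 1: "avg {0..<Q} (\<lambda>n. iexp (t * s n)) = (\<Prod>p\<in>P. z p)"
    unfolding z_def by (simp only:) (intro avgQ_prod periodic_compose [OF periodic_carry] P)
  have "(\<Prod>p\<in>P. exp (- y p)) = exp (- (\<Sum>p\<in>P. y p))"
    using finP by (simp add: exp_sum sum_negf [symmetric])
  also have "(\<Sum>p\<in>P. y p) = t\<^sup>2 / 2" unfolding y_def v_def
    by (simp add: sum_divide_distrib [symmetric] sum_distrib_left [symmetric] var)
  finally have 2: "of_real (exp (- t\<^sup>2 / 2)) = (\<Prod>p\<in>P. complex_of_real (exp (- y p)))"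
    by (simp add: of_real_prod [symmetric] del: of_real_exp)
  have "norm (z p - of_real (exp (- y p))) \<le> (\<bar>t\<bar> ^ 3 * cm / 6 + t ^ 4 * cm\<^sup>2 / 4) * v p" if p: "p \<in> P" for p
  proof -
    have cp: "0 \<le> c p" "c p \<le> cm" using c cm p by auto
    have "norm (z p - of_real (1 - y p)) \<le> \<bar>t\<bar> ^ 3 * cm / 6 * v p"
    proof -
      define T where "T = (\<lambda>x::real. \<Sum>j\<le>2. (\<i> * of_real x) ^ j / fact j)"
      have Teq: "T x = 1 + \<i> * of_real x - of_real (x\<^sup>2 / 2)" for x
      proof -
        have "\<i> * complex_of_real x * (\<i> * complex_of_real x) = - (complex_of_real x * complex_of_real x)"
          by (simp add: complex_eq_iff)
        then show ?thesis by (simp add: T_def numeral_2_eq_2 power2_eq_square)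
      qed
      have "avg {0..<p} (\<lambda>n. T (t * c p * carry k p n)) = of_real (1 - y p)"
      proof -
        have "avg {0..<p} (\<lambda>n. T (t * c p * carry k p n)) =
          avg {0..<p} (\<lambda>n. 1 + \<i> * of_real (t * c p) * of_real (carry k p n) - of_real ((t * c p)\<^sup>2 / 2) * of_real ((carry k p n)\<^sup>2))"
          unfolding Teq by (simp add: power_mult_distrib mult_ac)
        also have "\<dots> = 1 + \<i> * of_real (t * c p) * of_real (avg {0..<p} (carry k p)) - of_real ((t * c p)\<^sup>2 / 2) * of_real (avg {0..<p} (\<lambda>n. (carry k p n)\<^sup>2))"
          unfolding of_real_avg using P(2) [OF p] by (simp only: avg_diff avg_add avg_cmult) (simp add: avg_const)
        finally show ?thesis unfolding avg_carry [OF p] avg_carry_squared [OF p]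
          by (simp add: y_def v_def power_mult_distrib mult_ac)
      qed
      then have "norm (z p - of_real (1 - y p)) \<le> avg {0..<p} (\<lambda>n. norm (iexp (t * c p * carry k p n) - T (t * c p * carry k p n)))"
        unfolding z_def using norm_avg_le [of "{0..<p}" "\<lambda>n. iexp (t * c p * carry k p n) - T (t * c p * carry k p n)"]
        by (simp only: avg_diff)
      also have "\<dots> \<le> avg {0..<p} (\<lambda>n. \<bar>t\<bar> ^ 3 * cm / 6 * (c p)\<^sup>2 * (carry k p n)\<^sup>2)"
      proof (rule avg_mono)
        fix n
        have "norm (iexp (t * c p * carry k p n) - T (t * c p * carry k p n)) \<le> \<bar>t * c p * carry k p n\<bar> ^ Suc 2 / fact (Suc 2)"
          unfolding T_def by (rule iexp_approx1)
        also have "\<dots> = \<bar>t\<bar> ^ 3 / 6 * (c p)\<^sup>2 * (carry k p n)\<^sup>2 * (c p * \<bar>carry k p n\<bar>)"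
        proof -
          have e: "\<bar>t * c p * carry k p n\<bar> = \<bar>t\<bar> * c p * \<bar>carry k p n\<bar>" using cp by (simp add: abs_mult)
          have f: "fact (Suc 2) = (6::real)" by (simp add: eval_nat_numeral)
          have g: "(carry k p n)\<^sup>2 = \<bar>carry k p n\<bar>\<^sup>2" by simp
          have h: "(x * c p * y) ^ Suc 2 / 6 = x ^ 3 / 6 * (c p)\<^sup>2 * y\<^sup>2 * (c p * y)" for x y :: real
            by (simp add: power2_eq_square eval_nat_numeral)
          show ?thesis unfolding e f g by (rule h)
        qed
        also have "\<dots> \<le> \<bar>t\<bar> ^ 3 / 6 * (c p)\<^sup>2 * (carry k p n)\<^sup>2 * (cm * 1)"
          using cp abs_carry_le [OF P(2) [OF p], of k n] by (intro mult_left_mono mult_mono) auto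
        finally show "norm (iexp (t * c p * carry k p n) - T (t * c p * carry k p n)) \<le> \<bar>t\<bar> ^ 3 * cm / 6 * (c p)\<^sup>2 * (carry k p n)\<^sup>2"
          by (simp add: mult_ac)
      qed
      also have "\<dots> = \<bar>t\<bar> ^ 3 * cm / 6 * v p" unfolding avg_cmult avg_carry_squared [OF p] v_def by simp
      finally show ?thesis .
    qed
    moreover have "norm (complex_of_real (1 - y p) - of_real (exp (- y p))) \<le> t ^ 4 * cm\<^sup>2 / 4 * v p"
    proof -
      have y0: "y p \<ge> 0" using v0 [OF p] by (simp add: y_def)
      have "exp (- y p) \<le> 1 + (- y p) + (- y p)\<^sup>2" using y0 by (intro exp_le_quadratic) auto
      moreover have "1 + (- y p) \<le> exp (- y p)" by (rule exp_ge_add_one_self)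
      ultimately have "\<bar>(1 - y p) - exp (- y p)\<bar> \<le> (y p)\<^sup>2" by simp
      also have "(y p)\<^sup>2 = t ^ 4 / 4 * v p * v p"
        by (simp add: y_def power2_eq_square power4_eq_xxxx)
      also have "\<dots> \<le> t ^ 4 / 4 * v p * cm\<^sup>2"
      proof (rule mult_left_mono)
        have "v p \<le> (c p)\<^sup>2 * 1" unfolding v_def by (rule mult_left_mono [OF v_bounds(2) [OF p]]) simp
        also have "\<dots> \<le> cm\<^sup>2" using cp by (simp add: power_mono)
        finally show "v p \<le> cm\<^sup>2" .
      qed (use v0 [OF p] in simp)
      finally have "\<bar>(1 - y p) - exp (- y p)\<bar> \<le> t ^ 4 * cm\<^sup>2 / 4 * v p" by (simp add: mult_ac)
      then show ?thesis unfolding of_real_diff [symmetric] norm_of_real .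
    qed
    ultimately show ?thesis
      using norm_triangle_ineq [of "z p - of_real (1 - y p)" "of_real (1 - y p) - of_real (exp (- y p))"]
      by (simp add: distrib_right)
  qed
  then have "(\<Sum>p\<in>P. norm (z p - of_real (exp (- y p)))) \<le> (\<Sum>p\<in>P. (\<bar>t\<bar> ^ 3 * cm / 6 + t ^ 4 * cm\<^sup>2 / 4) * v p)"
    by (rule sum_mono)
  also have "\<dots> = \<bar>t\<bar> ^ 3 * cm / 6 + t ^ 4 * cm\<^sup>2 / 4"
    unfolding sum_distrib_left [symmetric] v_def var by simp
  finally have "(\<Sum>p\<in>P. norm (z p - of_real (exp (- y p)))) \<le> \<bar>t\<bar> ^ 3 * cm / 6 + t ^ 4 * cm\<^sup>2 / 4" .
  moreover have "norm ((\<Prod>p\<in>P. z p) - (\<Prod>p\<in>P. complex_of_real (exp (- y p)))) \<le> (\<Sum>p\<in>P. norm (z p - of_real (exp (- y p))))"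
  proof (rule norm_prod_diff)
    fix p assume p: "p \<in> P"
    have "norm (z p) \<le> avg {0..<p} (\<lambda>n. norm (iexp (t * c p * carry k p n)))" unfolding z_def by (rule norm_avg_le)
    also have "\<dots> = 1" using P(2) [OF p] by (simp add: avg_const)
    finally show "norm (z p) \<le> 1" .
    show "norm (complex_of_real (exp (- y p))) \<le> 1" using v0 [OF p] by (simp add: y_def)
  qed
  ultimately show ?thesis unfolding 1 2 by linarith
qed

end

section \<open>Higher prime powers\<close>

definition higher_part :: "int \<Rightarrow> nat \<Rightarrow> int \<Rightarrow> real" where
  "higher_part k L n = (\<Sum>p\<in>primes_upto k. ln (real_of_int p) * (\<Sum>a=2..L. carry k (p ^ a) n))"

abbreviation mean_tail_series :: "int \<Rightarrow> nat \<Rightarrow> int \<Rightarrow> real" where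
  "mean_tail_series k L p \<equiv> (\<Sum>j. real_of_int (k mod p ^ Suc (j + L)) / real_of_int (p ^ Suc (j + L)))"

text \<open>In \<open>mean_const\<close> the sum over exponents is infinite, whereas carries of
  \<open>n\<close> stop at \<open>L\<close>; this is the unmatched remainder of the
  centring.\<close>

definition mean_tail :: "int \<Rightarrow> nat \<Rightarrow> real" where
  "mean_tail k L = (\<Sum>p\<in>primes_upto k. ln (real_of_int p) * mean_tail_series k L p)"

lemma U_decomposition:
  assumes k: "0 \<le> k" "k \<le> n" and L: "n < 2 ^ L" "L \<ge> 1"
  shows "U k n - mean_const k = (\<Sum>p\<in>primes_upto k. ln (real_of_int p) * carry k p n) + higher_part k L n - mean_tail k L"
proof -
  have P: "prime p" "p \<ge> 2" if "p \<in> primes_upto k" for p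
    using that by (auto simp: primes_upto_def prime_ge_2_int)
  have "n < p ^ L" if "p \<in> primes_upto k" for p
    using L(1) power_mono [of 2 p L] P(2) [OF that] by linarith
  then have U: "U k n = (\<Sum>p\<in>primes_upto k. ln (real_of_int p) * (\<Sum>a=1..L. of_bool (n mod p ^ a < k mod p ^ a)))"
    by (intro U_eq k)
  have "U k n - mean_const k = (\<Sum>p\<in>primes_upto k. ln (real_of_int p) * ((\<Sum>a=1..L. of_bool (n mod p ^ a < k mod p ^ a))
     - (\<Sum>j. real_of_int (k mod p ^ Suc j) / real_of_int (p ^ Suc j))))"
    unfolding U mean_const_def by (simp add: sum_subtractf right_diff_distrib del: power_Suc)
  also have "\<dots> = (\<Sum>p\<in>primes_upto k. ln (real_of_int p) * carry k p n + ln (real_of_int p) * (\<Sum>a=2..L. carry k (p ^ a) n)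
     - ln (real_of_int p) * mean_tail_series k L p)"
  proof (rule sum.cong [OF refl])
    fix p assume p: "p \<in> primes_upto k"
    define g where "g = (\<lambda>a. real_of_int (k mod p ^ a) / real_of_int (p ^ a))"
    have "summable (\<lambda>j. g (Suc j))"
      unfolding g_def by (rule summable_mean_const [OF P(1) [OF p] k(1)])
    then have "(\<Sum>j. g (Suc j)) = (\<Sum>j. g (Suc (j + L))) + (\<Sum>j<L. g (Suc j))"
      by (rule suminf_split_initial_segment)
    also have "(\<Sum>j<L. g (Suc j)) = (\<Sum>a=1..L. g a)"
      by (rule sum.reindex_bij_witness [of _ "\<lambda>a. a - 1" Suc]) auto
    finally have g: "(\<Sum>j. g (Suc j)) = (\<Sum>j. g (Suc (j + L))) + (\<Sum>a=1..L. g a)" .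
    have "(\<Sum>a=1..L. of_bool (n mod p ^ a < k mod p ^ a)) - (\<Sum>a=1..L. g a) = (\<Sum>a=1..L. carry k (p ^ a) n)"
      by (simp add: carry_def g_def sum_subtractf)
    also have "\<dots> = carry k p n + (\<Sum>a=2..L. carry k (p ^ a) n)"
    proof -
      have "{1..L} = insert 1 {2..L}" using L(2) by auto
      then show ?thesis by simp
    qed
    finally have h: "(\<Sum>a=1..L. of_bool (n mod p ^ a < k mod p ^ a)) - (\<Sum>a=1..L. g a) = carry k p n + (\<Sum>a=2..L. carry k (p ^ a) n)" .
    then have "(\<Sum>a=1..L. of_bool (n mod p ^ a < k mod p ^ a)) - (\<Sum>j. g (Suc j)) = carry k p n + (\<Sum>a=2..L. carry k (p ^ a) n) - (\<Sum>j. g (Suc (j + L)))"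
      unfolding g by linarith
    then show "ln (real_of_int p) * ((\<Sum>a=1..L. of_bool (n mod p ^ a < k mod p ^ a)) - (\<Sum>j. real_of_int (k mod p ^ Suc j) / real_of_int (p ^ Suc j))) =
      ln (real_of_int p) * carry k p n + ln (real_of_int p) * (\<Sum>a=2..L. carry k (p ^ a) n)
     - ln (real_of_int p) * mean_tail_series k L p"
      unfolding g_def by (simp only: distrib_left right_diff_distrib)
  qed
  finally show ?thesis
    by (simp add: sum.distrib sum_subtractf higher_part_def mean_tail_def)
qed

lemma card_primes_upto_le: "real (card (primes_upto k)) \<le> real_of_int k" if "k \<ge> 0"
proof -
  have "primes_upto k \<subseteq> {1..k}" by (auto simp: primes_upto_def dest: prime_gt_0_int)
  then have "card (primes_upto k) \<le> card {1..k}" by (intro card_mono) auto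
  then show ?thesis using that by simp
qed

lemma ln_prime_bounds: "p \<in> primes_upto k \<Longrightarrow> 0 \<le> ln (real_of_int p)" "p \<in> primes_upto k \<Longrightarrow> ln (real_of_int p) \<le> real_of_int k"
proof -
  assume "p \<in> primes_upto k"
  then have p: "p \<ge> 2" "p \<le> k" by (auto simp: primes_upto_def prime_ge_2_int)
  then show "0 \<le> ln (real_of_int p)" by simp
  have "ln (real_of_int p) \<le> real_of_int p - 1" using p by (intro ln_le_minus_one) simp
  then show "ln (real_of_int p) \<le> real_of_int k" using p by simp
qed

text \<open>A geometric tail \<open>k / 2^L\<close> for each of at most \<open>k\<close> primes,
  with \<open>ln p \<le> k\<close>. The crude cube is harmless because \<open>2^L\<close> will be at
  least \<open>2 X\<close>.\<close>

lemma mean_tail_bounds: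
  assumes k: "k \<ge> 2"
  shows "0 \<le> mean_tail k L" "mean_tail k L \<le> real_of_int k ^ 3 / 2 ^ L"
proof -
  have P: "prime p" "p \<ge> 2" if "p \<in> primes_upto k" for p
    using that by (auto simp: primes_upto_def prime_ge_2_int)
  have tail: "0 \<le> mean_tail_series k L p \<and>
     mean_tail_series k L p \<le> real_of_int k / 2 ^ L"
    if p: "p \<in> primes_upto k" for p
  proof
    have sm: "summable (\<lambda>j. real_of_int (k mod p ^ Suc (j + L)) / real_of_int (p ^ Suc (j + L)))"
      using summable_ignore_initial_segment [OF summable_mean_const [OF P(1) [OF p], of k], of L] k by simp
    have nn: "0 \<le> real_of_int (k mod p ^ Suc (j + L)) / real_of_int (p ^ Suc (j + L))" for j
      using P(2) [OF p] by (intro divide_nonneg_nonneg) (simp_all del: power_Suc)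
    show "0 \<le> mean_tail_series k L p"
      by (rule suminf_nonneg [OF sm nn])
    have "(\<lambda>j. (1 / 2) ^ Suc j) sums (1::real)" by (rule power_half_series)
    from sums_mult [OF this, of "real_of_int k / 2 ^ L"]
    have gs: "(\<lambda>j. real_of_int k / 2 ^ L * (1 / 2) ^ Suc j) sums (real_of_int k / 2 ^ L)" by simp
    have "mean_tail_series k L p \<le> (\<Sum>j. real_of_int k / 2 ^ L * (1 / 2) ^ Suc j)"
    proof (rule suminf_le [OF _ sm sums_summable [OF gs]])
      fix j
      have q: "p ^ Suc (j + L) > 0" using P(2) [OF p] by simp
      have 1: "k mod p ^ Suc (j + L) \<le> k" using k q by (intro zmod_le_nonneg_dividend) auto
      have "(2::int) ^ Suc (j + L) \<le> p ^ Suc (j + L)" using P(2) [OF p] by (intro power_mono) auto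
      then have "real_of_int (2 ^ Suc (j + L)) \<le> real_of_int (p ^ Suc (j + L))" by (simp only: of_int_le_iff)
      then have "real_of_int (k mod p ^ Suc (j + L)) / real_of_int (p ^ Suc (j + L)) \<le> real_of_int k / real_of_int (2 ^ Suc (j + L))"
        using 1 k by (intro frac_le) auto
      also have "\<dots> = real_of_int k / 2 ^ L * (1 / 2) ^ Suc j"
        by (simp add: power_add power_one_over field_simps)
      finally show "real_of_int (k mod p ^ Suc (j + L)) / real_of_int (p ^ Suc (j + L)) \<le> real_of_int k / 2 ^ L * (1 / 2) ^ Suc j" .
    qed
    then show "mean_tail_series k L p \<le> real_of_int k / 2 ^ L"
      using sums_unique [OF gs] by simp
  qed
  show "0 \<le> mean_tail k L" unfolding mean_tail_def
    using tail ln_prime_bounds(1) by (intro sum_nonneg mult_nonneg_nonneg) blast+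
  have "mean_tail k L \<le> (\<Sum>p\<in>primes_upto k. real_of_int k * (real_of_int k / 2 ^ L))"
    unfolding mean_tail_def using tail ln_prime_bounds k by (intro sum_mono mult_mono) auto
  also have "\<dots> = real (card (primes_upto k)) * (real_of_int k * (real_of_int k / 2 ^ L))" by simp
  also have "\<dots> \<le> real_of_int k * (real_of_int k * (real_of_int k / 2 ^ L))"
    using k by (intro mult_right_mono card_primes_upto_le) auto
  finally show "mean_tail k L \<le> real_of_int k ^ 3 / 2 ^ L" by (simp add: power3_eq_cube)
qed

text \<open>The common period \<open>q * q'\<close> may be far longer than the interval. What counts
  is the absolute sum over it, which factors and is at most \<open>(2 k)^2\<close>, while the mean
  over the full period vanishes.\<close>

lemma avg_carry_mult_coprime:
  assumes q: "q > 0" "q' > 0" "coprime q q'" and k: "k \<ge> 0" and N: "N > 0"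
  shows "\<bar>avg {a..<a + N} (\<lambda>n. carry k q n * carry k q' n)\<bar> \<le> 8 * (real_of_int k)\<^sup>2 / real_of_int N"
proof -
  have per: "periodic (q * q') (\<lambda>n. carry k q n * carry k q' n)"
    using q by (intro periodic_mult periodic_dvd [OF periodic_carry [of q]] periodic_dvd [OF periodic_carry [of q']]) auto
  have "(\<Sum>n=0..<q * q'. carry k q n * carry k q' n) = (\<Sum>n=0..<q. carry k q n) * (\<Sum>n=0..<q'. carry k q' n)"
    using q by (intro sum_crt periodic_carry)
  then have 0: "avg {0..<q * q'} (\<lambda>n. carry k q n * carry k q' n) = 0"
    using sum_carry [OF q(1)] by (simp add: avg_def)
  have "(\<Sum>n=0..<q * q'. \<bar>carry k q n\<bar> * \<bar>carry k q' n\<bar>) = (\<Sum>n=0..<q. \<bar>carry k q n\<bar>) * (\<Sum>n=0..<q'. \<bar>carry k q' n\<bar>)"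
    using q by (intro sum_crt periodic_compose [OF periodic_carry])
  also have "\<dots> \<le> (2 * real_of_int k) * (2 * real_of_int k)"
    using q k by (intro mult_mono sum_abs_carry_le sum_nonneg) auto
  finally have "(\<Sum>n=0..<q * q'. \<bar>carry k q n * carry k q' n\<bar>) \<le> 4 * (real_of_int k)\<^sup>2"
    by (simp add: abs_mult power2_eq_square)
  then have "2 * (\<Sum>n=0..<q * q'. \<bar>carry k q n * carry k q' n\<bar>) / real_of_int N \<le> 2 * (4 * (real_of_int k)\<^sup>2) / real_of_int N"
    using N by (intro divide_right_mono) auto
  moreover have "\<bar>avg {a..<a + N} (\<lambda>n. carry k q n * carry k q' n) - avg {0..<q * q'} (\<lambda>n. carry k q n * carry k q' n)\<bar>
    \<le> 2 * (\<Sum>n=0..<q * q'. \<bar>carry k q n * carry k q' n\<bar>) / real_of_int N"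
    using q by (intro avg_interval_periodic per N) auto
  ultimately show ?thesis using 0 by simp
qed

lemma avg_abs_carry_le:
  assumes q: "q > 0" and k: "k \<ge> 0" and N: "N > 0"
  shows "avg {a..<a + N} (\<lambda>n. \<bar>carry k q n\<bar>) \<le> 2 * real_of_int k / real_of_int q + 4 * real_of_int k / real_of_int N"
proof -
  have "\<bar>avg {a..<a + N} (\<lambda>n. \<bar>carry k q n\<bar>) - avg {0..<q} (\<lambda>n. \<bar>carry k q n\<bar>)\<bar> \<le> 2 * (\<Sum>n=0..<q. \<bar>\<bar>carry k q n\<bar>\<bar>) / real_of_int N"
    by (intro avg_interval_periodic q N periodic_compose [OF periodic_carry])
  also have "\<dots> \<le> 2 * (2 * real_of_int k) / real_of_int N"
    using sum_abs_carry_le [OF q k] N by (intro divide_right_mono mult_left_mono) auto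
  finally have 1: "\<bar>avg {a..<a + N} (\<lambda>n. \<bar>carry k q n\<bar>) - avg {0..<q} (\<lambda>n. \<bar>carry k q n\<bar>)\<bar> \<le> 4 * real_of_int k / real_of_int N" by simp
  have "avg {0..<q} (\<lambda>n. \<bar>carry k q n\<bar>) \<le> 2 * real_of_int k / real_of_int q"
    unfolding avg_def using sum_abs_carry_le [OF q k] q by (simp add: divide_right_mono)
  then show ?thesis using 1 by linarith
qed

text \<open>Bounding the factor with the smaller exponent by \<open>1\<close> leaves about
  \<open>k / p^b\<close> for the larger exponent \<open>b\<close>. Weakening this to the symmetric
  \<open>k * p^(- a/2) * p^(- b/2)\<close> makes the double sum over exponents a product.\<close>

lemma avg_carry_powers:
  assumes p: "p \<ge> 2" and k: "k \<ge> 0" and N: "N > 0"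
  shows "avg {m..<m + N} (\<lambda>n. carry k (p ^ a) n * carry k (p ^ b) n) \<le>
     2 * real_of_int k * ((1 / sqrt (real_of_int p)) ^ a * (1 / sqrt (real_of_int p)) ^ b) + 4 * real_of_int k / real_of_int N"
proof -
  define x where "x = 1 / sqrt (real_of_int p)"
  have x: "0 < x" "x \<le> 1" using p by (auto simp: x_def)
  have main: "avg {m..<m + N} (\<lambda>n. carry k (p ^ a) n * carry k (p ^ b) n) \<le> 2 * real_of_int k * (x ^ a * x ^ b) + 4 * real_of_int k / real_of_int N"
    if ab: "a \<le> b" for a b
  proof -
    have q: "p ^ b > 0" "p ^ a > 0" using p by auto
    have "avg {m..<m + N} (\<lambda>n. carry k (p ^ a) n * carry k (p ^ b) n) \<le> avg {m..<m + N} (\<lambda>n. \<bar>carry k (p ^ b) n\<bar>)"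
    proof (rule avg_mono)
      fix n
      have "carry k (p ^ a) n * carry k (p ^ b) n \<le> \<bar>carry k (p ^ a) n\<bar> * \<bar>carry k (p ^ b) n\<bar>"
        by (simp add: abs_mult [symmetric])
      also have "\<dots> \<le> 1 * \<bar>carry k (p ^ b) n\<bar>" by (intro mult_right_mono abs_carry_le q) auto
      finally show "carry k (p ^ a) n * carry k (p ^ b) n \<le> \<bar>carry k (p ^ b) n\<bar>" by simp
    qed
    also have "\<dots> \<le> 2 * real_of_int k / real_of_int (p ^ b) + 4 * real_of_int k / real_of_int N"
      by (rule avg_abs_carry_le [OF q(1) k N])
    also have "1 / real_of_int (p ^ b) \<le> x ^ a * x ^ b"
    proof -
      have "x ^ 2 = 1 / real_of_int p" using p by (simp add: x_def power_divide)
      then have "1 / real_of_int (p ^ b) = x ^ b * x ^ b"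
        by (simp add: power_one_over [symmetric] power_mult_distrib [symmetric] power2_eq_square)
      also have "\<dots> \<le> x ^ a * x ^ b" using x ab by (intro mult_right_mono power_decreasing) auto
      finally show ?thesis .
    qed
    then have "2 * real_of_int k / real_of_int (p ^ b) \<le> 2 * real_of_int k * (x ^ a * x ^ b)"
      using mult_left_mono [of "1 / real_of_int (p ^ b)" "x ^ a * x ^ b" "2 * real_of_int k"] k by simp
    finally show ?thesis by simp
  qed
  show ?thesis
  proof (cases "a \<le> b")
    case True
    then show ?thesis using main [of a b] by (simp add: x_def)
  next
    case False
    then show ?thesis using main [of b a] by (simp add: x_def mult.commute)
  qed
qed

text \<open>The ratio is at most \<open>1 / sqrt 2 < 3 / 4\<close>, so the series is at most four
  times its first term \<open>1 / p\<close>.\<close>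

lemma geometric_sqrt_bound:
  assumes p: "p \<ge> (2::int)"
  shows "(\<Sum>a=2..L. (1 / sqrt (real_of_int p)) ^ a) \<le> 4 / real_of_int p"
proof -
  define x where "x = 1 / sqrt (real_of_int p)"
  have "x \<le> 3 / 4"
  proof -
    have "(4 / 3)\<^sup>2 \<le> real_of_int p" using p by (simp add: power2_eq_square)
    then have "4 / 3 \<le> sqrt (real_of_int p)" by (rule real_le_rsqrt)
    then show ?thesis using p by (simp add: x_def divide_simps)
  qed
  moreover have "x > 0" using p by (simp add: x_def)
  ultimately have x: "0 < x" "x \<le> 3 / 4" by auto
  have "(\<Sum>a=2..L. x ^ a) \<le> (\<Sum>a<L. x ^ 2 * x ^ a)"
  proof -
    have pw: "x ^ 2 * x ^ (a - 2) = x ^ a" if "2 \<le> a" for a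
      using that by (metis le_add_diff_inverse power_add)
    have "(\<Sum>a=2..L. x ^ a) = (\<Sum>a\<in>{0..<L - 1}. x ^ 2 * x ^ a)"
      by (rule sum.reindex_bij_witness [of _ "\<lambda>a. a + 2" "\<lambda>a. a - 2"]) (auto simp: pw)
    also have "\<dots> \<le> (\<Sum>a<L. x ^ 2 * x ^ a)" using x by (intro sum_mono2) auto
    finally show ?thesis .
  qed
  also have "\<dots> = x ^ 2 * ((1 - x ^ L) / (1 - x))"
    using x by (simp add: sum_distrib_left [symmetric] sum_gp_strict)
  also have "\<dots> \<le> x ^ 2 * 4"
  proof (rule mult_left_mono)
    have "(1 - x ^ L) / (1 - x) \<le> 1 / (1 / 4)" using x by (intro frac_le) auto
    then show "(1 - x ^ L) / (1 - x) \<le> 4" by simp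
  qed simp
  also have "x ^ 2 = 1 / real_of_int p" using p by (simp add: x_def power_divide)
  finally show ?thesis by (simp add: x_def)
qed

text \<open>The bound is independent of \<open>k\<close>; this is why the proper prime powers
  contribute only \<open>O(k)\<close> to the second moment.\<close>

lemma sum_ln_squared_bounded: "\<exists>B. \<forall>k. (\<Sum>p\<in>primes_upto k. (ln (real_of_int p))\<^sup>2 / (real_of_int p)\<^sup>2) \<le> B"
proof -
  have "summable (\<lambda>n. (ln (real n))\<^sup>2 / (real n)\<^sup>2)"
  proof (rule summable_comparison_test_ev)
    show "summable (\<lambda>n. real n powr (- 3 / 2))" by (simp add: summable_real_powr_iff)
    show "eventually (\<lambda>n. norm ((ln (real n))\<^sup>2 / (real n)\<^sup>2) \<le> real n powr (- 3 / 2)) sequentially"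
      by simp real_asymp
  qed
  then have "(\<Sum>n\<in>nat ` primes_upto k. (ln (real n))\<^sup>2 / (real n)\<^sup>2) \<le> (\<Sum>n. (ln (real n))\<^sup>2 / (real n)\<^sup>2)" for k
    by (intro sum_le_suminf) (auto simp: finite_primes_upto)
  moreover have "(\<Sum>n\<in>nat ` primes_upto k. (ln (real n))\<^sup>2 / (real n)\<^sup>2) = (\<Sum>p\<in>primes_upto k. (ln (real_of_int p))\<^sup>2 / (real_of_int p)\<^sup>2)" for k
  proof (subst sum.reindex)
    show "inj_on nat (primes_upto k)" by (auto simp: inj_on_def primes_upto_def dest!: prime_gt_0_int)
  qed (auto simp: primes_upto_def dest!: prime_gt_0_int intro!: sum.cong)
  ultimately have "(\<Sum>p\<in>primes_upto k. (ln (real_of_int p))\<^sup>2 / (real_of_int p)\<^sup>2) \<le> (\<Sum>n. (ln (real n))\<^sup>2 / (real n)\<^sup>2)" for k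
    by (simp only:)
  then show ?thesis by blast
qed

text \<open>Equal primes give \<open>(ln p)^2 * 2 k * (4 / p)^2\<close>, whence
  \<open>32 * B * k\<close>. Distinct primes are uncorrelated up to boundary effects of the
  interval; all such effects carry \<open>1 / N\<close>, so crude powers of \<open>k\<close> and
  \<open>L\<close> are affordable, and \<open>12\<close> is \<open>4\<close> from equal primes plus
  \<open>8\<close> from distinct ones.\<close>

lemma higher_part_second_moment:
  assumes k: "k \<ge> 2" and N: "N > 0" and L: "L \<ge> 1"
    and B: "\<And>k. (\<Sum>p\<in>primes_upto k. (ln (real_of_int p))\<^sup>2 / (real_of_int p)\<^sup>2) \<le> B"
  shows "avg {m..<m + N} (\<lambda>n. (higher_part k L n)\<^sup>2) \<le> 32 * B * real_of_int k + 12 * real_of_int k ^ 6 * (real L)\<^sup>2 / real_of_int N"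
proof -
  define P where "P = primes_upto k"
  have P: "prime p" "p \<ge> 2" "p > 0" if "p \<in> P" for p
    using that by (auto simp: P_def primes_upto_def prime_ge_2_int prime_gt_0_int)
  have fP: "finite P" by (simp add: P_def finite_primes_upto)
  have lnP: "0 \<le> ln (real_of_int p)" "ln (real_of_int p) \<le> real_of_int k" if "p \<in> P" for p
    using ln_prime_bounds that by (auto simp: P_def)
  have cP: "real (card P) \<le> real_of_int k" unfolding P_def using k by (intro card_primes_upto_le) simp
  define K where "K = real_of_int k"
  have K: "K \<ge> 2" using k by (simp add: K_def)
  define \<nu> where "\<nu> = real_of_int N"
  have \<nu>: "\<nu> > 0" using N by (simp add: \<nu>_def)
  define A where "A = (\<lambda>p p' a b. avg {m..<m + N} (\<lambda>n. carry k (p ^ a) n * carry k (p' ^ b) n))"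
  have cL: "real (card {2..L}) \<le> real L" by simp
  have "(higher_part k L n)\<^sup>2 = (\<Sum>p\<in>P. \<Sum>p'\<in>P. ln (real_of_int p) * ln (real_of_int p') * (\<Sum>a=2..L. \<Sum>b=2..L. carry k (p ^ a) n * carry k (p' ^ b) n))" for n
  proof -
    define W where "W = (\<lambda>p. \<Sum>a=2..L. carry k (p ^ a) n)"
    have "(higher_part k L n)\<^sup>2 = (\<Sum>p\<in>P. \<Sum>p'\<in>P. (ln (real_of_int p) * W p) * (ln (real_of_int p') * W p'))"
      unfolding higher_part_def P_def [symmetric] power2_eq_square W_def by (rule sum_product)
    also have "\<dots> = (\<Sum>p\<in>P. \<Sum>p'\<in>P. ln (real_of_int p) * ln (real_of_int p') * (W p * W p'))"
    proof -
      have "(w * x) * (y * z) = (w * y) * (x * z)" for w x y z :: real by simp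
      then show ?thesis by (intro sum.cong refl)
    qed
    finally show ?thesis unfolding W_def sum_product .
  qed
  then have eq: "avg {m..<m + N} (\<lambda>n. (higher_part k L n)\<^sup>2) =
      (\<Sum>p\<in>P. \<Sum>p'\<in>P. ln (real_of_int p) * ln (real_of_int p') * (\<Sum>a=2..L. \<Sum>b=2..L. A p p' a b))"
    unfolding A_def by (simp only: avg_sum avg_cmult)
  define D where "D = (\<lambda>p. (ln (real_of_int p))\<^sup>2 * (2 * K * (16 / (real_of_int p)\<^sup>2)))"
  define E where "E = K\<^sup>2 * (real L)\<^sup>2 * (8 * K\<^sup>2 / \<nu>)"
  define E' where "E' = K\<^sup>2 * (real L)\<^sup>2 * (4 * K / \<nu>)"
  have E0: "E \<ge> 0" "E' \<ge> 0" using K \<nu> by (auto simp: E_def E'_def)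
  have diag: "ln (real_of_int p) * ln (real_of_int p) * (\<Sum>a=2..L. \<Sum>b=2..L. A p p a b) \<le> D p + E'" if p: "p \<in> P" for p
  proof -
    define x where "x = 1 / sqrt (real_of_int p)"
    have x0: "x > 0" using P(3) [OF p] by (simp add: x_def)
    have "(\<Sum>a=2..L. \<Sum>b=2..L. A p p a b) \<le> (\<Sum>a=2..L. \<Sum>b=2..L. 2 * K * (x ^ a * x ^ b) + 4 * K / \<nu>)"
      unfolding A_def K_def \<nu>_def x_def using P(2) [OF p] k N by (intro sum_mono avg_carry_powers) auto
    also have "\<dots> = 2 * K * ((\<Sum>a=2..L. x ^ a) * (\<Sum>b=2..L. x ^ b)) + real (card {2..L}) * (real (card {2..L}) * (4 * K / \<nu>))"
    proof -
      have "(\<Sum>a=2..L. \<Sum>b=2..L. 2 * K * (x ^ a * x ^ b)) = 2 * K * ((\<Sum>a=2..L. x ^ a) * (\<Sum>b=2..L. x ^ b))"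
        unfolding sum_product by (simp only: sum_distrib_left)
      then show ?thesis by (simp only: sum.distrib sum_constant)
    qed
    also have "\<dots> \<le> 2 * K * ((4 / real_of_int p) * (4 / real_of_int p)) + real L * (real L * (4 * K / \<nu>))"
    proof (intro add_mono mult_left_mono)
      have g: "(\<Sum>a=2..L. x ^ a) \<le> 4 / real_of_int p" unfolding x_def by (rule geometric_sqrt_bound [OF P(2) [OF p]])
      show "(\<Sum>a=2..L. x ^ a) * (\<Sum>b=2..L. x ^ b) \<le> (4 / real_of_int p) * (4 / real_of_int p)"
        using x0 P(3) [OF p] by (intro mult_mono g sum_nonneg) auto
      show "real (card {2..L}) * (real (card {2..L}) * (4 * K / \<nu>)) \<le> real L * (real L * (4 * K / \<nu>))"
        using K \<nu> by (intro mult_mono mult_right_mono cL) auto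
    qed (use K in simp)
    finally have "(\<Sum>a=2..L. \<Sum>b=2..L. A p p a b) \<le> 2 * K * (16 / (real_of_int p)\<^sup>2) + (real L)\<^sup>2 * (4 * K / \<nu>)"
      by (simp add: power2_eq_square mult_ac)
    then have "(ln (real_of_int p))\<^sup>2 * (\<Sum>a=2..L. \<Sum>b=2..L. A p p a b) \<le>
       (ln (real_of_int p))\<^sup>2 * (2 * K * (16 / (real_of_int p)\<^sup>2) + (real L)\<^sup>2 * (4 * K / \<nu>))"
      by (intro mult_left_mono) auto
    also have "\<dots> = D p + (ln (real_of_int p))\<^sup>2 * ((real L)\<^sup>2 * (4 * K / \<nu>))"
      unfolding D_def by (rule distrib_left)
    also have "\<dots> \<le> D p + K\<^sup>2 * ((real L)\<^sup>2 * (4 * K / \<nu>))"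
      using lnP [OF p] K \<nu> unfolding K_def [symmetric] by (intro add_left_mono mult_right_mono power_mono) auto
    finally show ?thesis unfolding E'_def by (simp add: power2_eq_square mult_ac)
  qed
  have off: "ln (real_of_int p) * ln (real_of_int p') * (\<Sum>a=2..L. \<Sum>b=2..L. A p p' a b) \<le> E"
    if p: "p \<in> P" "p' \<in> P" "p \<noteq> p'" for p p'
  proof -
    have "A p p' a b \<le> 8 * K\<^sup>2 / \<nu>" for a b
    proof -
      have "coprime p p'" by (rule primes_coprime [OF P(1) [OF p(1)] P(1) [OF p(2)] p(3)])
      then have "coprime (p ^ a) (p' ^ b)" by simp
      then have "\<bar>A p p' a b\<bar> \<le> 8 * K\<^sup>2 / \<nu>"
        unfolding A_def K_def \<nu>_def using P(3) p k N by (intro avg_carry_mult_coprime) auto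
      then show ?thesis by simp
    qed
    then have "(\<Sum>a=2..L. \<Sum>b=2..L. A p p' a b) \<le> (\<Sum>a=2..L. \<Sum>b=2..L. 8 * K\<^sup>2 / \<nu>)"
      by (intro sum_mono)
    also have "\<dots> = real (card {2..L}) * (real (card {2..L}) * (8 * K\<^sup>2 / \<nu>))" by (simp only: sum_constant)
    also have "\<dots> \<le> real L * (real L * (8 * K\<^sup>2 / \<nu>))"
      using K \<nu> by (intro mult_mono mult_right_mono cL) auto
    finally have 1: "(\<Sum>a=2..L. \<Sum>b=2..L. A p p' a b) \<le> real L * (real L * (8 * K\<^sup>2 / \<nu>))" .
    have "ln (real_of_int p) * ln (real_of_int p') * (\<Sum>a=2..L. \<Sum>b=2..L. A p p' a b) \<le>
       ln (real_of_int p) * ln (real_of_int p') * (real L * (real L * (8 * K\<^sup>2 / \<nu>)))"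
      using 1 lnP p by (intro mult_left_mono) auto
    also have "\<dots> \<le> K * K * (real L * (real L * (8 * K\<^sup>2 / \<nu>)))"
      using lnP p K \<nu> unfolding K_def [symmetric] by (intro mult_right_mono mult_mono) auto
    also have "\<dots> = E" by (simp add: E_def power2_eq_square)
    finally show ?thesis .
  qed
  \<comment> \<open>The non-negative \<open>E\<close> is added on the diagonal as well, so the
    double sum needs no side condition \<open>p \<noteq> p'\<close>.\<close>
  have "avg {m..<m + N} (\<lambda>n. (higher_part k L n)\<^sup>2) \<le> (\<Sum>p\<in>P. \<Sum>p'\<in>P. (if p' = p then D p + E' else 0) + E)"
    unfolding eq
  proof (intro sum_mono)
    fix p p' assume p: "p \<in> P" "p' \<in> P"
    show "ln (real_of_int p) * ln (real_of_int p') * (\<Sum>a=2..L. \<Sum>b=2..L. A p p' a b) \<le> (if p' = p then D p + E' else 0) + E"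
      using diag [of p] off [of p p'] p E0 by (cases "p' = p") auto
  qed
  also have "\<dots> = (\<Sum>p\<in>P. D p) + real (card P) * E' + real (card P) * (real (card P) * E)"
    using fP by (simp add: sum.distrib)
  also have "\<dots> \<le> 32 * B * K + K * E' + K * (K * E)"
  proof (intro add_mono mult_mono mult_right_mono)
    have "(\<Sum>p\<in>P. D p) = 32 * K * (\<Sum>p\<in>P. (ln (real_of_int p))\<^sup>2 / (real_of_int p)\<^sup>2)"
      unfolding D_def sum_distrib_left by (intro sum.cong refl) simp
    also have "\<dots> \<le> 32 * K * B" using B [of k] K by (intro mult_left_mono) (auto simp: P_def)
    finally show "(\<Sum>p\<in>P. D p) \<le> 32 * B * K" by (simp add: mult_ac)
  qed (use cP E0 K in \<open>auto simp: K_def\<close>)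
  also have "K * E' \<le> 4 * K ^ 6 * (real L)\<^sup>2 / \<nu>"
  proof -
    have "K * E' = 4 * K ^ 4 * ((real L)\<^sup>2 / \<nu>)" by (simp add: E'_def power2_eq_square power4_eq_xxxx)
    also have "\<dots> \<le> 4 * K ^ 6 * ((real L)\<^sup>2 / \<nu>)"
      using K \<nu> by (intro mult_right_mono mult_left_mono power_increasing) auto
    finally show ?thesis by simp
  qed
  also have "K * (K * E) = 8 * K ^ 6 * (real L)\<^sup>2 / \<nu>"
    by (simp add: E_def power2_eq_square eval_nat_numeral)
  finally have "avg {m..<m + N} (\<lambda>n. (higher_part k L n)\<^sup>2) \<le> 32 * B * K + 4 * K ^ 6 * (real L)\<^sup>2 / \<nu> + 8 * K ^ 6 * (real L)\<^sup>2 / \<nu>"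
    by simp
  also have "\<dots> = 32 * B * K + 12 * K ^ 6 * (real L)\<^sup>2 / \<nu>"
    by (simp add: add_divide_distrib [symmetric])
  finally show ?thesis by (simp add: K_def \<nu>_def)
qed

section \<open>The central limit theorem\<close>

lemma dyadic_ints_eq: "dyadic_ints X = {\<lceil>X\<rceil>..<\<lceil>X\<rceil> + (\<lceil>2 * X\<rceil> - \<lceil>X\<rceil>)}"
  by (auto simp: dyadic_ints_def ceiling_le_iff less_ceiling_iff)

lemma integral_unif:
  fixes f :: "int \<Rightarrow> 'a :: {banach, second_countable_topology, real_normed_field}"
  assumes "X \<ge> 3"
  shows "measure_pmf.expectation (unif X) f = avg (dyadic_ints X) f"
proof -
  have "measure_pmf.expectation (unif X) f = (\<Sum>n\<in>dyadic_ints X. pmf (unif X) n *\<^sub>R f n)"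
    using assms finite_dyadic_ints dyadic_ints_nonempty
    by (intro integral_measure_pmf [OF finite_dyadic_ints]) (auto simp: unif_def)
  also have "\<dots> = avg (dyadic_ints X) f"
    unfolding avg_def sum_divide_distrib
    using finite_dyadic_ints [of X] dyadic_ints_nonempty [OF assms]
    by (intro sum.cong refl) (simp add: unif_def scaleR_conv_of_real divide_inverse mult.commute)
  finally show ?thesis .
qed

lemma real_distribution_distr_pmf:
  fixes f :: "int \<Rightarrow> real"
  shows "real_distribution (distr (measure_pmf p) borel f)"
proof -
  interpret prob_space "distr (measure_pmf p) borel f"
    by (rule measure_pmf.prob_space_distr) simp
  show ?thesis by standard simp
qed

lemma char_distr_unif:
  assumes "X \<ge> 3"
  shows "char (distr (measure_pmf (unif X)) borel f) t = avg (dyadic_ints X) (\<lambda>n. iexp (t * f n))"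
  unfolding char_def by (subst integral_distr) (simp_all add: integral_unif [OF assms])

text \<open>Levy's theorem concerns sequences; a limit along real \<open>X\<close> is tested on all
  sequences tending to infinity.\<close>

lemma weak_conv_along_at_top_char:
  fixes M :: "real \<Rightarrow> real measure"
  assumes "\<And>X. real_distribution (M X)" "real_distribution N"
    and lim: "\<And>t. ((\<lambda>X. char (M X) t) \<longlongrightarrow> char N t) at_top"
  shows "weak_conv_along M N at_top"
  unfolding weak_conv_along_def
proof (intro allI impI)
  fix x assume x: "isCont (cdf N) x"
  show "((\<lambda>X. cdf (M X) x) \<longlongrightarrow> cdf N x) at_top"
  proof (rule tendsto_at_topI_sequentially)
    fix X :: "nat \<Rightarrow> real" assume X: "filterlim X at_top sequentially"
    have "weak_conv_m (\<lambda>n. M (X n)) N"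
      by (rule levy_continuity [OF assms(1,2)]) (rule filterlim_compose [OF lim X])
    then show "(\<lambda>n. cdf (M (X n)) x) \<longlonglongrightarrow> cdf N x"
      using x by (simp add: weak_conv_m_def weak_conv_def)
  qed
qed

lemma avg_abs_le_sqrt:
  assumes "finite S" "S \<noteq> {}"
  shows "avg S (\<lambda>n. \<bar>f n\<bar>) \<le> sqrt (avg S (\<lambda>n. (f n)\<^sup>2))"
proof (rule real_le_rsqrt)
  define m where "m = avg S (\<lambda>n. \<bar>f n\<bar>)"
  have "0 \<le> avg S (\<lambda>n. (\<bar>f n\<bar> - m)\<^sup>2)" by (rule avg_nonneg) simp
  also have "(\<lambda>n. (\<bar>f n\<bar> - m)\<^sup>2) = (\<lambda>n. ((f n)\<^sup>2 - (2 * m) * \<bar>f n\<bar>) + m\<^sup>2)"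
    by (simp add: fun_eq_iff power2_diff)
  also have "avg S (\<lambda>n. ((f n)\<^sup>2 - (2 * m) * \<bar>f n\<bar>) + m\<^sup>2) = avg S (\<lambda>n. (f n)\<^sup>2) - 2 * m * m + m\<^sup>2"
    unfolding avg_add avg_diff avg_cmult avg_const [OF assms] m_def ..
  finally show "(avg S (\<lambda>n. \<bar>f n\<bar>))\<^sup>2 \<le> avg S (\<lambda>n. (f n)\<^sup>2)"
    by (simp add: m_def power2_eq_square)
qed

lemma avg_mult_le_sqrt:
  assumes "finite S" "S \<noteq> {}"
  shows "\<bar>avg S (\<lambda>n. f n * g n)\<bar> \<le> sqrt (avg S (\<lambda>n. (f n)\<^sup>2) * avg S (\<lambda>n. (g n)\<^sup>2))"
proof -
  have c: "real (card S) > 0" using assms by (simp add: card_gt_0_iff)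
  have "(\<Sum>n\<in>S. f n * g n)\<^sup>2 \<le> (\<Sum>n\<in>S. (f n)\<^sup>2) * (\<Sum>n\<in>S. (g n)\<^sup>2)"
    by (rule Cauchy_Schwarz_ineq_sum)
  then have "(avg S (\<lambda>n. f n * g n))\<^sup>2 \<le> avg S (\<lambda>n. (f n)\<^sup>2) * avg S (\<lambda>n. (g n)\<^sup>2)"
    using c by (simp add: avg_def power_divide divide_right_mono power2_eq_square)
  then show ?thesis by (metis real_sqrt_le_iff real_sqrt_abs)
qed

lemma norm_iexp_diff_le: "norm (iexp x - iexp y) \<le> \<bar>x - y\<bar>"
proof -
  have "iexp x - iexp y = iexp y * (iexp (x - y) - 1)"
    by (simp add: right_diff_distrib exp_add [symmetric] algebra_simps)
  then have "norm (iexp x - iexp y) = norm (iexp (x - y) - 1)" by (simp add: norm_mult)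
  also have "\<dots> \<le> \<bar>x - y\<bar>" using iexp_approx1 [of "x - y" 0] by simp
  finally show ?thesis .
qed

text \<open>A change that is small in mean does not affect the limit of characteristic functions.
  This is how the remainder and the later renormalisation are discarded.\<close>

lemma norm_avg_iexp_diff_le:
  "norm (avg S (\<lambda>n. iexp (t * f n)) - avg S (\<lambda>n. iexp (t * g n))) \<le> \<bar>t\<bar> * avg S (\<lambda>n. \<bar>f n - g n\<bar>)"
proof -
  have "norm (avg S (\<lambda>n. iexp (t * f n)) - avg S (\<lambda>n. iexp (t * g n))) \<le> avg S (\<lambda>n. norm (iexp (t * f n) - iexp (t * g n)))"
    unfolding avg_diff [symmetric] by (rule norm_avg_le)
  also have "\<dots> \<le> avg S (\<lambda>n. \<bar>t\<bar> * \<bar>f n - g n\<bar>)"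
  proof (rule avg_mono)
    fix n
    show "norm (iexp (t * f n) - iexp (t * g n)) \<le> \<bar>t\<bar> * \<bar>f n - g n\<bar>"
      using norm_iexp_diff_le [of "t * f n" "t * g n"] by (simp add: right_diff_distrib [symmetric] abs_mult)
  qed
  finally show ?thesis by (simp add: avg_cmult)
qed

lemma weak_conv_along_cong:
  assumes "eventually (\<lambda>X. M X = M' X) F" "weak_conv_along M N F"
  shows "weak_conv_along M' N F"
  unfolding weak_conv_along_def
proof (intro allI impI)
  fix x assume "isCont (cdf N) x"
  then have "((\<lambda>X. cdf (M X) x) \<longlongrightarrow> cdf N x) F" using assms(2) by (simp add: weak_conv_along_def)
  then show "((\<lambda>X. cdf (M' X) x) \<longlongrightarrow> cdf N x) F"
    by (rule Lim_transform_eventually) (use assms(1) in \<open>eventually_elim, simp\<close>)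
qed

section \<open>Orders of magnitude as \<open>X\<close> tends to infinity\<close>

locale clt_setup =
  fixes A :: real and k :: "real \<Rightarrow> int"
  assumes A: "A > 0" and k_top: "filterlim k at_top at_top"
    and k_le: "\<forall>\<^sub>F X in at_top. real_of_int (k X) \<le> A * ln X"
begin

abbreviation K :: "real \<Rightarrow> real" where "K X \<equiv> real_of_int (k X)"
abbreviation Vk :: "real \<Rightarrow> real" where "Vk X \<equiv> V (k X)"

text \<open>The absolute value keeps the weight non-negative at every integer argument, as
  \<open>carry_sum\<close> requires; on primes it changes nothing.\<close>

definition c :: "real \<Rightarrow> int \<Rightarrow> real" where "c X p = \<bar>ln (real_of_int p)\<bar> / sqrt (Vk X)"
definition N :: "real \<Rightarrow> int" where "N X = \<lceil>2 * X\<rceil> - \<lceil>X\<rceil>"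
definition L :: "real \<Rightarrow> nat" where "L X = nat \<lceil>log 2 (2 * X)\<rceil>"
definition s :: "real \<Rightarrow> int \<Rightarrow> real" where "s X n = carry_sum.s (k X) (c X) n"
definition R :: "real \<Rightarrow> int \<Rightarrow> real" where
  "R X n = (higher_part (k X) (L X) n - mean_tail (k X) (L X)) / sqrt (Vk X)"
definition Z :: "real \<Rightarrow> int \<Rightarrow> real" where "Z X n = (U (k X) n - mean_const (k X)) / sqrt (Vk X)"
abbreviation E :: "real \<Rightarrow> (int \<Rightarrow> 'a) \<Rightarrow> 'a :: real_normed_field" where "E X \<equiv> avg (dyadic_ints X)"

lemma K_top: "filterlim K at_top at_top"
  by (rule filterlim_compose [OF filterlim_real_of_int_at_top k_top])

lemma eventually_K_gt_1: "eventually (\<lambda>X. K X > 1) at_top"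
proof -
  have "eventually (\<lambda>X. k X \<ge> 2) at_top" using k_top by (simp add: filterlim_at_top)
  then show ?thesis by eventually_elim simp
qed

lemma V_ratio: "((\<lambda>X. Vk X / (K X * ln (K X))) \<longlongrightarrow> 2 - ln (2 * pi)) at_top"
proof -
  have "filterlim (\<lambda>X. nat (k X)) sequentially at_top"
    by (rule filterlim_compose [OF filterlim_nat_sequentially k_top])
  from filterlim_compose [OF V_asymptotics this]
  have "((\<lambda>X. V (int (nat (k X))) / (real (nat (k X)) * ln (real (nat (k X))))) \<longlongrightarrow> 2 - ln (2 * pi)) at_top" .
  moreover have "eventually (\<lambda>X. k X \<ge> 0) at_top" using k_top by (simp add: filterlim_at_top)
  then have "eventually (\<lambda>X. V (int (nat (k X))) / (real (nat (k X)) * ln (real (nat (k X)))) = Vk X / (K X * ln (K X))) at_top"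
    by eventually_elim simp
  ultimately show ?thesis by (rule Lim_transform_eventually)
qed

lemma c0_pos: "2 - ln (2 * pi) > 0"
  using ln_2pi_less_2 by simp

lemma inv_ratio: "((\<lambda>X. K X * ln (K X) / Vk X) \<longlongrightarrow> 1 / (2 - ln (2 * pi))) at_top"
  using tendsto_inverse [OF V_ratio] c0_pos by (simp add: inverse_eq_divide)

text \<open>The proper prime powers have second moment \<open>O(k)\<close>, so this limit makes them
  negligible after normalisation.\<close>

lemma K_over_V: "((\<lambda>X. K X / Vk X) \<longlongrightarrow> 0) at_top"
proof -
  have "((\<lambda>x::real. 1 / ln x) \<longlongrightarrow> 0) at_top" by real_asymp
  from tendsto_mult [OF filterlim_compose [OF this K_top] inv_ratio]
  have "((\<lambda>X. 1 / ln (K X) * (K X * ln (K X) / Vk X)) \<longlongrightarrow> 0) at_top" by simp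
  moreover have "eventually (\<lambda>X. K X > 1) at_top" by (rule eventually_K_gt_1)
  then have "eventually (\<lambda>X. 1 / ln (K X) * (K X * ln (K X) / Vk X) = K X / Vk X) at_top"
    by eventually_elim simp
  ultimately show ?thesis by (rule Lim_transform_eventually)
qed

text \<open>The largest weight tends to \<open>0\<close>: no single prime matters, which is the
  Lindeberg condition here.\<close>

lemma lnK_over_sqrt_V: "((\<lambda>X. ln (K X) / sqrt (Vk X)) \<longlongrightarrow> 0) at_top"
proof -
  have "((\<lambda>x::real. ln x / x) \<longlongrightarrow> 0) at_top" by real_asymp
  from tendsto_mult [OF filterlim_compose [OF this K_top] inv_ratio]
  have "((\<lambda>X. ln (K X) / K X * (K X * ln (K X) / Vk X)) \<longlongrightarrow> 0) at_top" by simp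
  then have "((\<lambda>X. sqrt (ln (K X) / K X * (K X * ln (K X) / Vk X))) \<longlongrightarrow> sqrt 0) at_top"
    by (rule tendsto_real_sqrt)
  then have "((\<lambda>X. sqrt (ln (K X) / K X * (K X * ln (K X) / Vk X))) \<longlongrightarrow> 0) at_top" by simp
  moreover have "eventually (\<lambda>X. K X > 1) at_top" by (rule eventually_K_gt_1)
  then have "eventually (\<lambda>X. sqrt (ln (K X) / K X * (K X * ln (K X) / Vk X)) = ln (K X) / sqrt (Vk X)) at_top"
  proof eventually_elim
    case (elim X)
    have "ln (K X) / K X * (K X * ln (K X) / Vk X) = (ln (K X))\<^sup>2 / Vk X"
      using elim by (simp add: power2_eq_square)
    then show ?case using elim by (simp add: real_sqrt_divide)
  qed
  ultimately show ?thesis by (rule Lim_transform_eventually)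
qed

text \<open>Collects the eventual properties so that estimates can be made at a fixed
  \<open>X\<close>. The clause \<open>K X \<le> X\<close> gives \<open>k \<le> n\<close> on the
  interval, and \<open>Vk X \<ge> 1\<close> permits dropping the normalisation in crude
  bounds.\<close>

definition good :: "real \<Rightarrow> bool" where
  "good X \<longleftrightarrow> X \<ge> 3 \<and> k X \<ge> 2 \<and> K X \<le> A * ln X \<and> K X \<le> X \<and> Vk X \<ge> 1"

lemma eventually_good: "eventually good at_top"
proof -
  have "eventually (\<lambda>X. A * ln X \<le> X) at_top" using A by real_asymp
  moreover have "eventually (\<lambda>X. K X / Vk X < 1) at_top"
    using K_over_V by (rule order_tendstoD) simp
  moreover have "eventually (\<lambda>X. Vk X / (K X * ln (K X)) > 0) at_top"
    using V_ratio c0_pos by (rule order_tendstoD)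
  moreover have "eventually (\<lambda>X. k X \<ge> 2) at_top" using k_top by (simp add: filterlim_at_top)
  ultimately show ?thesis using k_le eventually_ge_at_top [of 3]
  proof eventually_elim
    case (elim X)
    have "K X * ln (K X) > 0" using elim by simp
    then have "Vk X > 0" using elim(3) by (simp add: zero_less_divide_iff)
    then have "K X < Vk X" using elim(2) by (simp add: divide_simps)
    then show ?case using elim by (simp add: good_def)
  qed
qed

lemma N_bounds: "X \<ge> 3 \<Longrightarrow> N X > 0" "X \<ge> 3 \<Longrightarrow> real_of_int (N X) \<ge> X - 1"
proof -
  show "X \<ge> 3 \<Longrightarrow> real_of_int (N X) \<ge> X - 1" unfolding N_def by linarith
  then show "X \<ge> 3 \<Longrightarrow> N X > 0" by linarith
qed

lemma I_eq: "dyadic_ints X = {\<lceil>X\<rceil>..<\<lceil>X\<rceil> + N X}"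
  unfolding N_def by (rule dyadic_ints_eq)

lemma carry_sum_good:
  assumes "good X"
  shows "carry_sum (k X) (N X) (c X)"
proof
  show "k X \<ge> 2" "N X > 0" using assms N_bounds by (auto simp: good_def)
  show "c X p \<ge> 0" for p using assms by (simp add: c_def good_def)
  have V: "Vk X > 0" using assms by (simp add: good_def)
  have "(\<Sum>p\<in>primes_upto (k X). (c X p)\<^sup>2 * (alpha p (k X) * (1 - alpha p (k X)))) = Vk X / Vk X"
    unfolding V_def [of "k X"] sum_divide_distrib
  proof (rule sum.cong [OF refl], fold V_def)
    fix p
    show "(c X p)\<^sup>2 * (alpha p (k X) * (1 - alpha p (k X))) = (ln (real_of_int p))\<^sup>2 * alpha p (k X) * (1 - alpha p (k X)) / Vk X"
      using V by (simp add: c_def power_divide)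
  qed
  then show "(\<Sum>p\<in>primes_upto (k X). (c X p)\<^sup>2 * (alpha p (k X) * (1 - alpha p (k X)))) = 1"
    using V by simp
qed

text \<open>Here the growth hypothesis acts: for \<open>k\<close> at most a multiple of
  \<open>ln X\<close>, every fixed power of \<open>k\<close> is negligible against the length of the
  interval.\<close>

lemma polylog: "((\<lambda>X. K X ^ m * (2 / real_of_int (N X))) \<longlongrightarrow> 0) at_top"
proof (rule tendsto_sandwich [of "\<lambda>_. 0" _ _ "\<lambda>X. (A * ln X) ^ m * (2 / (X - 1))"])
  show "eventually (\<lambda>X. 0 \<le> K X ^ m * (2 / real_of_int (N X))) at_top"
    using eventually_good
  proof eventually_elim
    case (elim X)
    then show ?case using N_bounds(1) [of X] by (auto simp: good_def)
  qed
  show "eventually (\<lambda>X. K X ^ m * (2 / real_of_int (N X)) \<le> (A * ln X) ^ m * (2 / (X - 1))) at_top"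
    using eventually_good
  proof eventually_elim
    case (elim X)
    then show ?case using N_bounds [of X]
      by (intro mult_mono power_mono divide_left_mono) (auto simp: good_def)
  qed
  show "((\<lambda>X. (A * ln X) ^ m * (2 / (X - 1))) \<longlongrightarrow> 0) at_top"
  proof (cases "m = 0")
    case True
    have "((\<lambda>X::real. 2 / (X - 1)) \<longlongrightarrow> 0) at_top" by real_asymp
    then show ?thesis using True by simp
  next
    case False
    \<comment> \<open>Chosen so that the \<open>m\<close>-th power of \<open>X powr e\<close> is
      \<open>X\<close> itself.\<close>
    define e where "e = 1 / real m"
    have e: "e > 0" using False by (simp add: e_def)
    have "((\<lambda>X. A * ln X / X powr e) \<longlongrightarrow> 0) at_top" using e by real_asymp
    then have "((\<lambda>X. (A * ln X / X powr e) ^ m) \<longlongrightarrow> 0 ^ m) at_top" by (rule tendsto_power)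
    moreover have "((\<lambda>X::real. 2 * X / (X - 1)) \<longlongrightarrow> 2) at_top" by real_asymp
    ultimately have "((\<lambda>X. (A * ln X / X powr e) ^ m * (2 * X / (X - 1))) \<longlongrightarrow> 0 ^ m * 2) at_top"
      by (rule tendsto_mult)
    then have "((\<lambda>X. (A * ln X / X powr e) ^ m * (2 * X / (X - 1))) \<longlongrightarrow> 0) at_top"
      using False by (simp only: power_0_left if_False mult_zero_left)
    moreover have "eventually (\<lambda>X. (A * ln X / X powr e) ^ m * (2 * X / (X - 1)) = (A * ln X) ^ m * (2 / (X - 1))) at_top"
      using eventually_gt_at_top [of 1]
    proof eventually_elim
      case (elim X)
      have "(X powr e) ^ m = X"
        using elim False by (simp add: powr_realpow [symmetric] powr_powr e_def)
      then show ?case using elim by (simp add: power_divide)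
    qed
    ultimately show ?thesis by (rule Lim_transform_eventually)
  qed
qed simp

definition err :: "real \<Rightarrow> nat \<Rightarrow> real" where
  "err X j = carry_sum.err (k X) (N X) (c X) j"

text \<open>There are at most \<open>k\<close> primes with weights at most \<open>k\<close>, so
  \<open>C \<le> k^2\<close>; each step of the moment comparison costs a further factor
  \<open>k\<close> for the period, whence the exponent \<open>3 * j\<close>.\<close>

lemma err_tendsto: "((\<lambda>X. err X j) \<longlongrightarrow> 0) at_top"
proof (rule tendsto_sandwich [OF _ _ tendsto_const polylog [of "3 * j"]])
  have C: "0 \<le> carry_sum.C (k X) (c X) \<and> carry_sum.C (k X) (c X) \<le> K X * K X" if "good X" for X
  proof -
    interpret cs: carry_sum "k X" "\<lceil>X\<rceil>" "N X" "c X" using that by (rule carry_sum_good)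
    have "cs.C \<le> (\<Sum>p\<in>primes_upto (k X). K X)" unfolding cs.C_def
    proof (rule sum_mono)
      fix p assume p: "p \<in> primes_upto (k X)"
      have "c X p \<le> \<bar>ln (real_of_int p)\<bar> / 1"
        unfolding c_def using that by (intro divide_left_mono) (auto simp: good_def)
      also have "\<dots> \<le> K X" using ln_prime_bounds [OF p] by simp
      finally show "c X p \<le> K X" .
    qed
    also have "\<dots> = real (card (primes_upto (k X))) * K X" by simp
    also have "\<dots> \<le> K X * K X"
      using that by (intro mult_right_mono card_primes_upto_le) (auto simp: good_def)
    finally show ?thesis using cs.C0 by simp
  qed
  show "eventually (\<lambda>X. 0 \<le> err X j) at_top"
    using eventually_good
  proof eventually_elim
    case (elim X)
    interpret cs: carry_sum "k X" "\<lceil>X\<rceil>" "N X" "c X" using elim by (rule carry_sum_good)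
    show ?case using C [OF elim] cs.N cs.k unfolding err_def cs.err_def by simp
  qed
  show "eventually (\<lambda>X. err X j \<le> K X ^ (3 * j) * (2 / real_of_int (N X))) at_top"
    using eventually_good
  proof eventually_elim
    case (elim X)
    interpret cs: carry_sum "k X" "\<lceil>X\<rceil>" "N X" "c X" using elim by (rule carry_sum_good)
    have "carry_sum.C (k X) (c X) ^ j * K X ^ j \<le> (K X * K X) ^ j * K X ^ j"
      using C [OF elim] cs.k by (intro mult_right_mono power_mono) auto
    also have "\<dots> = K X ^ (3 * j)"
      by (simp add: power_mult_distrib [symmetric] power_mult power3_eq_cube)
    finally show ?case unfolding err_def cs.err_def
      using cs.N by (intro mult_right_mono) auto
  qed
qed

text \<open>The order of choices is decisive: \<open>t\<close> fixes
  \<open>l = 2 \<bar>t\<bar> + 1\<close>, which makes the tail at most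
  \<open>(1 / 4)^r * (4 * exp (l^2))\<close>; then \<open>\<epsilon>\<close> fixes \<open>r\<close>,
  and only afterwards \<open>X\<close> grows. Each of the three errors takes
  \<open>\<epsilon> / 3\<close>.\<close>

lemma char_s_tendsto: "((\<lambda>X. E X (\<lambda>n. iexp (t * s X n))) \<longlongrightarrow> of_real (exp (- t\<^sup>2 / 2))) at_top"
proof (rule tendstoI)
  fix \<epsilon> :: real assume \<epsilon>: "\<epsilon> > 0"
  define l where "l = 2 * \<bar>t\<bar> + 1"
  have l: "l > 0" "\<bar>t\<bar> / l \<le> 1 / 2" by (auto simp: l_def divide_simps)
  have "(\<lambda>r. (1 / 4 :: real) ^ r * (4 * exp (l\<^sup>2))) \<longlonglongrightarrow> 0 * (4 * exp (l\<^sup>2))"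
    by (intro tendsto_mult tendsto_const LIMSEQ_realpow_zero) auto
  then have "eventually (\<lambda>r. (1 / 4 :: real) ^ r * (4 * exp (l\<^sup>2)) < \<epsilon> / 3) sequentially"
    by (rule order_tendstoD(2)) (use \<epsilon> in simp)
  from eventually_happens' [OF sequentially_bot eventually_conj [OF this eventually_gt_at_top [of 0]]]
  obtain r :: nat where r: "(1 / 4 :: real) ^ r * (4 * exp (l\<^sup>2)) < \<epsilon> / 3" "r > 0" by auto
  have "((\<lambda>X. \<Sum>j\<le>2 * r. \<bar>t\<bar> ^ j / fact j * err X j) \<longlongrightarrow> (\<Sum>j\<le>2 * r. \<bar>t\<bar> ^ j / fact j * 0)) at_top"
    by (intro tendsto_sum tendsto_mult tendsto_const err_tendsto)
  then have e1: "eventually (\<lambda>X. (\<Sum>j\<le>2 * r. \<bar>t\<bar> ^ j / fact j * err X j) < \<epsilon> / 3) at_top"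
    by (rule order_tendstoD(2)) (use \<epsilon> in simp)
  define cm where "cm = (\<lambda>X. ln (K X) / sqrt (Vk X))"
  have cm: "(cm \<longlongrightarrow> 0) at_top" unfolding cm_def by (rule lnK_over_sqrt_V)
  have "((\<lambda>X. l * cm X) \<longlongrightarrow> l * 0) at_top" by (intro tendsto_mult tendsto_const cm)
  then have e2: "eventually (\<lambda>X. l * cm X < 1) at_top" by (rule order_tendstoD(2)) simp
  have "((\<lambda>X. \<bar>t\<bar> ^ 3 * cm X / 6 + t ^ 4 * (cm X)\<^sup>2 / 4) \<longlongrightarrow> \<bar>t\<bar> ^ 3 * 0 / 6 + t ^ 4 * 0\<^sup>2 / 4) at_top"
    by (intro tendsto_intros cm) auto
  then have e3: "eventually (\<lambda>X. \<bar>t\<bar> ^ 3 * cm X / 6 + t ^ 4 * (cm X)\<^sup>2 / 4 < \<epsilon> / 3) at_top"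
    by (rule order_tendstoD(2)) (use \<epsilon> in simp)
  show "eventually (\<lambda>X. dist (E X (\<lambda>n. iexp (t * s X n))) (of_real (exp (- t\<^sup>2 / 2))) < \<epsilon>) at_top"
    using eventually_good e1 e2 e3
  proof eventually_elim
    case (elim X)
    interpret cs: carry_sum "k X" "\<lceil>X\<rceil>" "N X" "c X" using elim(1) by (rule carry_sum_good)
    have cX: "c X p \<le> cm X" if "p \<in> primes_upto (k X)" for p
    proof -
      have p: "p \<ge> 2" "p \<le> k X" using that by (auto simp: primes_upto_def prime_ge_2_int)
      then have "\<bar>ln (real_of_int p)\<bar> \<le> ln (K X)" by simp
      then show ?thesis unfolding c_def cm_def using elim(1) by (intro divide_right_mono) (auto simp: good_def)
    qed
    have lc: "l * c X p \<le> 1" if "p \<in> primes_upto (k X)" for p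
      using mult_left_mono [OF cX [OF that], of l] l(1) elim(3) by linarith
    have "(\<bar>t\<bar> / l) ^ (2 * r) \<le> (1 / 2) ^ (2 * r)" using l by (intro power_mono) auto
    also have "\<dots> = (1 / 4 :: real) ^ r" by (simp add: power_mult power_one_over power2_eq_square)
    finally have "2 * ((\<bar>t\<bar> / l) ^ (2 * r) * (2 * exp (l\<^sup>2))) \<le> (1 / 4) ^ r * (4 * exp (l\<^sup>2))"
      using mult_right_mono [of "(\<bar>t\<bar> / l) ^ (2 * r)" "(1 / 4) ^ r" "4 * exp (l\<^sup>2)"] by simp
    then have a: "norm (E X (\<lambda>n. iexp (t * s X n)) - avg {0..<\<Prod>(primes_upto (k X))} (\<lambda>n. iexp (t * s X n))) < \<epsilon> / 3 + \<epsilon> / 3"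
      using cs.char_compare [OF l(1) lc r(2), of t] elim(2) r(1)
      unfolding I_eq s_def err_def by linarith
    have b: "norm (avg {0..<\<Prod>(primes_upto (k X))} (\<lambda>n. iexp (t * s X n)) - of_real (exp (- t\<^sup>2 / 2))) < \<epsilon> / 3"
      using cs.char_limit [OF cX, of t] elim(4) unfolding s_def by linarith
    show ?case unfolding dist_norm
      using norm_diff_triangle_less [OF a b] by simp
  qed
qed

lemma s_moments: "((\<lambda>X. E X (s X)) \<longlongrightarrow> 0) at_top" "((\<lambda>X. E X (\<lambda>n. (s X n)\<^sup>2)) \<longlongrightarrow> 1) at_top"
proof -
  have "eventually (\<lambda>X. norm (E X (s X)) \<le> err X 1) at_top"
    using eventually_good
  proof eventually_elim
    case (elim X)
    interpret cs: carry_sum "k X" "\<lceil>X\<rceil>" "N X" "c X" using elim by (rule carry_sum_good)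
    show ?case using cs.moment_compare [of 1] cs.avgQ_s unfolding I_eq err_def s_def by simp
  qed
  then show "((\<lambda>X. E X (s X)) \<longlongrightarrow> 0) at_top" by (rule Lim_null_comparison) (rule err_tendsto)
  have "eventually (\<lambda>X. norm (E X (\<lambda>n. (s X n)\<^sup>2) - 1) \<le> err X 2) at_top"
    using eventually_good
  proof eventually_elim
    case (elim X)
    interpret cs: carry_sum "k X" "\<lceil>X\<rceil>" "N X" "c X" using elim by (rule carry_sum_good)
    show ?case using cs.moment_compare [of 2] cs.avgQ_s_squared unfolding I_eq err_def s_def by simp
  qed
  then have "((\<lambda>X. E X (\<lambda>n. (s X n)\<^sup>2) - 1) \<longlongrightarrow> 0) at_top" by (rule Lim_null_comparison) (rule err_tendsto)
  then show "((\<lambda>X. E X (\<lambda>n. (s X n)\<^sup>2)) \<longlongrightarrow> 1) at_top" by (rule Lim_null [THEN iffD2])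
qed

lemma two_power_L: "X \<ge> 3 \<Longrightarrow> 2 * X \<le> 2 ^ L X" "X \<ge> 3 \<Longrightarrow> real (L X) \<le> log 2 (2 * X) + 1" "X \<ge> 3 \<Longrightarrow> L X \<ge> 1"
proof -
  assume X: "X \<ge> 3"
  have lg: "log 2 (2 * X) \<ge> 1" using X by (simp add: le_log_iff)
  have LX: "real (L X) = real_of_int \<lceil>log 2 (2 * X)\<rceil>" unfolding L_def using lg by simp
  have "log 2 (2 * X) \<le> real (L X)" unfolding LX by (rule le_of_int_ceiling)
  then have "2 * X \<le> 2 powr (real (L X))" using X by (simp add: log_le_iff)
  then show "2 * X \<le> 2 ^ L X" by (simp add: powr_realpow)
  show "real (L X) \<le> log 2 (2 * X) + 1" unfolding LX by linarith
  have "real (L X) \<ge> 1" unfolding LX using lg by linarith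
  then show "L X \<ge> 1" by simp
qed

lemma R_second_moment: "((\<lambda>X. E X (\<lambda>n. (R X n)\<^sup>2)) \<longlongrightarrow> 0) at_top"
proof -
  obtain B where B: "\<And>k. (\<Sum>p\<in>primes_upto k. (ln (real_of_int p))\<^sup>2 / (real_of_int p)\<^sup>2) \<le> B"
    using sum_ln_squared_bounded by blast
  \<comment> \<open>The constants are those of \<open>higher_part_second_moment\<close>, doubled by
    \<open>(w - \<tau>)^2 \<le> 2 w^2 + 2 \<tau>^2\<close>.\<close>
  define b1 where "b1 = (\<lambda>X. 64 * B * (K X / Vk X))"
  define b2 where "b2 = (\<lambda>X. 24 * ((A * ln X) ^ 6 * (log 2 (2 * X) + 1)\<^sup>2 / (X - 1)))"
  have lim: "((\<lambda>X. b1 X + b2 X + 2 * (A * ln X) ^ 6 / X\<^sup>2) \<longlongrightarrow> 64 * B * 0 + 0 + 0) at_top"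
  proof (intro tendsto_add)
    show "(b1 \<longlongrightarrow> 64 * B * 0) at_top" unfolding b1_def by (intro tendsto_mult tendsto_const K_over_V)
    show "(b2 \<longlongrightarrow> 0) at_top" unfolding b2_def using A by real_asymp
    show "((\<lambda>X. 2 * (A * ln X) ^ 6 / X\<^sup>2) \<longlongrightarrow> 0) at_top" using A by real_asymp
  qed
  have "eventually (\<lambda>X. norm (E X (\<lambda>n. (R X n)\<^sup>2)) \<le> b1 X + b2 X + 2 * (A * ln X) ^ 6 / X\<^sup>2) at_top"
    using eventually_good
  proof eventually_elim
    case (elim X)
    have X: "X \<ge> 3" and kX: "k X \<ge> 2" and KA: "K X \<le> A * ln X" and V1: "Vk X \<ge> 1" using elim by (auto simp: good_def)
    define H where "H = E X (\<lambda>n. (higher_part (k X) (L X) n)\<^sup>2)"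
    define \<tau> where "\<tau> = mean_tail (k X) (L X)"
    have I: "finite (dyadic_ints X)" "dyadic_ints X \<noteq> {}" using finite_dyadic_ints dyadic_ints_nonempty [OF X] by auto
    have "E X (\<lambda>n. (R X n)\<^sup>2) \<le> E X (\<lambda>n. 2 / Vk X * (higher_part (k X) (L X) n)\<^sup>2 + 2 / Vk X * \<tau>\<^sup>2)"
    proof (rule avg_mono)
      fix n
      define w where "w = higher_part (k X) (L X) n"
      have "(w - \<tau>)\<^sup>2 \<le> 2 * w\<^sup>2 + 2 * \<tau>\<^sup>2"
        using zero_le_power2 [of "w + \<tau>"] unfolding power2_sum power2_diff by linarith
      then have "(w - \<tau>)\<^sup>2 / Vk X \<le> (2 * w\<^sup>2 + 2 * \<tau>\<^sup>2) / Vk X" using V1 by (intro divide_right_mono) auto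
      then show "(R X n)\<^sup>2 \<le> 2 / Vk X * (higher_part (k X) (L X) n)\<^sup>2 + 2 / Vk X * \<tau>\<^sup>2"
        using V1 by (simp add: R_def w_def [symmetric] \<tau>_def [symmetric] power_divide add_divide_distrib)
    qed
    also have "\<dots> = 2 / Vk X * H + 2 / Vk X * \<tau>\<^sup>2"
      unfolding avg_add avg_cmult avg_const [OF I] H_def ..
    also have "\<dots> \<le> (b1 X + b2 X) + 2 * (A * ln X) ^ 6 / X\<^sup>2"
    proof (rule add_mono)
      define \<nu> where "\<nu> = real_of_int (N X)"
      have \<nu>: "\<nu> \<ge> X - 1" using N_bounds(2) [OF X] by (simp add: \<nu>_def)
      define w where "w = 12 * K X ^ 6 * (real (L X))\<^sup>2 / \<nu>"
      have "H \<le> 32 * B * K X + w"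
        unfolding H_def I_eq w_def \<nu>_def
        by (rule higher_part_second_moment [OF kX N_bounds(1) [OF X] two_power_L(3) [OF X] B])
      then have "2 / Vk X * H \<le> 2 / Vk X * (32 * B * K X + w)" using V1 by (intro mult_left_mono) auto
      also have "\<dots> = b1 X + 2 * w / Vk X" by (simp add: b1_def distrib_left)
      also have "2 * w / Vk X \<le> b2 X"
      proof -
        have w0: "w \<ge> 0" unfolding w_def using \<nu> X kX by (intro divide_nonneg_nonneg mult_nonneg_nonneg) auto
        have "2 * w / Vk X \<le> 2 * w / 1" using V1 w0 by (intro divide_left_mono) auto
        also have "\<dots> = 24 * (K X ^ 6 * (real (L X))\<^sup>2 / \<nu>)" by (simp add: w_def)
        also have "\<dots> \<le> b2 X" unfolding b2_def
          using KA kX \<nu> X two_power_L(2) [OF X]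
          by (intro mult_left_mono frac_le mult_mono power_mono) auto
        finally show ?thesis .
      qed
      finally show "2 / Vk X * H \<le> b1 X + b2 X" by simp
      have "\<tau> \<le> K X ^ 3 / 2 ^ L X" "0 \<le> \<tau>" unfolding \<tau>_def by (rule mean_tail_bounds [OF kX])+
      moreover have "K X ^ 3 / 2 ^ L X \<le> (A * ln X) ^ 3 / X"
        using KA kX X two_power_L(1) [OF X] by (intro frac_le power_mono) auto
      ultimately have "\<tau>\<^sup>2 \<le> ((A * ln X) ^ 3 / X)\<^sup>2" by (intro power_mono) auto
      also have "\<dots> = (A * ln X) ^ 6 / X\<^sup>2" by (simp add: power_divide power_mult [symmetric])
      finally have "2 * \<tau>\<^sup>2 \<le> 2 * (A * ln X) ^ 6 / X\<^sup>2" by simp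
      moreover have "2 * \<tau>\<^sup>2 / Vk X \<le> 2 * \<tau>\<^sup>2 / 1" using V1 by (intro divide_left_mono) auto
      ultimately show "2 / Vk X * \<tau>\<^sup>2 \<le> 2 * (A * ln X) ^ 6 / X\<^sup>2" by simp
    qed
    finally show ?case using avg_nonneg [of "dyadic_ints X" "\<lambda>n. (R X n)\<^sup>2"] by simp
  qed
  then show ?thesis by (rule Lim_null_comparison) (use lim in simp)
qed

lemma Z_eq:
  assumes "good X" "n \<in> dyadic_ints X"
  shows "Z X n = s X n + R X n"
proof -
  have X: "X \<ge> 3" and kX: "k X \<ge> 2" and V1: "Vk X \<ge> 1" and KX: "K X \<le> X" using assms by (auto simp: good_def)
  have n: "X \<le> real_of_int n" "real_of_int n < 2 * X" using assms(2) by (auto simp: dyadic_ints_def)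
  interpret cs: carry_sum "k X" "\<lceil>X\<rceil>" "N X" "c X" using assms(1) by (rule carry_sum_good)
  have "real_of_int n < 2 ^ L X" using n two_power_L(1) [OF X] by linarith
  then have "real_of_int n < real_of_int (2 ^ L X)" by simp
  then have "n < 2 ^ L X" by (simp only: of_int_less_iff)
  moreover have "k X \<le> n" using n KX by linarith
  ultimately have "U (k X) n - mean_const (k X) = (\<Sum>p\<in>primes_upto (k X). ln (real_of_int p) * carry (k X) p n)
      + higher_part (k X) (L X) n - mean_tail (k X) (L X)"
    using kX two_power_L(3) [OF X] by (intro U_decomposition) auto
  moreover have "(\<Sum>p\<in>primes_upto (k X). ln (real_of_int p) * carry (k X) p n) = sqrt (Vk X) * s X n"
    unfolding s_def cs.s_def sum_distrib_left
  proof (rule sum.cong [OF refl])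
    fix p assume "p \<in> primes_upto (k X)"
    then show "ln (real_of_int p) * carry (k X) p n = sqrt (Vk X) * (c X p * carry (k X) p n)"
      using ln_prime_bounds(1) [of p "k X"] V1 by (simp add: c_def)
  qed
  ultimately have "U (k X) n - mean_const (k X) = sqrt (Vk X) * s X n + (higher_part (k X) (L X) n - mean_tail (k X) (L X))"
    by simp
  then show ?thesis using V1 unfolding Z_def R_def by (simp add: add_divide_distrib)
qed

lemma E_cong: "(\<And>n. n \<in> dyadic_ints X \<Longrightarrow> f n = g n) \<Longrightarrow> E X f = E X g"
  unfolding avg_def by (simp cong: sum.cong)

lemma good_dyadic: "good X \<Longrightarrow> finite (dyadic_ints X)" "good X \<Longrightarrow> dyadic_ints X \<noteq> {}"
  using finite_dyadic_ints dyadic_ints_nonempty by (auto simp: good_def)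

lemma R_abs: "((\<lambda>X. E X (\<lambda>n. \<bar>R X n\<bar>)) \<longlongrightarrow> 0) at_top"
proof (rule Lim_null_comparison)
  show "eventually (\<lambda>X. norm (E X (\<lambda>n. \<bar>R X n\<bar>)) \<le> sqrt (E X (\<lambda>n. (R X n)\<^sup>2))) at_top"
    using eventually_good
  proof eventually_elim
    case (elim X)
    show ?case using avg_abs_le_sqrt [OF good_dyadic [OF elim], of "R X"] avg_nonneg [of "dyadic_ints X" "\<lambda>n. \<bar>R X n\<bar>"] by simp
  qed
  show "((\<lambda>X. sqrt (E X (\<lambda>n. (R X n)\<^sup>2))) \<longlongrightarrow> 0) at_top"
    using tendsto_real_sqrt [OF R_second_moment] by simp
qed

lemma Z_first: "((\<lambda>X. E X (Z X)) \<longlongrightarrow> 0) at_top"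
proof -
  have "((\<lambda>X. E X (R X)) \<longlongrightarrow> 0) at_top"
    by (rule Lim_null_comparison [OF _ R_abs]) (simp add: abs_avg_le)
  from tendsto_add [OF s_moments(1) this] have "((\<lambda>X. E X (s X) + E X (R X)) \<longlongrightarrow> 0) at_top" by simp
  then show ?thesis
  proof (rule Lim_transform_eventually)
    show "eventually (\<lambda>X. E X (s X) + E X (R X) = E X (Z X)) at_top"
      using eventually_good
    proof eventually_elim
      case (elim X)
      show ?case unfolding avg_add [symmetric] by (rule E_cong) (simp add: Z_eq [OF elim])
    qed
  qed
qed

text \<open>Expand the square of \<open>s + R\<close>; Cauchy-Schwarz disposes of the mixed term, as
  the second moment of \<open>s\<close> is bounded and that of \<open>R\<close> vanishes in the
  limit.\<close>

lemma Z_second: "((\<lambda>X. E X (\<lambda>n. (Z X n)\<^sup>2)) \<longlongrightarrow> 1) at_top"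
proof -
  have "((\<lambda>X. E X (\<lambda>n. s X n * R X n)) \<longlongrightarrow> 0) at_top"
  proof (rule Lim_null_comparison)
    show "eventually (\<lambda>X. norm (E X (\<lambda>n. s X n * R X n)) \<le> sqrt (E X (\<lambda>n. (s X n)\<^sup>2) * E X (\<lambda>n. (R X n)\<^sup>2))) at_top"
      using eventually_good by eventually_elim (simp add: avg_mult_le_sqrt good_dyadic)
    show "((\<lambda>X. sqrt (E X (\<lambda>n. (s X n)\<^sup>2) * E X (\<lambda>n. (R X n)\<^sup>2))) \<longlongrightarrow> 0) at_top"
      using tendsto_real_sqrt [OF tendsto_mult [OF s_moments(2) R_second_moment]] by simp
  qed
  from tendsto_add [OF tendsto_add [OF s_moments(2) tendsto_mult [OF tendsto_const [of 2] this]] R_second_moment]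
  have "((\<lambda>X. E X (\<lambda>n. (s X n)\<^sup>2) + 2 * E X (\<lambda>n. s X n * R X n) + E X (\<lambda>n. (R X n)\<^sup>2)) \<longlongrightarrow> 1) at_top" by simp
  then show ?thesis
  proof (rule Lim_transform_eventually)
    show "eventually (\<lambda>X. E X (\<lambda>n. (s X n)\<^sup>2) + 2 * E X (\<lambda>n. s X n * R X n) + E X (\<lambda>n. (R X n)\<^sup>2) = E X (\<lambda>n. (Z X n)\<^sup>2)) at_top"
      using eventually_good
    proof eventually_elim
      case (elim X)
      show ?case unfolding avg_cmult [symmetric] avg_add [symmetric]
        by (rule E_cong) (simp add: Z_eq [OF elim] power2_sum)
    qed
  qed
qed

lemma char_Z_tendsto: "((\<lambda>X. E X (\<lambda>n. iexp (t * Z X n))) \<longlongrightarrow> of_real (exp (- t\<^sup>2 / 2))) at_top"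
proof -
  have "((\<lambda>X. E X (\<lambda>n. iexp (t * Z X n)) - E X (\<lambda>n. iexp (t * s X n))) \<longlongrightarrow> 0) at_top"
  proof (rule Lim_null_comparison)
    show "eventually (\<lambda>X. norm (E X (\<lambda>n. iexp (t * Z X n)) - E X (\<lambda>n. iexp (t * s X n))) \<le> \<bar>t\<bar> * E X (\<lambda>n. \<bar>R X n\<bar>)) at_top"
      using eventually_good
    proof eventually_elim
      case (elim X)
      have "E X (\<lambda>n. \<bar>Z X n - s X n\<bar>) = E X (\<lambda>n. \<bar>R X n\<bar>)"
        by (rule E_cong) (simp add: Z_eq [OF elim])
      then show ?case using norm_avg_iexp_diff_le [of "dyadic_ints X" t "Z X" "s X"] by simp
    qed
    show "((\<lambda>X. \<bar>t\<bar> * E X (\<lambda>n. \<bar>R X n\<bar>)) \<longlongrightarrow> 0) at_top"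
      using tendsto_mult [OF tendsto_const [of "\<bar>t\<bar>"] R_abs] by simp
  qed
  from tendsto_add [OF this char_s_tendsto [of t]] show ?thesis by simp
qed

section \<open>Renormalisation by the actual mean and standard deviation\<close>

definition \<mu> :: "real \<Rightarrow> real" where "\<mu> X = E X (Z X)"
definition \<rho> :: "real \<Rightarrow> real" where "\<rho> X = sqrt (E X (\<lambda>n. (Z X n)\<^sup>2) - (\<mu> X)\<^sup>2)"

lemma \<rho>_tendsto: "(\<rho> \<longlongrightarrow> 1) at_top"
proof -
  have "((\<lambda>X. sqrt (E X (\<lambda>n. (Z X n)\<^sup>2) - (\<mu> X)\<^sup>2)) \<longlongrightarrow> sqrt (1 - 0\<^sup>2)) at_top"
    unfolding \<mu>_def by (intro tendsto_real_sqrt tendsto_diff tendsto_power Z_first Z_second)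
  then show ?thesis unfolding \<rho>_def [abs_def] by simp
qed

lemma U_Z: "good X \<Longrightarrow> U (k X) n = mean_const (k X) + sqrt (Vk X) * Z X n"
  by (simp add: Z_def good_def)

lemma expectation_U: 
  assumes "good X"
  shows "measure_pmf.expectation (unif X) (U (k X)) = mean_const (k X) + sqrt (Vk X) * \<mu> X"
proof -
  have X: "X \<ge> 3" using assms by (simp add: good_def)
  have "U (k X) = (\<lambda>n. mean_const (k X) + sqrt (Vk X) * Z X n)"
    using U_Z [OF assms] by (rule ext)
  then show ?thesis
    by (simp only: integral_unif [OF X] avg_add avg_cmult avg_const [OF good_dyadic [OF assms]] \<mu>_def)
qed

lemma variance_U:
  assumes "good X"
  shows "measure_pmf.variance (unif X) (U (k X)) = Vk X * (E X (\<lambda>n. (Z X n)\<^sup>2) - (\<mu> X)\<^sup>2)"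
proof -
  have X: "X \<ge> 3" and V: "Vk X \<ge> 1" using assms by (auto simp: good_def)
  have "(U (k X) n - measure_pmf.expectation (unif X) (U (k X)))\<^sup>2 = Vk X * ((Z X n)\<^sup>2 - 2 * \<mu> X * Z X n + (\<mu> X)\<^sup>2)" for n
  proof -
    have "U (k X) n - measure_pmf.expectation (unif X) (U (k X)) = sqrt (Vk X) * (Z X n - \<mu> X)"
      unfolding expectation_U [OF assms] U_Z [OF assms, of n] by (simp add: right_diff_distrib)
    then show ?thesis using V by (simp add: power_mult_distrib power2_diff mult_ac)
  qed
  then have "measure_pmf.variance (unif X) (U (k X)) = Vk X * (E X (\<lambda>n. (Z X n)\<^sup>2) - 2 * \<mu> X * \<mu> X + (\<mu> X)\<^sup>2)"
    unfolding \<mu>_def by (simp only: integral_unif [OF X] avg_add avg_diff avg_cmult avg_const [OF good_dyadic [OF assms]])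
  then show ?thesis by (simp add: power2_eq_square)
qed

text \<open>Slutsky's argument for characteristic functions: the affine change from \<open>Z\<close>
  is small in mean, since \<open>\<rho>\<close> tends to \<open>1\<close>, \<open>\<mu>\<close>
  tends to \<open>0\<close> and the second moment of \<open>Z\<close> stays bounded.\<close>

lemma char_normalized_tendsto:
  "((\<lambda>X. E X (\<lambda>n. iexp (t * ((Z X n - \<mu> X) / \<rho> X)))) \<longlongrightarrow> of_real (exp (- t\<^sup>2 / 2))) at_top"
proof -
  have "((\<lambda>X. E X (\<lambda>n. iexp (t * ((Z X n - \<mu> X) / \<rho> X))) - E X (\<lambda>n. iexp (t * Z X n))) \<longlongrightarrow> 0) at_top"
  proof (rule Lim_null_comparison)
    show "eventually (\<lambda>X. norm (E X (\<lambda>n. iexp (t * ((Z X n - \<mu> X) / \<rho> X))) - E X (\<lambda>n. iexp (t * Z X n))) \<le>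
       \<bar>t\<bar> * (\<bar>1 / \<rho> X - 1\<bar> * sqrt (E X (\<lambda>n. (Z X n)\<^sup>2)) + \<bar>\<mu> X / \<rho> X\<bar>)) at_top"
      using eventually_good
    proof eventually_elim
      case (elim X)
      have "E X (\<lambda>n. \<bar>(Z X n - \<mu> X) / \<rho> X - Z X n\<bar>) \<le> E X (\<lambda>n. \<bar>1 / \<rho> X - 1\<bar> * \<bar>Z X n\<bar> + \<bar>\<mu> X / \<rho> X\<bar>)"
      proof (rule avg_mono)
        fix n
        have "(Z X n - \<mu> X) / \<rho> X - Z X n = (1 / \<rho> X - 1) * Z X n - \<mu> X / \<rho> X"
          by (simp add: diff_divide_distrib left_diff_distrib)
        then show "\<bar>(Z X n - \<mu> X) / \<rho> X - Z X n\<bar> \<le> \<bar>1 / \<rho> X - 1\<bar> * \<bar>Z X n\<bar> + \<bar>\<mu> X / \<rho> X\<bar>"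
          using abs_triangle_ineq4 [of "(1 / \<rho> X - 1) * Z X n" "\<mu> X / \<rho> X"] by (simp only: abs_mult)
      qed
      also have "\<dots> = \<bar>1 / \<rho> X - 1\<bar> * E X (\<lambda>n. \<bar>Z X n\<bar>) + \<bar>\<mu> X / \<rho> X\<bar>"
        by (simp only: avg_add avg_cmult avg_const [OF good_dyadic [OF elim]])
      also have "\<dots> \<le> \<bar>1 / \<rho> X - 1\<bar> * sqrt (E X (\<lambda>n. (Z X n)\<^sup>2)) + \<bar>\<mu> X / \<rho> X\<bar>"
        by (intro add_right_mono mult_left_mono avg_abs_le_sqrt good_dyadic elim) simp
      finally have "\<bar>t\<bar> * E X (\<lambda>n. \<bar>(Z X n - \<mu> X) / \<rho> X - Z X n\<bar>) \<le>
          \<bar>t\<bar> * (\<bar>1 / \<rho> X - 1\<bar> * sqrt (E X (\<lambda>n. (Z X n)\<^sup>2)) + \<bar>\<mu> X / \<rho> X\<bar>)"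
        by (rule mult_left_mono) simp
      then show ?case
        using norm_avg_iexp_diff_le [of "dyadic_ints X" t "\<lambda>n. (Z X n - \<mu> X) / \<rho> X" "Z X"] by (rule order_trans [rotated])
    qed
    have "((\<lambda>X. \<bar>t\<bar> * (\<bar>1 / \<rho> X - 1\<bar> * sqrt (E X (\<lambda>n. (Z X n)\<^sup>2)) + \<bar>\<mu> X / \<rho> X\<bar>)) \<longlongrightarrow>
        \<bar>t\<bar> * (\<bar>1 / 1 - 1\<bar> * sqrt 1 + \<bar>0 / 1\<bar>)) at_top"
      unfolding \<mu>_def by (intro tendsto_intros \<rho>_tendsto Z_first Z_second) auto
    then show "((\<lambda>X. \<bar>t\<bar> * (\<bar>1 / \<rho> X - 1\<bar> * sqrt (E X (\<lambda>n. (Z X n)\<^sup>2)) + \<bar>\<mu> X / \<rho> X\<bar>)) \<longlongrightarrow> 0) at_top"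
      by simp
  qed
  from tendsto_add [OF this char_Z_tendsto [of t]] show ?thesis by simp
qed

lemma weak_convI:
  assumes "\<And>t. ((\<lambda>X. E X (\<lambda>n. iexp (t * f X n))) \<longlongrightarrow> of_real (exp (- t\<^sup>2 / 2))) at_top"
  shows "weak_conv_along (\<lambda>X. distr (measure_pmf (unif X)) borel (f X)) std_normal_distribution at_top"
proof (rule weak_conv_along_at_top_char [OF real_distribution_distr_pmf real_dist_normal_dist])
  fix t
  have "eventually (\<lambda>X. E X (\<lambda>n. iexp (t * f X n)) = char (distr (measure_pmf (unif X)) borel (f X)) t) at_top"
    using eventually_ge_at_top [of 3] by eventually_elim (simp add: char_distr_unif)
  with assms [of t] have "((\<lambda>X. char (distr (measure_pmf (unif X)) borel (f X)) t) \<longlongrightarrow> of_real (exp (- t\<^sup>2 / 2))) at_top"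
    by (rule Lim_transform_eventually)
  then show "((\<lambda>X. char (distr (measure_pmf (unif X)) borel (f X)) t) \<longlongrightarrow> char std_normal_distribution t) at_top"
    by (simp add: char_std_normal_distribution)
qed

section \<open>The assertions of the theorem\<close>

lemma clt_mean_const: "weak_conv_along
    (\<lambda>X. distr (measure_pmf (unif X)) borel (\<lambda>n. (U (k X) n - mean_const (k X)) / sqrt (V (k X))))
    std_normal_distribution at_top"
  using weak_convI [of Z, OF char_Z_tendsto] by (simp add: Z_def [abs_def])

text \<open>The factor \<open>sqrt (V k)\<close> cancels between the centred \<open>U\<close> and
  its standard deviation, so this is the renormalised \<open>Z\<close>.\<close>

lemma clt_expectation: "weak_conv_along
    (\<lambda>X. distr (measure_pmf (unif X)) borel
       (\<lambda>n. (U (k X) n - measure_pmf.expectation (unif X) (U (k X))) / sqrt (measure_pmf.variance (unif X) (U (k X)))))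
    std_normal_distribution at_top"
proof (rule weak_conv_along_cong)
  show "weak_conv_along (\<lambda>X. distr (measure_pmf (unif X)) borel (\<lambda>n. (Z X n - \<mu> X) / \<rho> X)) std_normal_distribution at_top"
    by (rule weak_convI [OF char_normalized_tendsto])
  show "eventually (\<lambda>X. distr (measure_pmf (unif X)) borel (\<lambda>n. (Z X n - \<mu> X) / \<rho> X) =
      distr (measure_pmf (unif X)) borel
       (\<lambda>n. (U (k X) n - measure_pmf.expectation (unif X) (U (k X))) / sqrt (measure_pmf.variance (unif X) (U (k X))))) at_top"
    using eventually_good
  proof eventually_elim
    case (elim X)
    have "(Z X n - \<mu> X) / \<rho> X = (U (k X) n - measure_pmf.expectation (unif X) (U (k X))) / sqrt (measure_pmf.variance (unif X) (U (k X)))" for n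
    proof -
      have "U (k X) n - measure_pmf.expectation (unif X) (U (k X)) = sqrt (Vk X) * (Z X n - \<mu> X)"
        unfolding expectation_U [OF elim] U_Z [OF elim, of n] by (simp add: right_diff_distrib)
      moreover have "sqrt (measure_pmf.variance (unif X) (U (k X))) = sqrt (Vk X) * \<rho> X"
        unfolding variance_U [OF elim] \<rho>_def by (rule real_sqrt_mult)
      moreover have "sqrt (Vk X) \<noteq> 0" using elim by (simp add: good_def)
      ultimately show ?thesis by simp
    qed
    then show ?case by (simp only:)
  qed
qed

lemma expectation_asymp: "(\<lambda>X. measure_pmf.expectation (unif X) (U (k X)) - mean_const (k X)) \<in> o[at_top](\<lambda>X. sqrt (V (k X)))"
proof (rule smalloI_tendsto)
  have "eventually (\<lambda>X. \<mu> X = (measure_pmf.expectation (unif X) (U (k X)) - mean_const (k X)) / sqrt (Vk X)) at_top"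
    using eventually_good
  proof eventually_elim
    case (elim X)
    have "sqrt (Vk X) \<noteq> 0" using elim by (simp add: good_def)
    then show ?case unfolding expectation_U [OF elim] by simp
  qed
  then show "((\<lambda>X. (measure_pmf.expectation (unif X) (U (k X)) - mean_const (k X)) / sqrt (Vk X)) \<longlongrightarrow> 0) at_top"
    using Z_first unfolding \<mu>_def by (rule Lim_transform_eventually [rotated])
  show "eventually (\<lambda>X. sqrt (Vk X) \<noteq> 0) at_top"
    using eventually_good by eventually_elim (simp add: good_def)
qed

lemma variance_asymp: "(\<lambda>X. measure_pmf.variance (unif X) (U (k X))) \<sim>[at_top] (\<lambda>X. V (k X))"
proof (rule asymp_equivI')
  have "((\<lambda>X. E X (\<lambda>n. (Z X n)\<^sup>2) - (\<mu> X)\<^sup>2) \<longlongrightarrow> 1 - 0\<^sup>2) at_top"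
    unfolding \<mu>_def by (intro tendsto_diff tendsto_power Z_first Z_second)
  then have "((\<lambda>X. E X (\<lambda>n. (Z X n)\<^sup>2) - (\<mu> X)\<^sup>2) \<longlongrightarrow> 1) at_top" by simp
  moreover have "eventually (\<lambda>X. E X (\<lambda>n. (Z X n)\<^sup>2) - (\<mu> X)\<^sup>2 = measure_pmf.variance (unif X) (U (k X)) / Vk X) at_top"
    using eventually_good
  proof eventually_elim
    case (elim X)
    have "Vk X \<noteq> 0" using elim by (simp add: good_def)
    then show ?case unfolding variance_U [OF elim] by simp
  qed
  ultimately show "((\<lambda>X. measure_pmf.variance (unif X) (U (k X)) / Vk X) \<longlongrightarrow> 1) at_top"
    by (rule Lim_transform_eventually)
qed

lemma V_asymp: "\<exists>\<epsilon> :: real \<Rightarrow> real. (\<epsilon> \<longlongrightarrow> 0) at_top \<and>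
        (\<forall>\<^sub>F X in at_top. V (k X) = (2 - ln (2 * pi) + \<epsilon> X) * real_of_int (k X) * ln (real_of_int (k X)))"
proof (intro exI conjI)
  show "((\<lambda>X. Vk X / (K X * ln (K X)) - (2 - ln (2 * pi))) \<longlongrightarrow> 0) at_top"
    using tendsto_diff [OF V_ratio tendsto_const [of "2 - ln (2 * pi)"]] by simp
  show "\<forall>\<^sub>F X in at_top. V (k X) = (2 - ln (2 * pi) + (Vk X / (K X * ln (K X)) - (2 - ln (2 * pi)))) * real_of_int (k X) * ln (real_of_int (k X))"
    using eventually_good
  proof eventually_elim
    case (elim X)
    then have "K X * ln (K X) \<noteq> 0" by (simp add: good_def)
    then show ?case by simp
  qed
qed

end

theorem theorem1p3:
  fixes A :: real and k :: "real \<Rightarrow> int"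
  assumes "A > 0"
    and "filterlim k at_top at_top"
    and "\<forall>\<^sub>F X in at_top. real_of_int (k X) \<le> A * ln X"
  shows
    "(\<exists>\<epsilon> :: real \<Rightarrow> real. (\<epsilon> \<longlongrightarrow> 0) at_top \<and>
        (\<forall>\<^sub>F X in at_top. V (k X) =
           (2 - ln (2 * pi) + \<epsilon> X) * real_of_int (k X) * ln (real_of_int (k X))))
     \<and> weak_conv_along
          (\<lambda>X. distr (measure_pmf (unif X)) borel
                 (\<lambda>n. (U (k X) n - mean_const (k X)) / sqrt (V (k X))))
          std_normal_distribution at_top
     \<and> (\<lambda>X. measure_pmf.expectation (unif X) (U (k X)) - mean_const (k X))
          \<in> o[at_top](\<lambda>X. sqrt (V (k X)))
     \<and> (\<lambda>X. measure_pmf.variance (unif X) (U (k X))) \<sim>[at_top] (\<lambda>X. V (k X))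
     \<and> weak_conv_along
          (\<lambda>X. distr (measure_pmf (unif X)) borel
                 (\<lambda>n. (U (k X) n - measure_pmf.expectation (unif X) (U (k X)))
                        / sqrt (measure_pmf.variance (unif X) (U (k X)))))
          std_normal_distribution at_top"
proof -
  interpret clt_setup A k
    using assms by unfold_locales
  show ?thesis
    by (intro conjI V_asymp clt_mean_const expectation_asymp variance_asymp clt_expectation)
qed

end
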